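(* Let $v\in S_n$ avoid $1324$ and $2143$, and let $k$ be the size of the largest square region in $\Gamma[v,w_0]$. Let $R,C\in\left(\!\binom{[m]}{n}\!\right)$. Then for every $k$-positive $m\times m$ matrix $M$, \[(-1)^{\ell(v)}\det\big(M(R,C)|_{\Gamma[v,w_0]}\big)\ge 0,\] with equality if and only if $\Gamma[v,w_0]$ is not $(R,C)$-admissible.
   Context: $\ell(v)$ is the Coxeter length (number of inversions) of $v$; $w_0$ is the longest element of $S_n$. $\Gamma[v,w_0]=\{(i,u_i):u\in[v,w_0],\ i\in[n]\}\subseteq[n]^2$ for the Bruhat interval $[v,w_0]$, with $(i,j)$ viewed as row $i$, column $j$. A square region of size $s$ in $P\subseteq[n]^2$ is a set $[a,a+s-1]\times[b,b+s-1]\subseteq P$. $\left(\!\binom{[m]}{n}\!\right)$ is the set of $n$-element multisets of $[m]$ listed weakly increasingly; $M(R,C)=(m_{r_i,c_j})_{i,j=1}^n$ for $R=\{r_1\le\dots\le r_n\}$, $C=\{c_1\le\dots\le c_n\}$, with row labels $r_i$ and column labels $c_j$. For $P\subseteq[n]^2$, $N|_P$ keeps the entries of $N$ in positions of $P$ and replaces the others by $0$. The support of row $r$ of $P$ is $\{c:(r,c)\in P\}$ (similarly for columns); $P$ is $(R,C)$-admissible if no two distinct rows with equal labels have equal support and no two distinct columns with equal labels have equal support. A matrix is $k$-positive if all its minors of size at most $k$ are positive. *)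

theory Defs
  imports
    "HOL-Combinatorics.Permutations"
    "HOL-Library.Multiset"
    "Jordan_Normal_Form.Determinant"
    "Jordan_Normal_Form.DL_Submatrix"
begin

(* Indices start at 0, as in Jordan_Normal_Form.Matrix: [n] is rendered as {..<n}, and the
   elements of S_n are the v with v permutes {..<n}, v i being the image of position i. *)

definition inversions :: "nat \<Rightarrow> (nat \<Rightarrow> nat) \<Rightarrow> (nat \<times> nat) set" where
  "inversions n v = {(i, j). i < j \<and> j < n \<and> v j < v i}"

definition coxeter_length :: "nat \<Rightarrow> (nat \<Rightarrow> nat) \<Rightarrow> nat" where
  "coxeter_length n v = card (inversions n v)"

definition longest_element :: "nat \<Rightarrow> (nat \<Rightarrow> nat)" where
  "longest_element n = (ARG_MAX (coxeter_length n) w. w permutes {..<n})"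

inductive bruhat_le :: "nat \<Rightarrow> (nat \<Rightarrow> nat) \<Rightarrow> (nat \<Rightarrow> nat) \<Rightarrow> bool" for n where
  refl: "u permutes {..<n} \<Longrightarrow> bruhat_le n u u"
| step: "bruhat_le n u w \<Longrightarrow> a < n \<Longrightarrow> b < n \<Longrightarrow>
    coxeter_length n w < coxeter_length n (w \<circ> transpose a b) \<Longrightarrow>
    bruhat_le n u (w \<circ> transpose a b)"

definition bruhat_interval :: "nat \<Rightarrow> (nat \<Rightarrow> nat) \<Rightarrow> (nat \<Rightarrow> nat) \<Rightarrow> (nat \<Rightarrow> nat) set" where
  "bruhat_interval n v w = {u. bruhat_le n v u \<and> bruhat_le n u w}"

definition Gamma_region :: "nat \<Rightarrow> (nat \<Rightarrow> nat) \<Rightarrow> (nat \<Rightarrow> nat) \<Rightarrow> (nat \<times> nat) set" where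
  "Gamma_region n v w = {(i, u i) | i u. u \<in> bruhat_interval n v w \<and> i < n}"

(* The pattern is given in one-line notation; only the relative order of its entries matters. *)
definition contains_pattern :: "nat \<Rightarrow> (nat \<Rightarrow> nat) \<Rightarrow> nat list \<Rightarrow> bool" where
  "contains_pattern n v p \<longleftrightarrow>
     (\<exists>f. strict_mono_on {..<length p} f \<and> f ` {..<length p} \<subseteq> {..<n} \<and>
          (\<forall>a<length p. \<forall>b<length p. v (f a) < v (f b) \<longleftrightarrow> p ! a < p ! b))"

abbreviation avoids :: "nat \<Rightarrow> (nat \<Rightarrow> nat) \<Rightarrow> nat list \<Rightarrow> bool" where
  "avoids n v p \<equiv> \<not> contains_pattern n v p"

(* The size 0 is always attained (by the empty region), so for finite P the maximum is taken
   over a nonempty finite set. *)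
definition largest_square :: "(nat \<times> nat) set \<Rightarrow> nat" where
  "largest_square P = Max {s. \<exists>a b. {a..<a + s} \<times> {b..<b + s} \<subseteq> P}"

definition index_multisets :: "nat \<Rightarrow> nat \<Rightarrow> nat multiset set" where
  "index_multisets m n = {R. set_mset R \<subseteq> {..<m} \<and> size R = n}"

definition label :: "nat multiset \<Rightarrow> nat \<Rightarrow> nat" where
  "label R i = sorted_list_of_multiset R ! i"

definition gen_submatrix :: "'a mat \<Rightarrow> nat multiset \<Rightarrow> nat multiset \<Rightarrow> 'a mat" where
  "gen_submatrix M R C = mat (size R) (size C) (\<lambda>(i, j). M $$ (label R i, label C j))"

definition restrict_mat :: "'a::zero mat \<Rightarrow> (nat \<times> nat) set \<Rightarrow> 'a mat" where
  "restrict_mat N P =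
     mat (dim_row N) (dim_col N) (\<lambda>(i, j). if (i, j) \<in> P then N $$ (i, j) else 0)"

definition row_support :: "(nat \<times> nat) set \<Rightarrow> nat \<Rightarrow> nat set" where
  "row_support P r = {c. (r, c) \<in> P}"

definition col_support :: "(nat \<times> nat) set \<Rightarrow> nat \<Rightarrow> nat set" where
  "col_support P c = {r. (r, c) \<in> P}"

definition admissible ::
    "nat \<Rightarrow> nat multiset \<Rightarrow> nat multiset \<Rightarrow> (nat \<times> nat) set \<Rightarrow> bool" where
  "admissible n R C P \<longleftrightarrow>
     (\<forall>i<n. \<forall>j<n. i \<noteq> j \<longrightarrow> label R i = label R j \<longrightarrow> row_support P i \<noteq> row_support P j) \<and>
     (\<forall>i<n. \<forall>j<n. i \<noteq> j \<longrightarrow> label C i = label C j \<longrightarrow> col_support P i \<noteq> col_support P j)"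

definition k_positive :: "nat \<Rightarrow> real mat \<Rightarrow> bool" where
  "k_positive k M \<longleftrightarrow>
     (\<forall>I J. I \<subseteq> {..<dim_row M} \<longrightarrow> J \<subseteq> {..<dim_col M} \<longrightarrow> card I = card J \<longrightarrow> card I \<le> k \<longrightarrow>
        det (submatrix M I J) > 0)"

(* The longest element is the order-reversing permutation, so the choice made by ARG_MAX
   in longest_element is determined. *)
lemma longest_element_eq:
  "longest_element n = (\<lambda>i. if i < n then n - 1 - i else i)" (is "_ = ?r")
proof -
  let ?D = "{(i, j). i < j \<and> j < n}"
  have finD: "finite ?D"
    by (rule finite_subset[of _ "{..<n} \<times> {..<n}"]) auto
  have le: "coxeter_length n w \<le> card ?D" for w
    unfolding coxeter_length_def inversions_def by (rule card_mono[OF finD]) auto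
  have inj_r: "inj_on ?r {..<n}"
    by (auto simp: inj_on_def)
  have r_perm: "?r permutes {..<n}"
  proof (rule bij_imp_permutes)
    have "?r ` {..<n} = {..<n}"
      by (rule endo_inj_surj[OF finite_lessThan _ inj_r]) auto
    with inj_r show "bij_betw ?r {..<n} {..<n}"
      by (simp add: bij_betw_def)
  qed auto
  have "inversions n ?r = ?D"
    by (auto simp: inversions_def)
  then have r_len: "coxeter_length n ?r = card ?D"
    by (simp add: coxeter_length_def)
  have uniq: "w = ?r" if w: "w permutes {..<n}" and len: "coxeter_length n w = card ?D" for w
  proof -
    have "inversions n w = ?D"
      using len card_subset_eq[OF finD, of "inversions n w"]
      by (auto simp: coxeter_length_def inversions_def)
    then have dec: "w j < w i" if "i < j" "j < n" for i j
      using that unfolding inversions_def by blast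
    have range: "w i < n" if "i < n" for i
      using permutes_in_image[OF w, of i] that by simp
    have upper: "i < n \<Longrightarrow> w i + i < n" for i
    proof (induction i)
      case 0
      then show ?case using range by simp
    next
      case (Suc i)
      then show ?case using dec[of i "Suc i"] by simp
    qed
    have lower: "d < n \<Longrightarrow> d \<le> w (n - 1 - d)" for d
    proof (induction d)
      case (Suc d)
      have "n - 1 - Suc d < n - 1 - d" "n - 1 - d < n"
        using Suc.prems by auto
      then have "w (n - 1 - d) < w (n - 1 - Suc d)" by (rule dec)
      with Suc show ?case by simp
    qed simp
    have "w i = n - 1 - i" if "i < n" for i
      using upper[OF that] lower[of "n - 1 - i"] that by simp
    moreover have "w i = i" if "\<not> i < n" for i
      using permutes_not_in[OF w, of i] that by simp
    ultimately show ?thesis by auto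
  qed
  have "is_arg_max (coxeter_length n) (\<lambda>w. w permutes {..<n}) ?r"
    using r_perm r_len le by (metis (mono_tags, lifting) is_arg_max_linorder)
  then have "is_arg_max (coxeter_length n) (\<lambda>w. w permutes {..<n}) (longest_element n)"
    unfolding longest_element_def arg_max_def
    by (rule someI[where P = "is_arg_max (coxeter_length n) (\<lambda>w. w permutes {..<n})"])
  then have "longest_element n permutes {..<n}"
    "coxeter_length n (longest_element n) \<ge> coxeter_length n ?r"
    using r_perm by (auto simp only: is_arg_max_linorder)
  then show ?thesis
    using uniq r_len le[of "longest_element n"] by simp
qed

end

theory Submission
  imports Defs
begin

text \<open>
  Reverse the columns. The region becomes a band Q around the main diagonal, minors of size s lying
  inside Q get the sign (-1)^(s choose 2), and v becomes a permutation w avoiding 4231 and 3412; a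
  cell is in Q iff it has a point of w weakly north-east and one weakly south-west of it. Avoidance of
  3412 means that the maximal rectangles of Q intersect along a caterpillar, so at the top left
  corner either the first rows or the first columns have equal supports. There the Lewis Carroll
  identity, for two rows and two columns of different types, has two products on its right hand side
  whose signs agree. By induction the determinant has the sign (-1)^e, where e is the number of pairs
  a < b with both (a,b) and (b,a) in Q, for every band; a suitable nonzero complementary minor is found
  by comparing cofactors. If the determinant vanished for an admissible labelling, both products would
  vanish for all choices, whereas deleting a corner of Q preserves admissibility. Avoidance of 4231
  enters only through e being the number of inversions of w.
\<close>

section \<open>Cofactor identities\<close>

text \<open>The identity has a minus sign, so it yields a definite sign only if exchanging the
  pairing (i, y), (l, j) for (i, j), (l, y) changes the parity of e. This dictates the choice of
  indices: the rows come from the two adjacent groups [0, r) and [r, r'), the columns from [0, u)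
  and [u, q). The obstacle is the factor next to det X: it can be divided out only if nonzero, and
  zero minors are unavoidable since labels may repeat. Hence the sign is proved first, as a weak
  inequality and without labels, and the case det X = 0 costs nothing there. Deleting a row and a
  column may remove diagonal cells, which no region of a permutation lacks; the sign statement
  therefore ranges over all bands. Nonvanishing has a narrower induction: deletion must keep the
  diagonal, balance and the separation of equal labels, which is shown for two corner cells only.
  The second corner serves when rows agree; when columns agree, cofactors are read as kernel vectors
  of nonsingular blocks instead. The bound k enters through convexity: a minor with all its entries
  in the band spans a rectangle inside the band.\<close>

lemma det_unit_col:
  fixes A :: "'a :: comm_ring_1 mat"
  assumes A: "A \<in> carrier_mat n n" and y: "y < n" and i: "i < n"
    and col: "\<And>a. a < n \<Longrightarrow> A $$ (a, y) = (if a = i then 1 else 0)"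
  shows "det A = cofactor A i y"
proof -
  have "det A = (\<Sum>a<n. A $$ (a, y) * cofactor A a y)"
    by (rule laplace_expansion_column[OF A y])
  also have "\<dots> = (\<Sum>a<n. if a = i then cofactor A a y else 0)"
    by (rule sum.cong) (auto simp: col)
  also have "\<dots> = cofactor A i y"
    using i by simp
  finally show ?thesis .
qed

lemma cofactor_column_orthogonality:
  fixes A :: "'a :: comm_ring_1 mat"
  assumes A: "A \<in> carrier_mat n n" and "j < n" "c < n"
  shows "(\<Sum>a<n. cofactor A a j * A $$ (a, c)) = (if j = c then det A else 0)"
proof -
  have "(adj_mat A * A) $$ (j, c) = (\<Sum>a<n. cofactor A a j * A $$ (a, c))"
    unfolding times_mat_def scalar_prod_def adj_mat_def using assms
    by (auto simp: atLeast0LessThan intro: sum.cong)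
  then show ?thesis
    using adj_mat(3)[OF A] assms by (auto split: if_splits)
qed

lemma cofactor_row_orthogonality:
  fixes A :: "'a :: comm_ring_1 mat"
  assumes A: "A \<in> carrier_mat n n" and "i < n" "l < n"
  shows "(\<Sum>c<n. A $$ (i, c) * cofactor A l c) = (if i = l then det A else 0)"
proof -
  have "(A * adj_mat A) $$ (i, l) = (\<Sum>c<n. A $$ (i, c) * cofactor A l c)"
    unfolding times_mat_def scalar_prod_def adj_mat_def using assms
    by (auto simp: atLeast0LessThan intro: sum.cong)
  then show ?thesis
    using adj_mat(2)[OF A] assms by (auto split: if_splits)
qed

text \<open>A double sum of cofactors of an auxiliary matrix, entries of \<open>A\<close> and
  cofactors of \<open>A\<close> is evaluated in both orders by orthogonality. No division occurs, so
  singular \<open>A\<close> is covered; the nonvanishing argument applies the identity exactly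
  there.\<close>

lemma lewis_carroll_cofactor:
  fixes A :: "'a :: comm_ring_1 mat"
  assumes A: "A \<in> carrier_mat n n" and il: "i < l" "l < n" and yj: "y < j" "j < n"
  shows "det A * ((-1) ^ (i + y + l + j) * det (mat_delete (mat_delete A l j) i y)) =
    cofactor A i y * cofactor A l j - cofactor A i j * cofactor A l y"
proof -
  \<comment> \<open>\<open>A'\<close> has the unit vector of row \<open>i\<close> as column
    \<open>y\<close>: its determinant is a cofactor of \<open>A\<close>, and its cofactor at
    \<open>(l, j)\<close> is the complementary minor. \<open>A2\<close> arises when column
    \<open>y\<close> of \<open>A\<close> is paired with the cofactors of column \<open>j\<close> of
    \<open>A'\<close>; it is \<open>A3\<close> with two columns interchanged, the source of the
    minus sign.\<close>
  define A' where "A' = mat n n (\<lambda>(a, b). if b = y then (if a = i then 1 else 0) else A $$ (a, b))"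
  define A2 where "A2 = mat n n (\<lambda>(a, b). if b = j then A $$ (a, y) else A' $$ (a, b))"
  define A3 where "A3 = mat n n (\<lambda>(a, b). if b = j then (if a = i then 1 else 0) else A $$ (a, b))"
  have A': "A' \<in> carrier_mat n n" and A2: "A2 \<in> carrier_mat n n" and A3: "A3 \<in> carrier_mat n n"
    by (auto simp: A'_def A2_def A3_def)
  have dA': "det A' = cofactor A i y"
  proof -
    have "det A' = cofactor A' i y"
      by (rule det_unit_col[OF A']) (use il yj in \<open>auto simp: A'_def\<close>)
    also have "mat_delete A' i y = mat_delete A i y"
      using A A' by (intro eq_matI) (auto simp: A'_def mat_delete_def)
    then have "cofactor A' i y = cofactor A i y"
      by (simp add: cofactor_def)
    finally show ?thesis .
  qed
  have K'lj: "cofactor A' l j = (-1) ^ (i + y + l + j) * det (mat_delete (mat_delete A l j) i y)"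
  proof -
    have c: "mat_delete A' l j \<in> carrier_mat (n - 1) (n - 1)"
      using A' by (rule mat_delete_carrier)
    have "det (mat_delete A' l j) = cofactor (mat_delete A' l j) i y"
      by (rule det_unit_col[OF c]) (use il yj in \<open>auto simp: A'_def mat_delete_def\<close>)
    also have "mat_delete (mat_delete A' l j) i y = mat_delete (mat_delete A l j) i y"
      using A A' yj by (intro eq_matI) (auto simp: A'_def mat_delete_def)
    then have "cofactor (mat_delete A' l j) i y
      = (-1) ^ (i + y) * det (mat_delete (mat_delete A l j) i y)"
      by (simp add: cofactor_def)
    finally show ?thesis
      by (simp add: cofactor_def power_add)
  qed
  have dA2: "(\<Sum>a<n. cofactor A' a j * A $$ (a, y)) = det A2"
  proof -
    have "det A2 = (\<Sum>a<n. A2 $$ (a, j) * cofactor A2 a j)"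
      using yj by (intro laplace_expansion_column[OF A2]) auto
    also have "\<dots> = (\<Sum>a<n. cofactor A' a j * A $$ (a, y))"
    proof (rule sum.cong)
      fix a assume a: "a \<in> {..<n}"
      have "mat_delete A2 a j = mat_delete A' a j"
        using A2 A' by (intro eq_matI) (auto simp: A2_def mat_delete_def)
      then show "A2 $$ (a, j) * cofactor A2 a j = cofactor A' a j * A $$ (a, y)"
        using a yj by (simp add: A2_def cofactor_def)
    qed simp
    finally show ?thesis by simp
  qed
  have "det A3 = cofactor A3 i j"
    by (rule det_unit_col[OF A3]) (use il yj in \<open>auto simp: A3_def\<close>)
  also have "mat_delete A3 i j = mat_delete A i j"
    using A A3 by (intro eq_matI) (auto simp: A3_def mat_delete_def)
  then have "cofactor A3 i j = cofactor A i j"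
    by (simp add: cofactor_def)
  finally have dA3: "det A3 = cofactor A i j" .
  have "swapcols y j A3 = A2"
    using A2 A3 yj by (intro eq_matI) (auto simp: A2_def A3_def A'_def mat_swapcols_def)
  then have dA23: "det A2 = - cofactor A i j"
    using det_swapcols[of y n j A3] A3 yj dA3 by auto
  \<comment> \<open>The sum over \<open>c\<close> collapses to two terms, because \<open>A\<close>
    and \<open>A'\<close> differ in column \<open>y\<close> only: \<open>c = j\<close> gives
    \<open>det A'\<close>, and \<open>c = y\<close> gives \<open>det A2\<close>.\<close>
  have "det A * cofactor A' l j = (\<Sum>a<n. cofactor A' a j * (if a = l then det A else 0))"
    using il by (simp add: if_distrib mult.commute cong: if_cong)
  also have "\<dots> = (\<Sum>a<n. cofactor A' a j * (\<Sum>c<n. A $$ (a, c) * cofactor A l c))"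
    using il by (intro sum.cong) (auto simp: cofactor_row_orthogonality[OF A])
  also have "\<dots> = (\<Sum>c<n. cofactor A l c * (\<Sum>a<n. cofactor A' a j * A $$ (a, c)))"
    unfolding sum_distrib_left by (subst sum.swap) (auto intro!: sum.cong simp: ac_simps)
  also have "\<dots> = (\<Sum>c<n. (if c = j then cofactor A l j * det A' else 0)
      + (if c = y then cofactor A l y * det A2 else 0))"
  proof (rule sum.cong)
    fix c assume c: "c \<in> {..<n}"
    have "(\<Sum>a<n. cofactor A' a j * A $$ (a, c)) = (if j = c then det A' else 0)" if "c \<noteq> y"
    proof -
      have "(\<Sum>a<n. cofactor A' a j * A $$ (a, c)) = (\<Sum>a<n. cofactor A' a j * A' $$ (a, c))"
        using c that by (intro sum.cong) (auto simp: A'_def)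
      then show ?thesis
        using cofactor_column_orthogonality[OF A', of j c] c yj by simp
    qed
    then show "cofactor A l c * (\<Sum>a<n. cofactor A' a j * A $$ (a, c)) =
      (if c = j then cofactor A l j * det A' else 0) + (if c = y then cofactor A l y * det A2 else 0)"
      using dA2 yj by auto
  qed simp
  also have "\<dots> = cofactor A l j * det A' + cofactor A l y * det A2"
    using yj by (simp add: sum.distrib)
  finally show ?thesis
    unfolding K'lj dA' dA23 by (simp add: mult.commute)
qed

text \<open>Frobenius-Koenig: the zero block has a + 1 rows and n - a columns, together more than n,
  so every permutation meets it.\<close>

lemma det_zero_block:
  fixes A :: "'a :: comm_ring_1 mat"
  assumes A: "A \<in> carrier_mat n n" and a: "a < n"
    and z: "\<And>i j. i \<le> a \<Longrightarrow> a \<le> j \<Longrightarrow> j < n \<Longrightarrow> A $$ (i, j) = 0"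
  shows "det A = 0"
proof -
  have "(\<Prod>i = 0..<n. A $$ (i, p i)) = 0" if p: "p permutes {0..<n}" for p
  proof -
    have "\<exists>i\<le>a. a \<le> p i"
    proof (rule ccontr)
      assume "\<not> ?thesis"
      then have "p ` {..a} \<subseteq> {..<a}" by auto
      moreover have "inj_on p {..a}"
        using permutes_inj_on[OF p] .
      ultimately have "card {..a} \<le> card {..<a}"
        by (metis card_image card_mono finite_lessThan)
      then show False by simp
    qed
    then obtain i where i: "i \<le> a" "a \<le> p i" by blast
    then have "p i < n"
      using permutes_in_image[OF p, of i] a by simp
    then have "A $$ (i, p i) = 0"
      using z i by blast
    then show ?thesis
      using i a by (intro prod_zero) (auto intro!: bexI[of _ i])
  qed
  then show ?thesis
    unfolding det_def'[OF A] by (intro sum.neutral) auto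
qed

section \<open>Band regions\<close>

text \<open>Rows are numbered downwards, so \<open>(i, j)\<close> is a north-east and
  \<open>(i', j')\<close> a south-west cell, and the condition fills the rectangle between
  them.\<close>

definition convex_region :: "(nat \<times> nat) set \<Rightarrow> bool" where
  "convex_region P \<longleftrightarrow> (\<forall>i i' j j' a b. (i, j) \<in> P \<longrightarrow> (i', j') \<in> P \<longrightarrow>
     i \<le> a \<longrightarrow> a \<le> i' \<longrightarrow> j' \<le> b \<longrightarrow> b \<le> j \<longrightarrow> (a, b) \<in> P)"

text \<open>
  The excluded configuration is a 3412 pattern of corners of the band; it would make two lower left
  and two upper right corners span four rectangles inside the band.
\<close>

definition caterpillar :: "(nat \<times> nat) set \<Rightarrow> bool" where
  "caterpillar P \<longleftrightarrow> \<not> (\<exists>x y z w c0 c1 c2 c3. x < y \<and> y \<le> z \<and> z < w \<and> c0 < c1 \<and> c1 \<le> c2 \<and> c2 < c3 \<and>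
     (z, c0) \<in> P \<and> (w, c1) \<in> P \<and> (x, c2) \<in> P \<and> (y, c3) \<in> P \<and> (w, c0) \<notin> P \<and> (x, c3) \<notin> P)"

definition band :: "nat \<Rightarrow> (nat \<times> nat) set \<Rightarrow> bool" where
  "band n P \<longleftrightarrow> P \<subseteq> {..<n} \<times> {..<n} \<and> convex_region P \<and> caterpillar P"

definition del_region :: "nat \<Rightarrow> nat \<Rightarrow> (nat \<times> nat) set \<Rightarrow> (nat \<times> nat) set" where
  "del_region i j P = {(a, b). (insert_index i a, insert_index j b) \<in> P}"

definition sym_pairs :: "(nat \<times> nat) set \<Rightarrow> nat" where
  "sym_pairs P = card {(a, b). a < b \<and> (a, b) \<in> P \<and> (b, a) \<in> P}"

lemma insert_index_le_iff [simp]: "insert_index i a \<le> insert_index i b \<longleftrightarrow> a \<le> b"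
  by (auto simp: insert_index_def)

lemma insert_index_less_iff [simp]: "insert_index i a < insert_index i b \<longleftrightarrow> a < b"
  by (auto simp: insert_index_def)

lemma insert_index_lessD: "insert_index i a < n \<Longrightarrow> i < n \<Longrightarrow> a < n - 1"
  by (auto simp: insert_index_def split: if_splits)

lemma insert_index_less: "a < n - 1 \<Longrightarrow> insert_index i a < n"
  by (auto simp: insert_index_def split: if_splits)

lemma mem_del_region [simp]:
  "(a, b) \<in> del_region i j P \<longleftrightarrow> (insert_index i a, insert_index j b) \<in> P"
  by (simp add: del_region_def)

lemma convex_regionD:
  "convex_region P \<Longrightarrow> (i, j) \<in> P \<Longrightarrow> (i', j') \<in> P \<Longrightarrow> i \<le> a \<Longrightarrow> a \<le> i' \<Longrightarrow> j' \<le> b \<Longrightarrow> b \<le> j \<Longrightarrow> (a, b) \<in> P"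
  unfolding convex_region_def by blast

lemma caterpillarD:
  "caterpillar P \<Longrightarrow> x < y \<Longrightarrow> y \<le> z \<Longrightarrow> z < w \<Longrightarrow> c0 < c1 \<Longrightarrow> c1 \<le> c2 \<Longrightarrow> c2 < c3 \<Longrightarrow>
     (z, c0) \<in> P \<Longrightarrow> (w, c1) \<in> P \<Longrightarrow> (x, c2) \<in> P \<Longrightarrow> (y, c3) \<in> P \<Longrightarrow> (w, c0) \<notin> P \<Longrightarrow> (x, c3) \<in> P"
  unfolding caterpillar_def by blast

lemma convex_region_converse: "convex_region P \<Longrightarrow> convex_region (P\<inverse>)"
  unfolding convex_region_def converse_iff by blast

lemma caterpillar_converse: "caterpillar P \<Longrightarrow> caterpillar (P\<inverse>)"
  unfolding caterpillar_def converse_iff by blast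

lemma band_converse: "band n P \<Longrightarrow> band n (P\<inverse>)"
  unfolding band_def using convex_region_converse caterpillar_converse by auto

lemma convex_region_del: "convex_region P \<Longrightarrow> convex_region (del_region i j P)"
  unfolding convex_region_def mem_del_region by (meson insert_index_le_iff)

lemma caterpillar_del:
  assumes "caterpillar P" shows "caterpillar (del_region i j P)"
  unfolding caterpillar_def mem_del_region
proof (intro notI, elim exE conjE)
  fix x y z w c0 c1 c2 c3
  assume "x < y" "y \<le> z" "z < w" "c0 < c1" "c1 \<le> c2" "c2 < c3"
    and *: "(insert_index i z, insert_index j c0) \<in> P" "(insert_index i w, insert_index j c1) \<in> P"
      "(insert_index i x, insert_index j c2) \<in> P" "(insert_index i y, insert_index j c3) \<in> P"
      "(insert_index i w, insert_index j c0) \<notin> P"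
    and n: "(insert_index i x, insert_index j c3) \<notin> P"
  then have "(insert_index i x, insert_index j c3) \<in> P"
    using caterpillarD[OF assms _ _ _ _ _ _ *] by simp
  with n show False by simp
qed

lemma band_del: "band n P \<Longrightarrow> i < n \<Longrightarrow> j < n \<Longrightarrow> band (n - 1) (del_region i j P)"
  unfolding band_def using convex_region_del caterpillar_del
  by (auto dest!: subsetD dest: insert_index_lessD simp del: One_nat_def)

lemma del_region_converse: "(del_region i j P)\<inverse> = del_region j i (P\<inverse>)"
  by auto

section \<open>Counting symmetric pairs\<close>

lemma sym_pairs_converse [simp]: "sym_pairs (P\<inverse>) = sym_pairs P"
  by (simp add: sym_pairs_def conj_commute)

lemma finite_sym_pairs: "finite P \<Longrightarrow> finite {(a, b). a < b \<and> (a, b) \<in> P \<and> (b, a) \<in> P}"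
  by (rule finite_subset[of _ P]) auto

lemma band_finite: "band n P \<Longrightarrow> finite P"
  unfolding band_def by (meson finite_SigmaI finite_lessThan finite_subset)

text \<open>The added cells are \<open>(x, a)\<close> with \<open>a < w\<close>, to the left of the
  diagonal; hypothesis \<open>c\<close> supplies their mirror images, so each of them completes one
  pair.\<close>

lemma sym_pairs_row_change:
  assumes fin: "finite P1"
    and eq: "\<And>a b. a \<noteq> x \<Longrightarrow> (a, b) \<in> P1 \<longleftrightarrow> (a, b) \<in> P2"
    and r1: "\<And>b. (x, b) \<in> P1 \<longleftrightarrow> w \<le> b \<and> b < t"
    and r2: "\<And>b. (x, b) \<in> P2 \<longleftrightarrow> b < t"
    and wx: "w \<le> x" "x < t" and c: "\<And>a. a < w \<Longrightarrow> (a, x) \<in> P2"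
  shows "sym_pairs P2 = sym_pairs P1 + w"
proof -
  let ?S = "\<lambda>P. {(a, b). a < b \<and> (a, b) \<in> P \<and> (b, a) \<in> P}"
  have iff: "a < b \<and> (a, b) \<in> P2 \<and> (b, a) \<in> P2 \<longleftrightarrow>
      (a < b \<and> (a, b) \<in> P1 \<and> (b, a) \<in> P1) \<or> (b = x \<and> a < w)" for a b
  proof (cases "a = x"; cases "b = x")
    assume "a = x" "b \<noteq> x"
    then show ?thesis using eq r1 r2 wx by auto
  next
    assume "a \<noteq> x" "b = x"
    then show ?thesis using eq r1 r2 wx c by auto
  qed (use eq wx in auto)
  have "?S P2 = ?S P1 \<union> (\<lambda>a. (a, x)) ` {..<w}"
    using iff by auto
  moreover have "(a, x) \<notin> ?S P1" if "a < w" for a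
    using r1[of a] that by simp
  then have "?S P1 \<inter> (\<lambda>a. (a, x)) ` {..<w} = {}"
    by blast
  moreover have "card ((\<lambda>a. (a, x)) ` {..<w}) = w"
    by (subst card_image) (auto simp: inj_on_def)
  ultimately show ?thesis
    unfolding sym_pairs_def using card_Un_disjoint[OF finite_sym_pairs[OF fin]] by auto
qed

text \<open>The added cells are \<open>(b, x)\<close> with \<open>t2 \<le> b < t1\<close>, all under
  the diagonal; such a cell completes a pair just when its mirror image lies in row
  \<open>x\<close>, that is, when \<open>b < g\<close>. Truncated subtraction covers
  \<open>g \<le> t2\<close>.\<close>

lemma sym_pairs_col_change:
  assumes fin: "finite P2"
    and eq: "\<And>a b. b \<noteq> x \<Longrightarrow> (a, b) \<in> P1 \<longleftrightarrow> (a, b) \<in> P2"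
    and c1: "\<And>a. (a, x) \<in> P1 \<longleftrightarrow> a < t1" and c2: "\<And>a. (a, x) \<in> P2 \<longleftrightarrow> a < t2"
    and xt: "x < t2" "t2 \<le> t1" and g: "\<And>b. x < b \<Longrightarrow> (x, b) \<in> P2 \<longleftrightarrow> b < g"
  shows "sym_pairs P1 = sym_pairs P2 + (min t1 g - t2)"
proof -
  let ?S = "\<lambda>P. {(a, b). a < b \<and> (a, b) \<in> P \<and> (b, a) \<in> P}"
  have iff: "a < b \<and> (a, b) \<in> P1 \<and> (b, a) \<in> P1 \<longleftrightarrow>
      (a < b \<and> (a, b) \<in> P2 \<and> (b, a) \<in> P2) \<or> (a = x \<and> t2 \<le> b \<and> b < min t1 g)" for a b
  proof (cases "a = x"; cases "b = x")
    assume "a = x" "b \<noteq> x"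
    then show ?thesis using eq c1 c2 g xt by auto
  next
    assume "a \<noteq> x" "b = x"
    then show ?thesis using eq c1 c2 xt by auto
  qed (use eq xt in auto)
  have "?S P1 = ?S P2 \<union> (\<lambda>b. (x, b)) ` {t2..<min t1 g}"
    using iff by auto
  moreover have "(x, b) \<notin> ?S P2" if "t2 \<le> b" for b
    using c2[of b] that by simp
  then have "?S P2 \<inter> (\<lambda>b. (x, b)) ` {t2..<min t1 g} = {}"
    by (metis (no_types, lifting) atLeastLessThan_iff disjoint_iff imageE)
  moreover have "card ((\<lambda>b. (x, b)) ` {t2..<min t1 g}) = min t1 g - t2"
    by (subst card_image) (auto simp: inj_on_def)
  ultimately show ?thesis
    unfolding sym_pairs_def using card_Un_disjoint[OF finite_sym_pairs[OF fin]] by auto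
qed

text \<open>The pairs through index 0 are \<open>(0, b)\<close> with \<open>1 \<le> b < r\<close>,
  the shorter of row 0 and column 0 being decisive.\<close>

lemma sym_pairs_del_0:
  assumes fin: "finite P" and row: "\<And>b. (0, b) \<in> P \<longleftrightarrow> b < q"
    and col: "\<And>a. (a, 0) \<in> P \<longleftrightarrow> a < r" and rq: "r \<le> q"
  shows "sym_pairs P = sym_pairs (del_region 0 0 P) + (r - 1)"
proof -
  let ?S = "\<lambda>P. {(a, b). a < b \<and> (a, b) \<in> P \<and> (b, a) \<in> P}"
  have iff: "a < b \<and> (a, b) \<in> P \<and> (b, a) \<in> P \<longleftrightarrow>
      (a > 0 \<and> (a - 1, b - 1) \<in> ?S (del_region 0 0 P)) \<or> (a = 0 \<and> 1 \<le> b \<and> b < r)" for a b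
    using row col rq by (cases a; cases b) auto
  have "?S P = map_prod Suc Suc ` ?S (del_region 0 0 P) \<union> (\<lambda>b. (0, b)) ` {1..<r}"
  proof -
    have "(a, b) \<in> map_prod Suc Suc ` ?S (del_region 0 0 P) \<longleftrightarrow>
      a > 0 \<and> b > 0 \<and> (a - 1, b - 1) \<in> ?S (del_region 0 0 P)" for a b
      by (cases a; cases b) (auto simp: image_iff)
    note img = this
    have m: "(a, b) \<in> (\<lambda>b. (0, b)) ` {1..<r} \<longleftrightarrow> a = 0 \<and> 1 \<le> b \<and> b < r" for a b :: nat
      by auto
    show ?thesis
    proof (rule Set.set_eqI)
      fix x :: "nat \<times> nat"
      obtain a b where x: "x = (a, b)" by (cases x)
      show "x \<in> ?S P \<longleftrightarrow> x \<in> map_prod Suc Suc ` ?S (del_region 0 0 P) \<union> (\<lambda>b. (0, b)) ` {1..<r}"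
        unfolding x Un_iff m img using iff[of a b] by (cases "b = 0") simp_all
    qed
  qed
  moreover have "map_prod Suc Suc ` ?S (del_region 0 0 P) \<inter> (\<lambda>b. (0, b)) ` {1..<r} = {}"
    by auto
  moreover have "card ((\<lambda>b. (0::nat, b)) ` {1..<r}) = r - 1"
    by (subst card_image) (auto simp: inj_on_def)
  moreover have "card (map_prod Suc Suc ` ?S (del_region 0 0 P)) = card (?S (del_region 0 0 P))"
    by (rule card_image) (auto simp: inj_on_def)
  moreover have "finite (?S P)"
    by (rule finite_sym_pairs[OF fin])
  ultimately show ?thesis
    unfolding sym_pairs_def by (metis (no_types, lifting) card_Un_disjoint finite_Un)
qed

text \<open>Lets a deleted row move inside a group of equal rows, so that exponents need be compared
  for one representative only.\<close>

lemma del_region_row_cong: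
  assumes "\<And>a b. i \<le> a \<Longrightarrow> a < i' \<Longrightarrow> (a, b) \<in> P \<longleftrightarrow> (Suc a, b) \<in> P" and "i \<le> i'"
  shows "del_region i j P = del_region i' j P"
proof -
  have "(a, b) \<in> del_region i j P \<longleftrightarrow> (a, b) \<in> del_region i' j P" for a b
    using assms(1)[of a "insert_index j b"] assms(2) by (auto simp: insert_index_def)
  then show ?thesis by auto
qed

lemma del_region_col_cong:
  assumes "\<And>a b. j \<le> b \<Longrightarrow> b < j' \<Longrightarrow> (a, b) \<in> P \<longleftrightarrow> (a, Suc b) \<in> P" and "j \<le> j'"
  shows "del_region i j P = del_region i j' P"
proof -
  have "(a, b) \<in> del_region i j P \<longleftrightarrow> (a, b) \<in> del_region i j' P" for a b
    using assms(1)[of b "insert_index i a"] assms(2) by (auto simp: insert_index_def)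
  then show ?thesis by auto
qed

section \<open>Corners of a band\<close>

lemma initial_segment:
  assumes "finite S" "0 \<in> S" "\<And>a b. b \<in> S \<Longrightarrow> a \<le> b \<Longrightarrow> a \<in> S"
  obtains k :: nat where "\<And>i. i \<in> S \<longleftrightarrow> i < k"
proof (rule that[of "Suc (Max S)"])
  fix i
  have "Max S \<in> S" using assms(1,2) by (intro Max_in) auto
  then show "i \<in> S \<longleftrightarrow> i < Suc (Max S)"
    using assms(1) assms(3)[of "Max S" i] by (auto simp: le_imp_less_Suc)
qed

text \<open>\<open>r\<close> is the height of the first column and \<open>q\<close> the common
  length of the first \<open>r\<close> rows. That these rows agree is a normalisation, which holds
  for the region or for its transpose.\<close>

locale band_corner =
  fixes n :: nat and P :: "(nat \<times> nat) set" and r q :: nat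
  assumes band: "band n P" and diag: "\<And>a. a < n \<Longrightarrow> (a, a) \<in> P" and n_pos: "0 < n"
    and col_0: "\<And>i. (i, 0) \<in> P \<longleftrightarrow> i < r" and rows_r: "\<And>i j. i < r \<Longrightarrow> (i, j) \<in> P \<longleftrightarrow> j < q"
begin

lemma bounded: "(i, j) \<in> P \<Longrightarrow> i < n \<and> j < n"
  using band unfolding band_def by auto

lemma convex: "convex_region P" and caterpillar: "caterpillar P"
  using band by (auto simp: band_def)

lemma fin: "finite P"
  using band by (rule band_finite)

lemma r_pos: "0 < r"
  using diag[of 0] n_pos col_0 by blast

lemma r_le_n: "r \<le> n"
  using bounded[of "r - 1" 0] col_0[of "r - 1"] r_pos by linarith

lemma r_le_q: "r \<le> q"
  using rows_r[of "r - 1" "r - 1"] diag[of "r - 1"] r_pos r_le_n by (simp; linarith)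

lemma q_pos: "0 < q"
  using r_pos r_le_q by simp

lemma q_le_n: "q \<le> n"
  using bounded[of 0 "q - 1"] rows_r[of 0 "q - 1"] r_pos q_pos by linarith

end

text \<open>
  The first r rows are [0, q), the first u columns are [0, r), and column u is [0, r'). Depending on
  whether (r' - 1, q) lies in P, the columns [u, q) or the rows [r, r') have equal supports.
\<close>

locale band_step = band_corner +
  fixes u r' :: nat
  assumes u_pos: "0 < u" and u_less: "u < r" and r_less: "r < q"
    and cols_u: "\<And>i j. j < u \<Longrightarrow> (i, j) \<in> P \<longleftrightarrow> i < r"
    and col_u: "\<And>i. (i, u) \<in> P \<longleftrightarrow> i < r'" and r_r': "r < r'"
    and row_r: "\<And>j. u \<le> j \<Longrightarrow> j < q \<Longrightarrow> (r, j) \<in> P"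
begin

lemma r'_le_n: "r' \<le> n"
  using bounded[of "r' - 1" u] col_u[of "r' - 1"] r_r' by linarith

lemma rows_r': "r \<le> i \<Longrightarrow> i < r' \<Longrightarrow> u \<le> j \<Longrightarrow> j < q \<Longrightarrow> (i, j) \<in> P"
  by (rule convex_regionD[OF convex row_r[of "q - 1"], where i' = "r' - 1" and j' = u])
    (use r_less u_less r_r' col_u in auto)

text \<open>A cell of such a row at or beyond column \<open>q\<close>, together with
  \<open>(r' - 1, u)\<close>, would by convexity put \<open>(r' - 1, q)\<close> into
  \<open>P\<close>.\<close>

lemma rows_A:
  assumes A: "(r' - 1, q) \<notin> P" and i: "r \<le> i" "i < r'"
  shows "(i, j) \<in> P \<longleftrightarrow> u \<le> j \<and> j < q"
proof
  assume ij: "(i, j) \<in> P"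
  have "u \<le> j"
    using cols_u[of j i] ij i by (meson not_le)
  moreover have "j < q"
  proof (rule ccontr)
    assume jq: "\<not> j < q"
    have "(r' - 1, q) \<in> P"
      by (rule convex_regionD[OF convex ij, where i' = "r' - 1" and j' = u])
        (use i jq col_u[of "r' - 1"] r_less u_less in auto)
    with A show False by simp
  qed
  ultimately show "u \<le> j \<and> j < q" by simp
qed (use rows_r' i in auto)

text \<open>A cell \<open>(i, j)\<close> with \<open>i \<ge> r'\<close> would be caught by the
  caterpillar condition: with \<open>(r' - 1, u)\<close>, \<open>(0, q - 1)\<close> and
  \<open>(r' - 1, q)\<close> it forces \<open>(0, q)\<close> into \<open>P\<close>.\<close>

lemma cols_B:
  assumes B: "(r' - 1, q) \<in> P" and j: "u \<le> j" "j < q"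
  shows "(i, j) \<in> P \<longleftrightarrow> i < r'"
proof
  assume ij: "(i, j) \<in> P"
  show "i < r'"
  proof (rule ccontr)
    assume i: "\<not> i < r'"
    have "j \<noteq> u" using i ij col_u[of i] by auto
    have "(0, q) \<in> P"
      by (rule caterpillarD[OF caterpillar, of 0 "r' - 1" "r' - 1" i u j "q - 1" q])
        (use i j \<open>j \<noteq> u\<close> ij B r_r' r_pos q_pos col_u[of "r' - 1"] col_u[of i] rows_r[of 0] in auto)
    then show False using rows_r r_pos by auto
  qed
next
  assume i: "i < r'"
  show "(i, j) \<in> P"
    using i j rows_r rows_r' by (cases "i < r") auto
qed

context
  fixes i y l j
  assumes i: "i < r" and y: "y < u" and l: "r \<le> l" "l < r'" and j: "u \<le> j" "j < q"
begin

lemma del_i: "del_region i c P = del_region (r - 1) c P"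
  by (rule del_region_row_cong) (use rows_r i in auto)

lemma del_y: "del_region c y P = del_region c (u - 1) P"
  by (rule del_region_col_cong) (use cols_u y in auto)

text \<open>Deleting row \<open>i\<close> and column \<open>y\<close> amounts to deleting index 0.
  It costs \<open>r - 1\<close> pairs both before and after the removal of row \<open>l\<close> and
  column \<open>j\<close>, because column 0 keeps its height when \<open>l \<ge> r\<close>; the two
  costs cancel modulo 2.\<close>

lemma sign_split:
  "even (sym_pairs P + sym_pairs (del_region i y P) + sym_pairs (del_region l j P)
     + sym_pairs (del_region i y (del_region l j P)))"
proof -
  let ?Q = "del_region l j P"
  have "del_region i y P = del_region 0 y P"
    by (rule del_region_row_cong[symmetric]) (use rows_r i in auto)
  also have "\<dots> = del_region 0 0 P"
    by (rule del_region_col_cong[symmetric]) (use cols_u y in auto)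
  finally have 1: "sym_pairs P = sym_pairs (del_region i y P) + (r - 1)"
    using sym_pairs_del_0[OF fin _ col_0, of q] rows_r r_pos r_le_q by simp
  have "del_region i y ?Q = del_region 0 y ?Q"
    by (rule del_region_row_cong[symmetric]) (use rows_r i l in auto)
  also have "\<dots> = del_region 0 0 ?Q"
    by (rule del_region_col_cong[symmetric]) (use cols_u y j in auto)
  finally have 2: "del_region i y ?Q = del_region 0 0 ?Q" .
  have "finite ?Q"
    using band_finite[OF band_del[OF band, of l j]] l j r'_le_n q_le_n by simp
  then have "sym_pairs ?Q = sym_pairs (del_region 0 0 ?Q) + (r - 1)"
  proof (rule sym_pairs_del_0)
    fix b show "(0, b) \<in> ?Q \<longleftrightarrow> b < q - 1"
      using l r_pos rows_r[of 0 "insert_index j b"] j by (auto simp: insert_index_def)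
  next
    fix a show "(a, 0) \<in> ?Q \<longleftrightarrow> a < r"
      using l j u_pos col_0[of "insert_index l a"] by (auto simp: insert_index_def)
  qed (use r_less in auto)
  then have "sym_pairs P + sym_pairs (del_region i y P) + sym_pairs ?Q + sym_pairs (del_region i y ?Q)
      = 2 * (sym_pairs (del_region i y P) + sym_pairs (del_region i y ?Q) + (r - 1))"
    using 1 2 by simp
  then show ?thesis
    by presburger
qed

text \<open>For a fixed deleted column, deleting row \<open>r\<close> or row \<open>r - 1\<close>
  gives regions that differ in row \<open>r - 1\<close> only, which starts at 0 or where the old row
  \<open>r\<close> starts. That start is \<open>u\<close> if a column \<open>j \<ge> u\<close> is
  deleted and \<open>u - 1\<close> if a column \<open>y < u\<close> is, so the two differences add
  up to \<open>2 * u - 1\<close>.\<close>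

lemma sign_cross_A:
  assumes A: "(r' - 1, q) \<notin> P"
  shows "odd (sym_pairs (del_region i j P) + sym_pairs (del_region l y P)
    + sym_pairs (del_region i y P) + sym_pairs (del_region l j P))"
proof -
  have del_l: "del_region l c P = del_region r c P" for c
    by (rule del_region_row_cong[symmetric]) (use rows_A[OF A] l in auto)
  have "sym_pairs (del_region r j P) = sym_pairs (del_region (r - 1) j P) + u"
  proof (rule sym_pairs_row_change[of _ "r - 1" _ _ "q - 1"])
    show "finite (del_region (r - 1) j P)"
      using band_finite[OF band_del[OF band, of "r - 1" j]] r_le_n r_pos j q_le_n by simp
  next
    fix a b assume "a \<noteq> r - 1"
    then show "(a, b) \<in> del_region (r - 1) j P \<longleftrightarrow> (a, b) \<in> del_region r j P"
      by (auto simp: insert_index_def)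
  next
    fix b show "(r - 1, b) \<in> del_region (r - 1) j P \<longleftrightarrow> u \<le> b \<and> b < q - 1"
      using rows_A[OF A, of r "insert_index j b"] r_r' r_pos j by (auto simp: insert_index_def)
  next
    fix b show "(r - 1, b) \<in> del_region r j P \<longleftrightarrow> b < q - 1"
      using rows_r[of "r - 1" "insert_index j b"] r_pos j by (auto simp: insert_index_def)
  next
    fix a assume "a < u"
    then show "(a, r - 1) \<in> del_region r j P"
      using rows_r[of a "insert_index j (r - 1)"] u_less r_less by (auto simp: insert_index_def)
  qed (use u_less r_less in auto)
  moreover have "sym_pairs (del_region r y P) = sym_pairs (del_region (r - 1) y P) + (u - 1)"
  proof (rule sym_pairs_row_change[of _ "r - 1" _ _ "q - 1"])
    show "finite (del_region (r - 1) y P)"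
      using band_finite[OF band_del[OF band, of "r - 1" y]] r_le_n r_pos y u_less by simp
  next
    fix a b assume "a \<noteq> r - 1"
    then show "(a, b) \<in> del_region (r - 1) y P \<longleftrightarrow> (a, b) \<in> del_region r y P"
      by (auto simp: insert_index_def)
  next
    fix b show "(r - 1, b) \<in> del_region (r - 1) y P \<longleftrightarrow> u - 1 \<le> b \<and> b < q - 1"
      using rows_A[OF A, of r "insert_index y b"] r_r' r_pos y u_less r_less by (auto simp: insert_index_def)
  next
    fix b show "(r - 1, b) \<in> del_region r y P \<longleftrightarrow> b < q - 1"
      using rows_r[of "r - 1" "insert_index y b"] r_pos y u_less r_less by (auto simp: insert_index_def)
  next
    fix a assume "a < u - 1"
    then show "(a, r - 1) \<in> del_region r y P"
      using rows_r[of a "insert_index y (r - 1)"] u_less r_less by (auto simp: insert_index_def)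
  qed (use u_less r_less in auto)
  ultimately show ?thesis
    unfolding del_i del_l using u_pos by presburger
qed

text \<open>Now the columns \<open>u - 1\<close> and \<open>u\<close> compete. Deleting
  \<open>u\<close> leaves column \<open>u - 1\<close> with height \<open>t\<close> in place of
  \<open>r' - 1\<close>, where \<open>t\<close> is \<open>r - 1\<close> or \<open>r\<close>
  according to whether the deleted row is among the first \<open>r\<close>. The two losses
  \<open>min (r' - 1) (q - 1) - t\<close> differ by one.\<close>

lemma sign_cross_B:
  assumes B: "(r' - 1, q) \<in> P"
  shows "odd (sym_pairs (del_region i j P) + sym_pairs (del_region l y P)
    + sym_pairs (del_region i y P) + sym_pairs (del_region l j P))"
proof -
  have del_j: "del_region c j P = del_region c u P" for c
    by (rule del_region_col_cong[symmetric]) (use cols_B[OF B] j in auto)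
  have "sym_pairs (del_region c (u - 1) P) = sym_pairs (del_region c u P) + (min (r' - 1) (q - 1) - t)"
    if c: "c < r'" and t: "t = (if c < r then r - 1 else r)" for c t
  proof (rule sym_pairs_col_change[of _ "u - 1"])
    show "finite (del_region c u P)"
      using band_finite[OF band_del[OF band, of c u]] c r'_le_n j q_le_n by simp
  next
    fix a b assume "b \<noteq> u - 1"
    then show "(a, b) \<in> del_region c (u - 1) P \<longleftrightarrow> (a, b) \<in> del_region c u P"
      by (auto simp: insert_index_def)
  next
    fix a show "(a, u - 1) \<in> del_region c (u - 1) P \<longleftrightarrow> a < r' - 1"
      using col_u[of "insert_index c a"] u_pos c by (auto simp: insert_index_def)
  next
    fix a show "(a, u - 1) \<in> del_region c u P \<longleftrightarrow> a < t"
      using cols_u[of "u - 1" "insert_index c a"] u_pos c t by (auto simp: insert_index_def)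
  next
    fix b assume b: "u - 1 < b"
    then have ub: "u \<le> b" using u_pos by simp
    then have "(u - 1, b) \<in> del_region c u P \<longleftrightarrow> (insert_index c (u - 1), Suc b) \<in> P"
      by (simp add: insert_index_def)
    also have "\<dots> \<longleftrightarrow> b < q - 1"
      using rows_r[of "insert_index c (u - 1)" "Suc b"] u_less u_pos r_less
      by (cases "u - 1 < c") (auto simp: insert_index_def)
    finally show "(u - 1, b) \<in> del_region c u P \<longleftrightarrow> b < q - 1" .
  qed (use u_less u_pos r_r' t in auto)
  from this[of i] this[of l] show ?thesis
    unfolding del_j del_y using i l r_pos r_less r_r' by (auto simp: min_def split: if_splits)
qed

lemma sign_cross:
  "odd (sym_pairs (del_region i j P) + sym_pairs (del_region l y P)
    + sym_pairs (del_region i y P) + sym_pairs (del_region l j P))"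
  using sign_cross_A sign_cross_B by blast

end

end

text \<open>Suppose a row \<open>y < r\<close> went past \<open>q\<close> and a column
  \<open>c < q\<close> went past \<open>r\<close>. By convexity the first cell may be taken in
  column \<open>q\<close>; with the second one and the cells \<open>(r - 1, 0)\<close> and
  \<open>(0, q - 1)\<close> it forms the configuration excluded by \<open>caterpillar\<close>. So
  the rows agree, or the columns do.\<close>

lemma band_corner_exists:
  assumes band: "band n P" and diag: "\<And>a. a < n \<Longrightarrow> (a, a) \<in> P" and n: "0 < n"
  obtains r q where "band_corner n P r q" | r q where "band_corner n (P\<inverse>) r q"
proof -
  have conv: "convex_region P" and cat: "caterpillar P" and bd: "\<And>i j. (i, j) \<in> P \<Longrightarrow> i < n \<and> j < n"
    using band by (auto simp: band_def)
  have d0: "(0, 0) \<in> P" using diag n by simp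
  have fin: "finite {i. (i, 0) \<in> P}" "finite {j. (0, j) \<in> P}"
    by (rule finite_subset[of _ "{..<n}"]; use bd in auto)+
  have "a \<in> {i. (i, 0) \<in> P}" if "b \<in> {i. (i, 0) \<in> P}" "a \<le> b" for a b
    using convex_regionD[OF conv d0, of b 0 a 0] that by simp
  then obtain r where "\<And>i. i \<in> {i. (i, 0) \<in> P} \<longleftrightarrow> i < r"
    using initial_segment[OF fin(1)] d0 by blast
  then have r: "\<And>i. (i, 0) \<in> P \<longleftrightarrow> i < r" by simp
  have "a \<in> {j. (0, j) \<in> P}" if "b \<in> {j. (0, j) \<in> P}" "a \<le> b" for a b
    using convex_regionD[OF conv _ d0, of 0 b 0 a] that by simp
  then obtain q where "\<And>j. j \<in> {j. (0, j) \<in> P} \<longleftrightarrow> j < q"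
    using initial_segment[OF fin(2)] d0 by blast
  then have q: "\<And>j. (0, j) \<in> P \<longleftrightarrow> j < q" by simp
  have rq: "0 < r" "0 < q" using d0 r q by auto
  have rect: "(i, j) \<in> P" if "i < r" "j < q" for i j
    by (rule convex_regionD[OF conv, of 0 "q - 1" "r - 1" 0]) (use that r q in auto)
  show thesis
  proof (cases "\<exists>y<r. \<exists>j\<ge>q. (y, j) \<in> P")
    case False
    then have "band_corner n P r q"
      by unfold_locales (use band diag n r rect in \<open>auto simp: not_le\<close>)
    then show thesis by (rule that)
  next
    case True
    then obtain y j where y: "y < r" "q \<le> j" "(y, j) \<in> P" by auto
    have yq: "(y, q) \<in> P"
      by (rule convex_regionD[OF conv y(3), of y 0]) (use y r in auto)
    have "y \<noteq> 0" using yq q by (metis less_irrefl)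
    have no: "i < r" if c: "c < q" "(i, c) \<in> P" for i c
    proof (rule ccontr)
      assume i: "\<not> i < r"
      have "c \<noteq> 0" using c i r by metis
      have "(0, q) \<in> P"
        by (rule caterpillarD[OF cat, of 0 y "r - 1" i 0 c "q - 1" q])
          (use y yq \<open>y \<noteq> 0\<close> \<open>c \<noteq> 0\<close> i c rq r[of i] r[of "r - 1"] q[of q] q[of "q - 1"] in auto)
      then show False using q by simp
    qed
    have "band_corner n (P\<inverse>) q r"
      by unfold_locales (use band_converse[OF band] diag n q rect no in auto)
    then show thesis by (rule that)
  qed
qed

section \<open>Signed minors\<close>

text \<open>The sign is that of reversing \<open>s\<close> columns. The inequality is weak because a
  minor with repeated labels vanishes.\<close>

definition signed_minors :: "(nat \<times> nat) set \<Rightarrow> real mat \<Rightarrow> bool" where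
  "signed_minors P X \<longleftrightarrow> (\<forall>s f g. strict_mono_on {..<s} f \<longrightarrow> strict_mono_on {..<s} g \<longrightarrow>
     (\<forall>a<s. \<forall>b<s. (f a, g b) \<in> P) \<longrightarrow>
     0 \<le> (-1) ^ (s choose 2) * det (mat s s (\<lambda>(a, b). X $$ (f a, g b))))"

definition supported_on :: "(nat \<times> nat) set \<Rightarrow> 'a :: zero mat \<Rightarrow> bool" where
  "supported_on P X \<longleftrightarrow> (\<forall>i<dim_row X. \<forall>j<dim_col X. (i, j) \<notin> P \<longrightarrow> X $$ (i, j) = 0)"

definition shift_region :: "nat \<Rightarrow> (nat \<times> nat) set \<Rightarrow> (nat \<times> nat) set" where
  "shift_region r P = {(a, b). (a + r, b + r) \<in> P}"

definition shift_mat :: "nat \<Rightarrow> 'a mat \<Rightarrow> 'a mat" where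
  "shift_mat r X = mat (dim_row X - r) (dim_col X - r) (\<lambda>(i, j). X $$ (i + r, j + r))"

lemma mem_shift_region [simp]: "(a, b) \<in> shift_region r P \<longleftrightarrow> (a + r, b + r) \<in> P"
  by (simp add: shift_region_def)

lemma signed_minorsD:
  "signed_minors P X \<Longrightarrow> strict_mono_on {..<s} f \<Longrightarrow> strict_mono_on {..<s} g \<Longrightarrow>
     (\<And>a b. a < s \<Longrightarrow> b < s \<Longrightarrow> (f a, g b) \<in> P) \<Longrightarrow>
     0 \<le> (-1) ^ (s choose 2) * det (mat s s (\<lambda>(a, b). X $$ (f a, g b)))"
  unfolding signed_minors_def by blast

text \<open>The common source for deletions and shifts: increasing index maps carry minors inside
  \<open>P'\<close> to minors inside \<open>P\<close>.\<close>

lemma signed_minors_reindex: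
  assumes X: "signed_minors P X" and mono: "strict_mono \<phi>" "strict_mono \<psi>"
    and P': "\<And>a b. (a, b) \<in> P' \<Longrightarrow> (\<phi> a, \<psi> b) \<in> P"
    and X': "\<And>a b. (a, b) \<in> P' \<Longrightarrow> X' $$ (a, b) = X $$ (\<phi> a, \<psi> b)"
  shows "signed_minors P' X'"
  unfolding signed_minors_def
proof (intro allI impI)
  fix s :: nat and f g
  assume f: "strict_mono_on {..<s} f" and g: "strict_mono_on {..<s} g"
    and in': "\<forall>a<s. \<forall>b<s. (f a, g b) \<in> P'"
  have "0 \<le> (-1) ^ (s choose 2) * det (mat s s (\<lambda>(a, b). X $$ ((\<phi> \<circ> f) a, (\<psi> \<circ> g) b)))"
  proof (rule signed_minorsD[OF X])
    show "strict_mono_on {..<s} (\<phi> \<circ> f)" "strict_mono_on {..<s} (\<psi> \<circ> g)"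
      using f g mono by (auto simp: strict_mono_on_def strict_mono_def)
  qed (use in' P' in auto)
  also have "mat s s (\<lambda>(a, b). X $$ ((\<phi> \<circ> f) a, (\<psi> \<circ> g) b)) = mat s s (\<lambda>(a, b). X' $$ (f a, g b))"
    using in' X' by (intro eq_matI) auto
  finally show "0 \<le> (-1) ^ (s choose 2) * det (mat s s (\<lambda>(a, b). X' $$ (f a, g b)))" .
qed

lemma strict_mono_insert_index: "strict_mono (insert_index i)"
  by (simp add: strict_mono_def)

lemma strict_mono_add: "strict_mono (\<lambda>a. a + r :: nat)"
  by (simp add: strict_mono_def)

lemma mat_delete_entry:
  assumes "X \<in> carrier_mat n n" "a < n - 1" "b < n - 1"
  shows "mat_delete X i j $$ (a, b) = X $$ (insert_index i a, insert_index j b)"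
  using assms by (simp add: mat_delete_def insert_index_def)

lemma signed_minors_mat_delete:
  assumes X: "signed_minors P X" and c: "X \<in> carrier_mat n n" and P: "P \<subseteq> {..<n} \<times> {..<n}"
    and ij: "i < n" "j < n"
  shows "signed_minors (del_region i j P) (mat_delete X i j)"
proof (rule signed_minors_reindex[OF X strict_mono_insert_index strict_mono_insert_index])
  fix a b assume "(a, b) \<in> del_region i j P"
  then show "(insert_index i a, insert_index j b) \<in> P"
    and "mat_delete X i j $$ (a, b) = X $$ (insert_index i a, insert_index j b)"
    using P ij by (auto intro!: mat_delete_entry[OF c] insert_index_lessD simp del: One_nat_def)
qed

lemma supported_on_mat_delete:
  assumes "supported_on P X" and c: "X \<in> carrier_mat n n"
  shows "supported_on (del_region i j P) (mat_delete X i j)"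
  using assms unfolding supported_on_def
  by (auto simp: mat_delete_entry[OF c] insert_index_less simp del: One_nat_def)

lemma shift_mat_carrier: "X \<in> carrier_mat n n \<Longrightarrow> shift_mat r X \<in> carrier_mat (n - r) (n - r)"
  by (simp add: shift_mat_def)

lemma signed_minors_shift:
  assumes X: "signed_minors P X" and c: "X \<in> carrier_mat n n" and P: "P \<subseteq> {..<n} \<times> {..<n}"
  shows "signed_minors (shift_region r P) (shift_mat r X)"
proof (rule signed_minors_reindex[OF X strict_mono_add[of r] strict_mono_add[of r]])
  fix a b assume "(a, b) \<in> shift_region r P"
  then show "(a + r, b + r) \<in> P" "shift_mat r X $$ (a, b) = X $$ (a + r, b + r)"
    using P c by (auto simp: shift_mat_def dest!: subsetD)
qed

lemma supported_on_shift:
  assumes "supported_on P X" and c: "X \<in> carrier_mat n n"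
  shows "supported_on (shift_region r P) (shift_mat r X)"
  using assms unfolding supported_on_def shift_mat_def by auto

lemma band_shift:
  assumes "band n P" shows "band (n - r) (shift_region r P)"
proof -
  have "convex_region (shift_region r P)"
    using assms unfolding band_def convex_region_def mem_shift_region by (meson add_le_mono1)
  moreover have "caterpillar (shift_region r P)"
    using assms unfolding band_def caterpillar_def mem_shift_region
    by (meson add_le_mono1 add_less_mono1)
  ultimately show ?thesis
    using assms by (auto simp: band_def)
qed

lemma signed_minors_transpose:
  assumes X: "signed_minors P X" and c: "X \<in> carrier_mat n n" and P: "P \<subseteq> {..<n} \<times> {..<n}"
  shows "signed_minors (P\<inverse>) (transpose_mat X)"
  unfolding signed_minors_def
proof (intro allI impI)
  fix s :: nat and f g
  assume f: "strict_mono_on {..<s} f" and g: "strict_mono_on {..<s} g"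
    and in': "\<forall>a<s. \<forall>b<s. (f a, g b) \<in> P\<inverse>"
  have "0 \<le> (-1) ^ (s choose 2) * det (mat s s (\<lambda>(a, b). X $$ (g a, f b)))"
    by (rule signed_minorsD[OF X g f]) (use in' in auto)
  also have "det (mat s s (\<lambda>(a, b). X $$ (g a, f b))) = det (transpose_mat (mat s s (\<lambda>(a, b). X $$ (g a, f b))))"
    by (rule det_transpose[symmetric, of _ s]) simp
  also have "transpose_mat (mat s s (\<lambda>(a, b). X $$ (g a, f b))) = mat s s (\<lambda>(a, b). transpose_mat X $$ (f a, g b))"
  proof (intro eq_matI)
    fix a b
    assume ab: "a < dim_row (mat s s (\<lambda>(a, b). transpose_mat X $$ (f a, g b)))"
      "b < dim_col (mat s s (\<lambda>(a, b). transpose_mat X $$ (f a, g b)))"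
    then have "(g b, f a) \<in> P" using in' by auto
    then have "g b < n" "f a < n" using P by auto
    then show "transpose_mat (mat s s (\<lambda>(a, b). X $$ (g a, f b))) $$ (a, b)
      = mat s s (\<lambda>(a, b). transpose_mat X $$ (f a, g b)) $$ (a, b)"
      using ab c by auto
  qed auto
  finally show "0 \<le> (-1) ^ (s choose 2) * det (mat s s (\<lambda>(a, b). transpose_mat X $$ (f a, g b)))" .
qed

lemma supported_on_transpose: "supported_on P X \<Longrightarrow> supported_on (P\<inverse>) (transpose_mat X)"
  by (auto simp: supported_on_def)

lemma det_block_triangular:
  fixes X :: "real mat"
  assumes X: "X \<in> carrier_mat n n" and r: "r \<le> n"
    and z: "(\<forall>i<r. \<forall>j<n. r \<le> j \<longrightarrow> X $$ (i, j) = 0) \<or> (\<forall>i<n. \<forall>j<r. r \<le> i \<longrightarrow> X $$ (i, j) = 0)"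
  shows "det X = det (mat r r (\<lambda>(i, j). X $$ (i, j))) * det (shift_mat r X)"
proof -
  define A where "A = mat r r (\<lambda>(i, j). X $$ (i, j))"
  define B where "B = mat r (n - r) (\<lambda>(i, j). X $$ (i, j + r))"
  define C where "C = mat (n - r) r (\<lambda>(i, j). X $$ (i + r, j))"
  define D where "D = shift_mat r X"
  have c: "A \<in> carrier_mat r r" "B \<in> carrier_mat r (n - r)" "C \<in> carrier_mat (n - r) r"
    "D \<in> carrier_mat (n - r) (n - r)"
    using X by (auto simp: A_def B_def C_def D_def shift_mat_def)
  have Xb: "X = four_block_mat A B C D"
    using X r by (intro eq_matI) (auto simp: four_block_mat_def Let_def A_def B_def C_def D_def shift_mat_def)
  have dX: "det X = det (four_block_mat A B C D)"
    by (rule arg_cong[OF Xb])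
  from z show ?thesis
  proof
    assume "\<forall>i<r. \<forall>j<n. r \<le> j \<longrightarrow> X $$ (i, j) = 0"
    then have "B = 0\<^sub>m r (n - r)"
      by (intro eq_matI) (auto simp: B_def)
    then show ?thesis
      unfolding dX A_def[symmetric] D_def[symmetric]
      by (rule det_four_block_mat_upper_right_zero[OF c(1) _ c(3) c(4)])
  next
    assume "\<forall>i<n. \<forall>j<r. r \<le> i \<longrightarrow> X $$ (i, j) = 0"
    then have "C = 0\<^sub>m (n - r) r"
      by (intro eq_matI) (auto simp: C_def)
    then show ?thesis
      unfolding dX A_def[symmetric] D_def[symmetric]
      by (rule det_four_block_mat_lower_left_zero[OF c(1) c(2) _ c(4)])
  qed
qed

lemma card_ordered_pairs: "card {(a, b). a < b \<and> b < r} = r choose 2"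
proof (induction r)
  case (Suc r)
  have "{(a, b). a < b \<and> b < Suc r} = {(a, b). a < b \<and> b < r} \<union> (\<lambda>a. (a, r)) ` {..<r}"
    by auto
  moreover have "card ((\<lambda>a. (a, r)) ` {..<r}) = r"
    by (subst card_image) (auto simp: inj_on_def)
  moreover have "finite {(a, b). a < b \<and> b < r}"
    by (rule finite_subset[of _ "{..<r} \<times> {..<r}"]) auto
  moreover have "{(a, b). a < b \<and> b < r} \<inter> (\<lambda>a. (a, r)) ` {..<r} = {}"
    by auto
  ultimately have "card {(a, b). a < b \<and> b < Suc r} = (r choose 2) + r"
    using Suc by (simp add: card_Un_disjoint)
  also have "\<dots> = Suc r choose 2"
    by (simp add: numeral_2_eq_2)
  finally show ?case .
qed simp

lemma sym_pairs_block:
  assumes fin: "finite P" and full: "\<And>a b. a < r \<Longrightarrow> b < r \<Longrightarrow> (a, b) \<in> P"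
    and cross: "\<And>a b. a < r \<Longrightarrow> r \<le> b \<Longrightarrow> (a, b) \<notin> P \<or> (b, a) \<notin> P"
  shows "sym_pairs P = (r choose 2) + sym_pairs (shift_region r P)"
proof -
  let ?S = "\<lambda>P. {(a, b). a < b \<and> (a, b) \<in> P \<and> (b, a) \<in> P}"
  let ?f = "map_prod (\<lambda>a. a + r) (\<lambda>b. b + r)"
  have mem: "(a, b) \<in> ?f ` ?S (shift_region r P) \<longleftrightarrow> r \<le> a \<and> (a, b) \<in> ?S P" for a b
  proof
    assume *: "r \<le> a \<and> (a, b) \<in> ?S P"
    then have "(a - r, b - r) \<in> ?S (shift_region r P)" "?f (a - r, b - r) = (a, b)"
      by auto
    then show "(a, b) \<in> ?f ` ?S (shift_region r P)"
      by (metis (no_types, lifting) image_eqI)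
  qed auto
  have "?S P = {(a, b). a < b \<and> b < r} \<union> ?f ` ?S (shift_region r P)"
  proof (rule Set.set_eqI)
    fix x :: "nat \<times> nat"
    obtain a b where x: "x = (a, b)" by (cases x)
    show "x \<in> ?S P \<longleftrightarrow> x \<in> {(a, b). a < b \<and> b < r} \<union> ?f ` ?S (shift_region r P)"
      unfolding x Un_iff mem using full[of a b] full[of b a] cross[of a b]
      by (cases "a < r"; cases "b < r") auto
  qed
  moreover have "x \<notin> {(a, b). a < b \<and> b < r}" if "x \<in> ?f ` ?S (shift_region r P)" for x
    using that by auto
  then have "{(a, b). a < b \<and> b < r} \<inter> ?f ` ?S (shift_region r P) = {}"
    by blast
  moreover have "card (?f ` ?S (shift_region r P)) = card (?S (shift_region r P))"
    by (rule card_image) (auto simp: inj_on_def)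
  moreover have "finite (?S P)"
    by (rule finite_sym_pairs[OF fin])
  ultimately show ?thesis
    unfolding sym_pairs_def card_ordered_pairs[symmetric]
    by (metis (no_types, lifting) card_Un_disjoint finite_Un)
qed

text \<open>
  The conclusion covers j < u as well: this is what makes some complementary minor nonzero.
\<close>

lemma cofactor_block_vanish:
  fixes X :: "real mat"
  assumes X: "X \<in> carrier_mat n n" and d: "det X \<noteq> 0"
    and dims: "r \<le> n" "q \<le> n" "0 < u" "u \<le> q" and l: "r \<le> l" "l < n"
    and rows: "\<And>i j. i < r \<Longrightarrow> q \<le> j \<Longrightarrow> j < n \<Longrightarrow> X $$ (i, j) = 0"
    and cols: "\<And>i j. j < u \<Longrightarrow> r \<le> i \<Longrightarrow> i < n \<Longrightarrow> X $$ (i, j) = 0"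
    and rel: "\<And>i y j. i < r \<Longrightarrow> y < u \<Longrightarrow> u \<le> j \<Longrightarrow> j < q \<Longrightarrow>
      cofactor X i y * cofactor X l j = cofactor X i j * cofactor X l y"
  shows "\<forall>j<q. cofactor X l j = 0"
proof -
  let ?K = "cofactor X"
  \<comment> \<open>The part of the orthogonality sum over the first \<open>u\<close> columns. The
    remainder lives on the columns \<open>[u, q)\<close>, where \<open>rel\<close> applies.\<close>
  define S where "S i m = (\<Sum>j<u. X $$ (i, j) * ?K m j)" for i m
  have split: "(\<Sum>j<n. X $$ (i, j) * ?K m j) = S i m + (\<Sum>j=u..<q. X $$ (i, j) * ?K m j)"
    if i: "i < r" for i m
  proof -
    have "(\<Sum>j<n. X $$ (i, j) * ?K m j) = (\<Sum>j<q. X $$ (i, j) * ?K m j)"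
      by (rule sum.mono_neutral_right) (use dims rows i in auto)
    also have "{..<q} = {..<u} \<union> {u..<q}"
      using dims by auto
    finally show ?thesis
      unfolding S_def by (simp add: sum.union_disjoint ivl_disj_int)
  qed
  \<comment> \<open>Summing \<open>rel\<close> over \<open>j\<close> with weights
    \<open>X $$ (i, j)\<close> relates the remainders for the rows \<open>l\<close> and
    \<open>i0\<close>; orthogonality then expresses both through \<open>S\<close>.\<close>
  have claim: "?K i0 y * S i l + ?K l y * ((if i = i0 then det X else 0) - S i i0) = 0"
    if "i < r" "i0 < r" "y < u" for i i0 y
  proof -
    have 1: "S i l + (\<Sum>j=u..<q. X $$ (i, j) * ?K l j) = 0"
      using cofactor_row_orthogonality[OF X, of i l] split[of i l] that l dims by auto
    have 2: "S i i0 + (\<Sum>j=u..<q. X $$ (i, j) * ?K i0 j) = (if i = i0 then det X else 0)"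
      using cofactor_row_orthogonality[OF X, of i i0] split[of i i0] that dims by auto
    have "?K i0 y * (\<Sum>j=u..<q. X $$ (i, j) * ?K l j) = (\<Sum>j=u..<q. X $$ (i, j) * (?K i0 y * ?K l j))"
      by (simp add: sum_distrib_left ac_simps)
    also have "\<dots> = (\<Sum>j=u..<q. X $$ (i, j) * (?K i0 j * ?K l y))"
      by (rule sum.cong) (use rel that in auto)
    also have "\<dots> = ?K l y * (\<Sum>j=u..<q. X $$ (i, j) * ?K i0 j)"
      by (simp add: sum_distrib_left ac_simps)
    finally have 3: "?K i0 y * (\<Sum>j=u..<q. X $$ (i, j) * ?K l j) = ?K l y * (\<Sum>j=u..<q. X $$ (i, j) * ?K i0 j)" .
    have "?K i0 y * S i l = - (?K i0 y * (\<Sum>j=u..<q. X $$ (i, j) * ?K l j))"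
      using 1 by (metis add_eq_0_iff2 mult_minus_right)
    moreover have "(if i = i0 then det X else 0) - S i i0 = (\<Sum>j=u..<q. X $$ (i, j) * ?K i0 j)"
      using 2 by linarith
    ultimately show ?thesis
      using 3 by simp
  qed
  have colsum: "(\<Sum>i<r. ?K i y * X $$ (i, j)) = (if y = j then det X else 0)" if "y < n" "j < u" for y j
  proof -
    have "(\<Sum>i<r. ?K i y * X $$ (i, j)) = (\<Sum>i<n. ?K i y * X $$ (i, j))"
      by (rule sum.mono_neutral_left) (use dims cols that in auto)
    also have "\<dots> = (if y = j then det X else 0)"
      using cofactor_column_orthogonality[OF X, of y j] that dims by auto
    finally show ?thesis .
  qed
  \<comment> \<open>The first \<open>u\<close> columns vanish from row \<open>r\<close> on, so
    column orthogonality survives the restriction to \<open>i < r\<close>, and contracting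
    \<open>S\<close> returns a single cofactor.\<close>
  have KS: "(\<Sum>i<r. ?K i y * S i m) = det X * ?K m y" if "y < u" for y m
  proof -
    have "(\<Sum>i<r. ?K i y * S i m) = (\<Sum>j<u. (\<Sum>i<r. ?K i y * X $$ (i, j)) * ?K m j)"
      unfolding S_def sum_distrib_left sum_distrib_right
      by (subst sum.swap) (simp add: mult.assoc)
    also have "\<dots> = (\<Sum>j<u. if j = y then det X * ?K m y else 0)"
      by (rule sum.cong) (use colsum that dims in auto)
    also have "\<dots> = det X * ?K m y"
      using that by simp
    finally show ?thesis .
  qed
  \<comment> \<open>Contract \<open>claim\<close> with \<open>?K i y'\<close>. The two terms
    multiplied by \<open>?K l y\<close> both become \<open>det X * ?K i0 y'\<close> and cancel,
    which leaves one product.\<close>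
  have prod0: "?K i0 y * ?K l y' = 0" if "i0 < r" "y < u" "y' < u" for i0 y y'
  proof -
    have "0 = (\<Sum>i<r. ?K i y' * (?K i0 y * S i l + ?K l y * ((if i = i0 then det X else 0) - S i i0)))"
      by (rule sum.neutral[symmetric]) (use claim that in auto)
    also have "\<dots> = ?K i0 y * (\<Sum>i<r. ?K i y' * S i l)
        + ?K l y * ((\<Sum>i<r. if i = i0 then ?K i y' * det X else 0) - (\<Sum>i<r. ?K i y' * S i i0))"
    proof -
      have "?K i y' * (?K i0 y * S i l + ?K l y * ((if i = i0 then det X else 0) - S i i0))
        = ?K i0 y * (?K i y' * S i l) + ?K l y * ((if i = i0 then ?K i y' * det X else 0) - ?K i y' * S i i0)" for i
        by (simp add: algebra_simps)
      then show ?thesis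
        by (simp add: sum.distrib sum_subtractf sum_distrib_left[symmetric])
    qed
    also have "\<dots> = ?K i0 y * (det X * ?K l y')"
      using that KS by (simp add: mult.commute)
    finally show ?thesis using d by simp
  qed
  have "\<exists>i0<r. ?K i0 0 \<noteq> 0"
    using colsum[of 0 0] d dims by (force intro: ccontr)
  then obtain i0 where i0: "i0 < r" "?K i0 0 \<noteq> 0" by blast
  show ?thesis
  proof (intro allI impI)
    fix j assume j: "j < q"
    show "?K l j = 0"
    proof (cases "j < u")
      case True
      then show ?thesis using prod0[of i0 0 j] i0 dims by simp
    next
      case False
      then show ?thesis
        using rel[of i0 0 j] prod0[of i0 0 0] i0 dims j by auto
    qed
  qed
qed

section \<open>Sign of the determinant\<close>

context band_corner
begin

text \<open>Row \<open>r\<close> is compared with the rows before it through its first column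
  \<open>u\<close>. If \<open>r = q\<close>, none of those rows extends beyond the block; if
  \<open>u = r\<close>, no column of the block continues downwards. Either way matrices supported on
  \<open>P\<close> are block triangular. What remains is \<open>0 < u < r < q\<close>, the situation
  of \<open>band_step\<close>.\<close>

lemma corner_cases:
  obtains (full) "r = n" "q = n"
  | (block) "r < n" "r = q \<or> (\<forall>i j. j < r \<longrightarrow> (i, j) \<in> P \<longrightarrow> i < r)"
  | (step) u r' where "band_step n P r q u r'"
proof (cases "r = n")
  case True
  then show thesis using full r_le_q q_le_n by simp
next
  case False
  then have r: "r < n" using r_le_n by simp
  show thesis
  proof (cases "\<exists>j<q. (r, j) \<in> P")
    case False
    then have "r = q"
      using diag[OF r] r_le_q by (meson antisym not_le)
    then show thesis using block r by simp
  next
    case True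
    define u where "u = (LEAST j. (r, j) \<in> P)"
    have ru: "(r, u) \<in> P"
      unfolding u_def using True by (metis LeastI)
    have min: "u \<le> j" if "(r, j) \<in> P" for j
      unfolding u_def using that by (rule Least_le)
    have uq: "u < q" using True min by (meson le_less_trans)
    have ur: "u \<le> r" using min diag[OF r] .
    have cols: "i < r" if "j < u" "(i, j) \<in> P" for i j
    proof (rule ccontr)
      assume i: "\<not> i < r"
      have "(r, j) \<in> P"
        by (rule convex_regionD[OF convex _ that(2), of 0 "q - 1"])
          (use rows_r[of 0 "q - 1"] r_pos i uq that in auto)
      then show False using min that(1) by (metis not_le)
    qed
    show thesis
    proof (cases "u < r \<and> r < q")
      case False
      then have "r = q \<or> u = r" using ur uq r_le_q by linarith
      then show thesis using block r cols by metis
    next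
      case True
      have u0: "0 < u"
        using ru col_0[of r] by (cases u) auto
      have "0 \<in> {i. (i, u) \<in> P}"
        using rows_r[of 0 u] r_pos uq by simp
      moreover have "a \<in> {i. (i, u) \<in> P}" if "b \<in> {i. (i, u) \<in> P}" "a \<le> b" for a b
        using convex_regionD[OF convex, of 0 u b u a u] that rows_r[of 0 u] r_pos uq by simp
      moreover have "finite {i. (i, u) \<in> P}"
        by (rule finite_subset[of _ "{..<n}"]) (use bounded in auto)
      ultimately obtain r' where r': "\<And>i. i \<in> {i. (i, u) \<in> P} \<longleftrightarrow> i < r'"
        using initial_segment[of "{i. (i, u) \<in> P}"] by blast
      have row: "(r, j) \<in> P" if "u \<le> j" "j < q" for j
        by (rule convex_regionD[OF convex _ ru, of 0 "q - 1"])
          (use rows_r[of 0 "q - 1"] r_pos uq that in auto)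
      have "band_step n P r q u r'"
      proof unfold_locales
        fix i j assume "j < u"
        then show "(i, j) \<in> P \<longleftrightarrow> i < r"
          using cols[of j i] rows_r[of i j] uq by (meson less_trans)
      next
        show "r < r'" using r'[of r] ru by simp
      qed (use True u0 r' row in simp_all)
      then show thesis by (rule step)
    qed
  qed
qed

end

lemma neg_one_power_even:
  "even (a + b) \<Longrightarrow> (-1 :: 'a :: ring_1) ^ a = (-1) ^ b"
  by (simp add: minus_one_power_iff)

lemma neg_one_power_odd:
  "odd (a + b) \<Longrightarrow> (-1 :: 'a :: ring_1) ^ a = - ((-1) ^ b)"
  by (auto simp: minus_one_power_iff)

lemma lewis_carroll:
  fixes A :: "real mat"
  assumes A: "A \<in> carrier_mat n n" and il: "i < l" "l < n" and yj: "y < j" "j < n"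
  shows "det A * det (mat_delete (mat_delete A l j) i y) =
    det (mat_delete A i y) * det (mat_delete A l j) - det (mat_delete A i j) * det (mat_delete A l y)"
proof -
  let ?e = "(-1 :: real) ^ (i + y + l + j)"
  have "?e * (det A * det (mat_delete (mat_delete A l j) i y)) = 
    ?e * (det (mat_delete A i y) * det (mat_delete A l j) - det (mat_delete A i j) * det (mat_delete A l y))"
    using lewis_carroll_cofactor[OF assms]
    by (simp add: cofactor_def power_add algebra_simps)
  then show ?thesis by simp
qed

section \<open>The condensation step for the sign\<close>

context band_step
begin

text \<open>If all these minors vanished, the Lewis Carroll identity would supply the relations of
  \<open>cofactor_block_vanish\<close>, and all cofactors in rows \<open>[r, r')\<close> and columns
  \<open>[0, q)\<close> would be zero. Expansion along row \<open>r\<close> contradicts this when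
  the rows agree, a rank count when the columns agree.\<close>

lemma exists_nonzero_minor:
  fixes X :: "real mat"
  assumes X: "X \<in> carrier_mat n n" and supp: "supported_on P X" and d: "det X \<noteq> 0"
  shows "\<exists>i y l j. i < r \<and> y < u \<and> r \<le> l \<and> l < r' \<and> u \<le> j \<and> j < q \<and>
    det (mat_delete (mat_delete X l j) i y) \<noteq> 0"
proof (rule ccontr)
  assume none: "\<not> ?thesis"
  have zero: "X $$ (i, j) = 0" if "i < n" "j < n" "(i, j) \<notin> P" for i j
    using supp X that by (auto simp: supported_on_def)
  have rel: "cofactor X i y * cofactor X l j = cofactor X i j * cofactor X l y"
    if "i < r" "y < u" "r \<le> l" "l < r'" "u \<le> j" "j < q" for i y l j
  proof -
    have "det (mat_delete (mat_delete X l j) i y) = 0"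
      using none that by blast
    then show ?thesis
      using lewis_carroll_cofactor[OF X, of i l y j] that r'_le_n q_le_n by simp
  qed
  have van: "cofactor X l j = 0" if l: "r \<le> l" "l < r'" and j: "j < q" for l j
  proof -
    have "\<forall>j<q. cofactor X l j = 0"
    proof (rule cofactor_block_vanish[OF X d r_le_n q_le_n u_pos _ l(1)])
      show "u \<le> q" "l < n" using u_less r_less l r'_le_n by auto
    next
      fix i j assume "i < r" "q \<le> j" "j < n"
      then show "X $$ (i, j) = 0"
        using zero[of i j] rows_r[of i j] r_le_n by simp
    next
      fix i j assume "j < u" "r \<le> i" "i < n"
      then show "X $$ (i, j) = 0"
        using zero[of i j] cols_u[of j i] u_less r_le_n by simp
    qed (use rel l in auto)
    then show ?thesis using j by blast
  qed
  show False
  proof (cases "(r' - 1, q) \<in> P")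
    case False
    have "(\<Sum>j<n. X $$ (r, j) * cofactor X r j) = 0"
    proof (rule sum.neutral, rule ballI)
      fix j assume "j \<in> {..<n}"
      then show "X $$ (r, j) * cofactor X r j = 0"
        using van[of r j] zero[of r j] rows_A[OF False, of r j] r_r' r'_le_n by (cases "j < q") auto
    qed
    then show False
      using cofactor_row_orthogonality[OF X, of r r] d r_r' r'_le_n by simp
  next
    case True
    \<comment> \<open>The first \<open>q\<close> columns live in the rows \<open>[0, r')\<close>,
      and the rows \<open>[r, r')\<close> carry zero cofactors there. Thus \<open>det X\<close>
      times the identity of size \<open>q\<close> factors through dimension \<open>r < q\<close>.
      Padding with zeros makes both factors square, and \<open>B\<close> gets a zero row.\<close>
    define A where "A = mat q q (\<lambda>(j, i). if i < r then cofactor X i j else 0)"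
    define B where "B = mat q q (\<lambda>(i, j). if i < r then X $$ (i, j) else 0)"
    have AB: "A \<in> carrier_mat q q" "B \<in> carrier_mat q q"
      by (auto simp: A_def B_def)
    have "A * B = det X \<cdot>\<^sub>m 1\<^sub>m q"
    proof (rule eq_matI)
      fix j j' assume "j < dim_row (det X \<cdot>\<^sub>m 1\<^sub>m q)" "j' < dim_col (det X \<cdot>\<^sub>m 1\<^sub>m q)"
      then have j: "j < q" "j' < q" by auto
      have "(A * B) $$ (j, j') = (\<Sum>i<q. if i < r then cofactor X i j * X $$ (i, j') else 0)"
        using j AB unfolding times_mat_def scalar_prod_def
        by (auto simp: A_def B_def atLeast0LessThan intro: sum.cong)
      also have "\<dots> = (\<Sum>i<r. cofactor X i j * X $$ (i, j'))"
        by (rule sum.mono_neutral_cong_right) (use r_less in auto)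
      also have "\<dots> = (\<Sum>i<n. cofactor X i j * X $$ (i, j'))"
      proof (rule sum.mono_neutral_left)
        show "\<forall>i\<in>{..<n} - {..<r}. cofactor X i j * X $$ (i, j') = 0"
        proof
          fix i assume i: "i \<in> {..<n} - {..<r}"
          show "cofactor X i j * X $$ (i, j') = 0"
          proof (cases "i < r'")
            case True
            then show ?thesis using van[of i j] i j by simp
          next
            case False
            have "(i, j') \<notin> P"
              using cols_u[of j' i] cols_B[OF True, of j' i] i j False by (cases "j' < u") auto
            then show ?thesis using zero[of i j'] i j q_le_n by simp
          qed
        qed
      qed (use r_le_n in auto)
      also have "\<dots> = (if j = j' then det X else 0)"
        using cofactor_column_orthogonality[OF X, of j j'] j q_le_n by simp
      finally show "(A * B) $$ (j, j') = (det X \<cdot>\<^sub>m 1\<^sub>m q) $$ (j, j')"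
        using j by simp
    qed (use AB in auto)
    then have "det A * det B = det X ^ q"
      using det_mult[OF AB] by (simp add: det_smult)
    moreover have "det B = (\<Sum>j<q. B $$ (r, j) * cofactor B r j)"
      by (rule laplace_expansion_row[OF AB(2) r_less])
    then have "det B = 0"
      using r_less by (simp add: B_def)
    ultimately show False
      using d by simp
  qed
qed

text \<open>By \<open>sign_cross\<close> the difference of the two products is, up to the common
  factor \<open>?sa * ?sb\<close>, a sum of two nonnegative terms. By \<open>sign_split\<close> this
  factor times the sign of the complementary minor is the sign claimed for
  \<open>det X\<close>.\<close>

lemma det_sign_step:
  fixes X :: "real mat"
  assumes X: "X \<in> carrier_mat n n" and supp: "supported_on P X"
    and IH1: "\<And>i j. i < n \<Longrightarrow> j < n \<Longrightarrow> 0 \<le> (-1) ^ sym_pairs (del_region i j P) * det (mat_delete X i j)"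
    and IH2: "\<And>i y l j. i < n - 1 \<Longrightarrow> y < n - 1 \<Longrightarrow> l < n \<Longrightarrow> j < n \<Longrightarrow>
      0 \<le> (-1) ^ sym_pairs (del_region i y (del_region l j P)) * det (mat_delete (mat_delete X l j) i y)"
  shows "0 \<le> (-1) ^ sym_pairs P * det X"
proof (cases "det X = 0")
  case False
  then obtain i y l j where i: "i < r" and y: "y < u" and l: "r \<le> l" "l < r'" and j: "u \<le> j" "j < q"
    and D0: "det (mat_delete (mat_delete X l j) i y) \<noteq> 0"
    using exists_nonzero_minor[OF X supp] by blast
  have lt: "i < l" "l < n" "y < j" "j < n"
    using i y l j r'_le_n q_le_n by auto
  let ?a = "det (mat_delete X i y)" and ?b = "det (mat_delete X l j)"
    and ?c = "det (mat_delete X i j)" and ?e = "det (mat_delete X l y)"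
    and ?D = "det (mat_delete (mat_delete X l j) i y)"
  let ?sa = "(-1 :: real) ^ sym_pairs (del_region i y P)" and ?sb = "(-1 :: real) ^ sym_pairs (del_region l j P)"
    and ?sc = "(-1 :: real) ^ sym_pairs (del_region i j P)" and ?se = "(-1 :: real) ^ sym_pairs (del_region l y P)"
    and ?sD = "(-1 :: real) ^ sym_pairs (del_region i y (del_region l j P))"
  have sP: "(-1 :: real) ^ sym_pairs P = ?sa * ?sb * ?sD"
    unfolding power_add[symmetric]
    by (rule neg_one_power_even) (use sign_split[OF i y l j] in \<open>simp add: add.assoc\<close>)
  have sc: "?sc * ?se = - (?sa * ?sb)"
    unfolding power_add[symmetric]
    by (rule neg_one_power_odd) (use sign_cross[OF i y l j] in \<open>simp add: add.assoc\<close>)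
  have "0 \<le> (?sa * ?a) * (?sb * ?b)" "0 \<le> (?sc * ?c) * (?se * ?e)"
    by (intro mult_nonneg_nonneg IH1; use lt i y in linarith)+
  moreover have "(?sc * ?c) * (?se * ?e) = - (?sa * ?sb) * (?c * ?e)"
    unfolding sc[symmetric] by (simp add: ac_simps)
  ultimately have "0 \<le> ?sa * ?sb * (?a * ?b - ?c * ?e)"
    by (simp add: algebra_simps)
  then have 1: "0 \<le> ?sa * ?sb * (det X * ?D)"
    unfolding lewis_carroll[OF X lt] .
  have 2: "0 < ?sD * ?D"
  proof -
    have "i < n - 1" "y < n - 1" using lt by linarith+
    then have "0 \<le> ?sD * ?D" by (rule IH2[OF _ _ lt(2) lt(4)])
    moreover have "?sD * ?D \<noteq> 0" using D0 by simp
    ultimately show ?thesis by linarith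
  qed
  have "((-1) ^ sym_pairs P * det X) * (?sD * ?D) = (?sD * ?sD) * (?sa * ?sb * (det X * ?D))"
    unfolding sP by (simp only: ac_simps)
  also have "?sD * ?sD = 1"
    by simp
  finally have "((-1) ^ sym_pairs P * det X) * (?sD * ?D) = ?sa * ?sb * (det X * ?D)"
    by simp
  then have "0 \<le> ((-1) ^ sym_pairs P * det X) * (?sD * ?D)"
    using 1 by (simp only:)
  then show ?thesis
    using 2 by (metis mult_less_0_iff not_le)
qed simp

end

text \<open>The induction hypothesis is an assumption here, so that the lemma serves the region and
  its transpose alike.\<close>

lemma det_sign_corner:
  assumes corner: "band_corner n P r q"
    and X: "X \<in> carrier_mat n n" and supp: "supported_on P X" and minors: "signed_minors P X"
    and IH: "\<And>m P X. m < n \<Longrightarrow> band m P \<Longrightarrow> X \<in> carrier_mat m m \<Longrightarrow> supported_on P X \<Longrightarrow>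
      signed_minors P X \<Longrightarrow> 0 \<le> (-1) ^ sym_pairs P * det X"
  shows "0 \<le> (-1) ^ sym_pairs P * det X"
proof -
  interpret band_corner n P r q by fact
  have Psub: "P \<subseteq> {..<n} \<times> {..<n}"
    using band by (simp add: band_def)
  have zero: "X $$ (i, j) = 0" if "i < n" "j < n" "(i, j) \<notin> P" for i j
    using supp X that by (auto simp: supported_on_def)
  have minor_r: "0 \<le> (-1) ^ (r choose 2) * det (mat r r (\<lambda>(i, j). X $$ (i, j)))"
    using signed_minorsD[OF minors, of r "\<lambda>i. i" "\<lambda>j. j"] rows_r r_le_q
    by (simp add: strict_mono_on_def)
  show ?thesis
  proof (cases rule: corner_cases)
    case full
    then have "(a, b) \<in> P \<longleftrightarrow> a < n \<and> b < n" for a b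
      using rows_r[of a b] bounded[of a b] by auto
    then have "{(a, b). a < b \<and> (a, b) \<in> P \<and> (b, a) \<in> P} = {(a, b). a < b \<and> b < r}"
      using full by auto
    then have "sym_pairs P = r choose 2"
      by (simp add: sym_pairs_def card_ordered_pairs)
    moreover have "mat r r (\<lambda>(i, j). X $$ (i, j)) = X"
      using full X by (intro eq_matI) auto
    ultimately show ?thesis using minor_r by simp
  next
    case block
    have cross: "(a, b) \<notin> P \<or> (b, a) \<notin> P" if "a < r" "r \<le> b" for a b
      using block(2) rows_r[of a b] that by (metis not_le)
    have "det X = det (mat r r (\<lambda>(i, j). X $$ (i, j))) * det (shift_mat r X)"
    proof (rule det_block_triangular[OF X r_le_n])
      show "(\<forall>i<r. \<forall>j<n. r \<le> j \<longrightarrow> X $$ (i, j) = 0) \<or> (\<forall>i<n. \<forall>j<r. r \<le> i \<longrightarrow> X $$ (i, j) = 0)"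
        using block(2)
      proof
        assume "r = q"
        then show ?thesis using zero rows_r r_le_n by (metis not_le order_less_le_trans)
      next
        assume "\<forall>i j. j < r \<longrightarrow> (i, j) \<in> P \<longrightarrow> i < r"
        then show ?thesis using zero r_le_n by (metis not_le order_less_le_trans)
      qed
    qed
    moreover have "sym_pairs P = (r choose 2) + sym_pairs (shift_region r P)"
      by (rule sym_pairs_block[OF fin]) (use rows_r r_le_q cross in auto)
    moreover have "0 \<le> (-1) ^ sym_pairs (shift_region r P) * det (shift_mat r X)"
      by (rule IH[OF _ band_shift[OF band] shift_mat_carrier[OF X]
            supported_on_shift[OF supp X] signed_minors_shift[OF minors X Psub]])
        (use r_pos n_pos in simp)
    ultimately show ?thesis
      using mult_nonneg_nonneg[OF minor_r, of "(-1) ^ sym_pairs (shift_region r P) * det (shift_mat r X)"]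
      by (simp add: power_add ac_simps)
  next
    case (step u r')
    then interpret band_step n P r q u r' .
    show ?thesis
    proof (rule det_sign_step[OF X supp])
      fix l j assume lj: "l < n" "j < n"
      note del = band_del[OF band lj] mat_delete_carrier[OF X] supported_on_mat_delete[OF supp X]
        signed_minors_mat_delete[OF minors X Psub lj]
      show "0 \<le> (-1) ^ sym_pairs (del_region l j P) * det (mat_delete X l j)"
        by (rule IH[OF _ del]) (use n_pos in simp)
      fix i y assume iy: "i < n - 1" "y < n - 1"
      have sub: "del_region l j P \<subseteq> {..<n - 1} \<times> {..<n - 1}"
        using del(1) by (simp add: band_def)
      show "0 \<le> (-1) ^ sym_pairs (del_region i y (del_region l j P)) * det (mat_delete (mat_delete X l j) i y)"
        by (rule IH[OF _ band_del[OF del(1) iy] mat_delete_carrier[OF del(2)]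
              supported_on_mat_delete[OF del(3) del(2)] signed_minors_mat_delete[OF del(4) del(2) sub iy]])
          (use n_pos in simp)
    qed
  qed
qed

theorem det_sign:
  assumes "band n P" "X \<in> carrier_mat n n" "supported_on P X" "signed_minors P X"
  shows "0 \<le> (-1) ^ sym_pairs P * det X"
  using assms
proof (induction n arbitrary: P X rule: less_induct)
  case (less n)
  note band = less.prems(1) and X = less.prems(2) and supp = less.prems(3) and minors = less.prems(4)
  have conv: "convex_region P" and sub: "P \<subseteq> {..<n} \<times> {..<n}"
    using band by (auto simp: band_def)
  have zero: "X $$ (i, j) = 0" if "i < n" "j < n" "(i, j) \<notin> P" for i j
    using supp X that by (auto simp: supported_on_def)
  consider "n = 0" | a where "a < n" "(a, a) \<notin> P" | "0 < n" "\<And>a. a < n \<Longrightarrow> (a, a) \<in> P"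
    by blast
  then show ?case
  proof cases
    case 1
    then have "P = {}" using sub by simp
    then show ?thesis using X 1 by (simp add: sym_pairs_def)
  next
    case (2 a)
    \<comment> \<open>By convexity a missing \<open>(a, a)\<close> has no cell weakly north-east of
      it, or none weakly south-west of it. Either way a zero block too large for a transversal
      appears, in \<open>X\<close> or in its transpose.\<close>
    have "det X = 0"
    proof (cases "\<exists>i j. i \<le> a \<and> a \<le> j \<and> (i, j) \<in> P")
      case False
      show ?thesis
        by (rule det_zero_block[OF X 2(1)]) (use False zero 2 in auto)
    next
      case True
      then obtain i j where ij: "i \<le> a" "a \<le> j" "(i, j) \<in> P" by blast
      have "(i', j') \<notin> P" if "a \<le> i'" "j' \<le> a" for i' j'
        using convex_regionD[OF conv ij(3), of i' j' a a] that ij 2 by blast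
      then have "det (transpose_mat X) = 0"
        by (intro det_zero_block[of _ n a]) (use X 2 zero in auto)
      then show ?thesis using det_transpose[OF X] by simp
    qed
    then show ?thesis by simp
  next
    case 3
    show ?thesis
    proof (rule band_corner_exists[OF band 3(2) 3(1)])
      fix r q assume 1: "band_corner n P r q"
      show ?thesis
        by (rule det_sign_corner[OF 1 X supp minors less.IH])
    next
      fix r q assume 2: "band_corner n (P\<inverse>) r q"
      have "0 \<le> (-1) ^ sym_pairs (P\<inverse>) * det (transpose_mat X)"
        by (rule det_sign_corner[OF 2 _ supported_on_transpose[OF supp] signed_minors_transpose[OF minors X sub] less.IH])
          (use X in simp)
      then show ?thesis using det_transpose[OF X] by simp
    qed
  qed
qed

section \<open>Repeated labels and nonvanishing\<close>

definition strict_minors :: "(nat \<Rightarrow> 'r) \<Rightarrow> (nat \<Rightarrow> 'c) \<Rightarrow> (nat \<times> nat) set \<Rightarrow> real mat \<Rightarrow> bool" where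
  "strict_minors R C P X \<longleftrightarrow> (\<forall>(s :: nat) f g. strict_mono_on {..<s} f \<longrightarrow> strict_mono_on {..<s} g \<longrightarrow>
     (\<forall>a<s. \<forall>b<s. (f a, g b) \<in> P) \<longrightarrow> inj_on (\<lambda>a. R (f a)) {..<s} \<longrightarrow> inj_on (\<lambda>b. C (g b)) {..<s} \<longrightarrow>
     det (mat s s (\<lambda>(a, b). X $$ (f a, g b))) \<noteq> 0)"

text \<open>What is left of a weakly monotone labelling when its direction is forgotten: row labels
  and reversed column labels can then be treated alike.\<close>

definition contiguous :: "nat \<Rightarrow> (nat \<Rightarrow> 'r) \<Rightarrow> bool" where
  "contiguous n R \<longleftrightarrow> (\<forall>i j k. i \<le> j \<longrightarrow> j \<le> k \<longrightarrow> k < n \<longrightarrow> R i = R k \<longrightarrow> R j = R i)"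

definition separated_rows :: "nat \<Rightarrow> (nat \<Rightarrow> 'r) \<Rightarrow> (nat \<times> nat) set \<Rightarrow> bool" where
  "separated_rows n R P \<longleftrightarrow> (\<forall>x x'. x < x' \<longrightarrow> x' < n \<longrightarrow> R x = R x' \<longrightarrow> (\<exists>c. (x, c) \<in> P \<longleftrightarrow> (x', c) \<notin> P))"

text \<open>
  Balance says that the diagonal blocks of P do not interact: a band that is only block triangular
  has cells on no transversal, and these could separate equal labels of a singular matrix.
\<close>

definition balanced :: "nat \<Rightarrow> (nat \<times> nat) set \<Rightarrow> bool" where
  "balanced n P \<longleftrightarrow> (\<forall>t. Suc t < n \<longrightarrow> ((t, Suc t) \<in> P \<longleftrightarrow> (Suc t, t) \<in> P))"

definition labelled_band ::
    "nat \<Rightarrow> (nat \<times> nat) set \<Rightarrow> (nat \<Rightarrow> 'r) \<Rightarrow> (nat \<Rightarrow> 'c) \<Rightarrow> real mat \<Rightarrow> bool" where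
  "labelled_band n P R C X \<longleftrightarrow> band n P \<and> (\<forall>a<n. (a, a) \<in> P) \<and> balanced n P \<and>
     X \<in> carrier_mat n n \<and> supported_on P X \<and> signed_minors P X \<and> strict_minors R C P X \<and>
     contiguous n R \<and> contiguous n C \<and> separated_rows n R P \<and> separated_rows n C (P\<inverse>)"

lemma strict_minorsD:
  "strict_minors R C P X \<Longrightarrow> strict_mono_on {..<s} f \<Longrightarrow> strict_mono_on {..<s} g \<Longrightarrow>
     (\<And>a b. a < s \<Longrightarrow> b < s \<Longrightarrow> (f a, g b) \<in> P) \<Longrightarrow>
     inj_on (\<lambda>a. R (f a)) {..<s} \<Longrightarrow> inj_on (\<lambda>b. C (g b)) {..<s} \<Longrightarrow>
     det (mat s s (\<lambda>(a, b). X $$ (f a, g b))) \<noteq> 0"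
  unfolding strict_minors_def by blast

lemma strict_minors_reindex:
  assumes X: "strict_minors R C P X" and mono: "strict_mono \<phi>" "strict_mono \<psi>"
    and P': "\<And>a b. (a, b) \<in> P' \<Longrightarrow> (\<phi> a, \<psi> b) \<in> P"
    and X': "\<And>a b. (a, b) \<in> P' \<Longrightarrow> X' $$ (a, b) = X $$ (\<phi> a, \<psi> b)"
  shows "strict_minors (R \<circ> \<phi>) (C \<circ> \<psi>) P' X'"
  unfolding strict_minors_def
proof (intro allI impI)
  fix s :: nat and f g
  assume f: "strict_mono_on {..<s} f" and g: "strict_mono_on {..<s} g"
    and in': "\<forall>a<s. \<forall>b<s. (f a, g b) \<in> P'"
    and inj: "inj_on (\<lambda>a. (R \<circ> \<phi>) (f a)) {..<s}" "inj_on (\<lambda>b. (C \<circ> \<psi>) (g b)) {..<s}"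
  have "det (mat s s (\<lambda>(a, b). X $$ ((\<phi> \<circ> f) a, (\<psi> \<circ> g) b))) \<noteq> 0"
  proof (rule strict_minorsD[OF X])
    show "strict_mono_on {..<s} (\<phi> \<circ> f)" "strict_mono_on {..<s} (\<psi> \<circ> g)"
      using f g mono by (auto simp: strict_mono_on_def strict_mono_def)
  qed (use in' P' inj in auto)
  also have "mat s s (\<lambda>(a, b). X $$ ((\<phi> \<circ> f) a, (\<psi> \<circ> g) b)) = mat s s (\<lambda>(a, b). X' $$ (f a, g b))"
    using in' X' by (intro eq_matI) auto
  finally show "det (mat s s (\<lambda>(a, b). X' $$ (f a, g b))) \<noteq> 0" .
qed

lemma strict_minors_transpose:
  assumes X: "strict_minors R C P X" and c: "X \<in> carrier_mat n n" and P: "P \<subseteq> {..<n} \<times> {..<n}"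
  shows "strict_minors C R (P\<inverse>) (transpose_mat X)"
  unfolding strict_minors_def
proof (intro allI impI)
  fix s :: nat and f g
  assume f: "strict_mono_on {..<s} f" and g: "strict_mono_on {..<s} g"
    and in': "\<forall>a<s. \<forall>b<s. (f a, g b) \<in> P\<inverse>"
    and inj: "inj_on (\<lambda>a. C (f a)) {..<s}" "inj_on (\<lambda>b. R (g b)) {..<s}"
  have "det (mat s s (\<lambda>(a, b). X $$ (g a, f b))) \<noteq> 0"
    by (rule strict_minorsD[OF X g f _ inj(2) inj(1)]) (use in' in auto)
  also have "det (mat s s (\<lambda>(a, b). X $$ (g a, f b))) = det (transpose_mat (mat s s (\<lambda>(a, b). X $$ (g a, f b))))"
    by (rule det_transpose[symmetric, of _ s]) simp
  also have "transpose_mat (mat s s (\<lambda>(a, b). X $$ (g a, f b))) = mat s s (\<lambda>(a, b). transpose_mat X $$ (f a, g b))"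
  proof (intro eq_matI)
    fix a b
    assume ab: "a < dim_row (mat s s (\<lambda>(a, b). transpose_mat X $$ (f a, g b)))"
      "b < dim_col (mat s s (\<lambda>(a, b). transpose_mat X $$ (f a, g b)))"
    then have "(g b, f a) \<in> P" using in' by auto
    then have "g b < n" "f a < n" using P by auto
    then show "transpose_mat (mat s s (\<lambda>(a, b). X $$ (g a, f b))) $$ (a, b)
      = mat s s (\<lambda>(a, b). transpose_mat X $$ (f a, g b)) $$ (a, b)"
      using ab c by auto
  qed auto
  finally show "det (mat s s (\<lambda>(a, b). transpose_mat X $$ (f a, g b))) \<noteq> 0" .
qed

lemma contiguousD: "contiguous n R \<Longrightarrow> i \<le> j \<Longrightarrow> j \<le> k \<Longrightarrow> k < n \<Longrightarrow> R i = R k \<Longrightarrow> R j = R i"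
  unfolding contiguous_def by blast

lemma contiguous_reindex:
  assumes "contiguous n R" "strict_mono \<phi>" "\<And>a. a < m \<Longrightarrow> \<phi> a < n"
  shows "contiguous m (R \<circ> \<phi>)"
  unfolding contiguous_def comp_def
proof (intro allI impI)
  fix i j k assume "i \<le> j" "j \<le> k" "k < m" "R (\<phi> i) = R (\<phi> k)"
  then show "R (\<phi> j) = R (\<phi> i)"
    using contiguousD[OF assms(1), of "\<phi> i" "\<phi> j" "\<phi> k"] assms(2,3) by (simp add: strict_mono_less_eq)
qed

lemma separated_rowsD:
  assumes "separated_rows n R P" "x < x'" "x' < n" "R x = R x'" "\<And>c. (x, c) \<in> P \<longleftrightarrow> (x', c) \<in> P"
  shows False
  using assms unfolding separated_rows_def by blast

lemma separated_rows_del: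
  assumes "\<And>x x'. x < x' \<Longrightarrow> x' < n \<Longrightarrow> x \<noteq> i \<Longrightarrow> x' \<noteq> i \<Longrightarrow> R x = R x' \<Longrightarrow>
    \<exists>c. c \<noteq> j \<and> ((x, c) \<in> P \<longleftrightarrow> (x', c) \<notin> P)"
  shows "separated_rows (n - 1) (R \<circ> insert_index i) (del_region i j P)"
  unfolding separated_rows_def
proof (intro allI impI)
  fix a a' assume a: "a < a'" "a' < n - 1" "(R \<circ> insert_index i) a = (R \<circ> insert_index i) a'"
  obtain c where c: "c \<noteq> j" "(insert_index i a, c) \<in> P \<longleftrightarrow> (insert_index i a', c) \<notin> P"
    using assms[of "insert_index i a" "insert_index i a'"] a insert_index_less[of a' n i] by auto
  then have "c = insert_index j (delete_index j c)"
    by (simp add: insert_delete_index)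
  then show "\<exists>c. (a, c) \<in> del_region i j P \<longleftrightarrow> (a', c) \<notin> del_region i j P"
    using c by (metis mem_del_region)
qed

lemma labelled_band_converse:
  assumes "labelled_band n P R C X" shows "labelled_band n (P\<inverse>) C R (transpose_mat X)"
  using assms unfolding labelled_band_def
  by (auto intro: band_converse supported_on_transpose signed_minors_transpose strict_minors_transpose
      simp: balanced_def dest: band_def[THEN iffD1])

lemma labelled_band_del:
  assumes L: "labelled_band n P R C X" and ij: "i < n" "j < n"
    and diag: "\<And>t. t < n - 1 \<Longrightarrow> (insert_index i t, insert_index j t) \<in> P"
    and bal: "\<And>t. Suc t < n - 1 \<Longrightarrow> (insert_index i t, insert_index j (Suc t)) \<in> P
      \<longleftrightarrow> (insert_index i (Suc t), insert_index j t) \<in> P"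
    and rows: "\<And>x x'. x < x' \<Longrightarrow> x' < n \<Longrightarrow> x \<noteq> i \<Longrightarrow> x' \<noteq> i \<Longrightarrow> R x = R x' \<Longrightarrow>
      \<exists>c. c \<noteq> j \<and> ((x, c) \<in> P \<longleftrightarrow> (x', c) \<notin> P)"
    and cols: "\<And>y y'. y < y' \<Longrightarrow> y' < n \<Longrightarrow> y \<noteq> j \<Longrightarrow> y' \<noteq> j \<Longrightarrow> C y = C y' \<Longrightarrow>
      \<exists>c. c \<noteq> i \<and> ((c, y) \<in> P \<longleftrightarrow> (c, y') \<notin> P)"
  shows "labelled_band (n - 1) (del_region i j P) (R \<circ> insert_index i) (C \<circ> insert_index j) (mat_delete X i j)"
proof -
  have L': "band n P" "X \<in> carrier_mat n n" "supported_on P X" "signed_minors P X" "strict_minors R C P X"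
    "contiguous n R" "contiguous n C"
    using L by (auto simp: labelled_band_def)
  have sub: "P \<subseteq> {..<n} \<times> {..<n}"
    using L'(1) by (simp add: band_def)
  have "strict_minors (R \<circ> insert_index i) (C \<circ> insert_index j) (del_region i j P) (mat_delete X i j)"
  proof (rule strict_minors_reindex[OF L'(5) strict_mono_insert_index strict_mono_insert_index])
    fix a b assume "(a, b) \<in> del_region i j P"
    then show "(insert_index i a, insert_index j b) \<in> P"
      and "mat_delete X i j $$ (a, b) = X $$ (insert_index i a, insert_index j b)"
      using sub ij by (auto intro!: mat_delete_entry[OF L'(2)] insert_index_lessD simp del: One_nat_def)
  qed
  moreover have "separated_rows (n - 1) (R \<circ> insert_index i) (del_region i j P)"
    by (rule separated_rows_del) (rule rows)
  moreover have "separated_rows (n - 1) (C \<circ> insert_index j) ((del_region i j P)\<inverse>)"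
    unfolding del_region_converse by (rule separated_rows_del) (use cols in simp)
  moreover have "contiguous (n - 1) (R \<circ> insert_index i)" "contiguous (n - 1) (C \<circ> insert_index j)"
    using L'(6,7) by (auto intro!: contiguous_reindex insert_index_less strict_mono_insert_index simp del: One_nat_def)
  moreover have "balanced (n - 1) (del_region i j P)"
    unfolding balanced_def mem_del_region using bal by blast
  ultimately show ?thesis
    unfolding labelled_band_def
    using band_del[OF L'(1) ij] mat_delete_carrier[OF L'(2)] supported_on_mat_delete[OF L'(3,2)]
      signed_minors_mat_delete[OF L'(4,2) sub ij] diag by simp
qed

lemma kernel_trivial:
  fixes A :: "real mat"
  assumes A: "A \<in> carrier_mat s s" and d: "det A \<noteq> 0"
    and v: "\<And>i. i < s \<Longrightarrow> (\<Sum>j<s. A $$ (i, j) * v j) = 0" and j: "j < s"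
  shows "v j = 0"
proof -
  have "0 = (\<Sum>i<s. cofactor A i j * (\<Sum>c<s. A $$ (i, c) * v c))"
    using v by simp
  also have "\<dots> = (\<Sum>c<s. (\<Sum>i<s. cofactor A i j * A $$ (i, c)) * v c)"
    unfolding sum_distrib_left sum_distrib_right by (subst sum.swap) (simp add: mult.assoc)
  also have "\<dots> = (\<Sum>c<s. if c = j then det A * v j else 0)"
    by (rule sum.cong) (use cofactor_column_orthogonality[OF A j] in auto)
  also have "\<dots> = det A * v j"
    using j by simp
  finally show ?thesis using d by simp
qed

lemma left_kernel_trivial:
  fixes A :: "real mat"
  assumes A: "A \<in> carrier_mat s s" and d: "det A \<noteq> 0"
    and v: "\<And>j. j < s \<Longrightarrow> (\<Sum>i<s. v i * A $$ (i, j)) = 0" and i: "i < s"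
  shows "v i = 0"
  by (rule kernel_trivial[of "transpose_mat A" s])
    (use A d i v det_transpose[OF A] in \<open>simp_all add: mult.commute\<close>)

lemma (in band_corner) labels_rows_inj:
  assumes "separated_rows n R P" shows "inj_on R {..<r}"
proof (rule linorder_inj_onI)
  fix x x' assume x: "x < x'" "x \<in> {..<r}" "x' \<in> {..<r}"
  show "R x \<noteq> R x'"
  proof
    assume eq: "R x = R x'"
    show False
      by (rule separated_rowsD[OF assms x(1) _ eq]) (use x rows_r r_le_n in auto)
  qed
qed auto

section \<open>Corner deletions and nonvanishing\<close>

context band_step
begin

context
  fixes R :: "nat \<Rightarrow> 'r" and C :: "nat \<Rightarrow> 'c" and X :: "real mat"
  assumes L: "labelled_band n P R C X"
begin

lemma labels:
  "balanced n P" "X \<in> carrier_mat n n" "supported_on P X" "signed_minors P X" "strict_minors R C P X"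
  "contiguous n R" "contiguous n C" "separated_rows n R P" "separated_rows n C (P\<inverse>)"
  using L by (auto simp: labelled_band_def)

lemma balancedD: "Suc t < n \<Longrightarrow> (t, Suc t) \<in> P \<longleftrightarrow> (Suc t, t) \<in> P"
  using labels(1) by (simp add: balanced_def)

text \<open>The cell is the lower end of the first column. Equally labelled rows told apart by
  column 0 alone lie on both sides of row \<open>r - 1\<close>; by contiguity row
  \<open>r - 1\<close> then shares the label of the upper one, against
  \<open>separated_rows\<close>, as these two have equal support. Separation of columns loses
  nothing, since row 0 is another row with the support of row \<open>r - 1\<close>.\<close>

lemma del_first_corner:
  "labelled_band (n - 1) (del_region (r - 1) 0 P) (R \<circ> insert_index (r - 1)) (C \<circ> insert_index 0)
     (mat_delete X (r - 1) 0)"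
proof (rule labelled_band_del[OF L])
  show "r - 1 < n" "0 < n" using r_pos r_le_n n_pos by auto
next
  fix t assume t: "t < n - 1"
  show "(insert_index (r - 1) t, insert_index 0 t) \<in> P"
    using t rows_r[of t "Suc t"] diag[of "Suc t"] r_less by (cases "t < r - 1") auto
next
  fix t assume t: "Suc t < n - 1"
  consider "Suc t < r - 1" | "Suc t = r - 1" | "r - 1 \<le> t" by linarith
  then show "(insert_index (r - 1) t, insert_index 0 (Suc t)) \<in> P \<longleftrightarrow> (insert_index (r - 1) (Suc t), insert_index 0 t) \<in> P"
  proof cases
    case 1
    then show ?thesis
      using rows_r[of t "Suc (Suc t)"] rows_r[of "Suc t" "Suc t"] r_less by simp
  next
    \<comment> \<open>Deletion makes neighbours of the diagonal out of \<open>(r - 2, r)\<close> and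
      \<open>(r, r - 1)\<close>; both lie in \<open>P\<close>, because \<open>r < q\<close> and
      \<open>u \<le> r - 1\<close>.\<close>
    case 2
    then show ?thesis
      using rows_r[of t "Suc (Suc t)"] row_r[of "Suc t"] r_less u_less by simp
  next
    case 3
    then show ?thesis
      using balancedD[of "Suc t"] t by simp
  qed
next
  fix x x' assume x: "x < x'" "x' < n" "x \<noteq> r - 1" "x' \<noteq> r - 1" "R x = R x'"
  show "\<exists>c. c \<noteq> 0 \<and> ((x, c) \<in> P \<longleftrightarrow> (x', c) \<notin> P)"
  proof (rule ccontr)
    assume no: "\<not> ?thesis"
    have "(x, 0) \<in> P \<longleftrightarrow> (x', 0) \<notin> P"
    proof (rule ccontr)
      assume "\<not> ?thesis"
      then have "(x, c) \<in> P \<longleftrightarrow> (x', c) \<in> P" for c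
        using no by metis
      then show False
        by (rule separated_rowsD[OF labels(8) x(1,2,5)])
    qed
    then have xr: "x < r - 1" "r \<le> x'"
      using col_0[of x] col_0[of x'] x by auto
    then have "R (r - 1) = R x"
      using contiguousD[OF labels(6), of x "r - 1" x'] x by auto
    then show False
      using inj_onD[OF labels_rows_inj[OF labels(8)], of "r - 1" x] xr by force
  qed
next
  fix y y' assume y: "y < y'" "y' < n" "y \<noteq> 0" "y' \<noteq> 0" "C y = C y'"
  show "\<exists>c. c \<noteq> r - 1 \<and> ((c, y) \<in> P \<longleftrightarrow> (c, y') \<notin> P)"
  proof (rule ccontr)
    assume no: "\<not> ?thesis"
    have "(r - 1, y) \<in> P \<longleftrightarrow> (r - 1, y') \<notin> P"
    proof (rule ccontr)
      assume "\<not> ?thesis"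
      then have "(y, c) \<in> P\<inverse> \<longleftrightarrow> (y', c) \<in> P\<inverse>" for c
        using no by (metis converse_iff)
      then show False
        by (rule separated_rowsD[OF labels(9) y(1,2,5)])
    qed
    then have "(0, y) \<in> P \<longleftrightarrow> (0, y') \<notin> P"
      using rows_r[of "r - 1" y] rows_r[of "r - 1" y'] rows_r[of 0 y] rows_r[of 0 y'] r_pos by simp
    moreover have "0 \<noteq> r - 1"
      using u_less u_pos by simp
    ultimately show False using no by blast
  qed
qed

text \<open>The cell is the lower end of column \<open>u\<close>. For rows the argument is that of
  the first corner, with column 0 forcing the upper row into the group \<open>[r, r')\<close>.
  Equally labelled columns told apart by row \<open>r' - 1\<close> alone are some
  \<open>y < u\<close> and \<open>y'\<close> with \<open>u < y' < q\<close>. If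
  \<open>r' - 1 \<noteq> r\<close>, then row \<open>r\<close> separates them too; otherwise column
  \<open>y'\<close> has the support of column \<open>u\<close>, and by contiguity its label.\<close>

lemma del_second_corner:
  assumes A: "(r' - 1, q) \<notin> P"
  shows "labelled_band (n - 1) (del_region (r' - 1) u P) (R \<circ> insert_index (r' - 1)) (C \<circ> insert_index u)
     (mat_delete X (r' - 1) u)"
proof -
  note rA = rows_A[OF A]
  have r'q: "r' - 1 < q"
    using rA[of "r' - 1" "r' - 1"] diag[of "r' - 1"] r_r' r'_le_n by simp
  show ?thesis
  proof (rule labelled_band_del[OF L])
    show "r' - 1 < n" "u < n" using r_r' r'_le_n u_less r_le_n by auto
  next
    fix t assume t: "t < n - 1"
    consider "t < u" | "u \<le> t" "t < r" | "r \<le> t" "t < r' - 1" | "r' - 1 \<le> t" by linarith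
    then show "(insert_index (r' - 1) t, insert_index u t) \<in> P"
    proof cases
      case 1
      then show ?thesis using diag[of t] t u_less r_r' by simp
    next
      case 2
      then show ?thesis using rows_r[of t "Suc t"] r_less r_r' by simp
    next
      case 3
      then show ?thesis using rA[of t "Suc t"] r'q u_less by simp
    next
      case 4
      then show ?thesis using diag[of "Suc t"] t u_less r_r' by simp
    qed
  next
    fix t assume t: "Suc t < n - 1"
    consider "Suc t < r' - 1" | "Suc t = r' - 1" | "r' - 1 \<le> t" by linarith
    then show "(insert_index (r' - 1) t, insert_index u (Suc t)) \<in> P
      \<longleftrightarrow> (insert_index (r' - 1) (Suc t), insert_index u t) \<in> P"
    proof cases
      case 1
      have "(t, insert_index u (Suc t)) \<in> P"
        using rows_r[of t "insert_index u (Suc t)"] rA[of t "insert_index u (Suc t)"] 1 r'q u_less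
        by (cases "t < r") (auto simp: insert_index_def)
      moreover have "(Suc t, insert_index u t) \<in> P"
        using rows_r[of "Suc t" "insert_index u t"] rA[of "Suc t" "insert_index u t"] 1 r'q u_less
        by (cases "Suc t < r") (auto simp: insert_index_def)
      ultimately show ?thesis using 1 by simp
    next
      case 2
      have "(t, r') \<in> P \<longleftrightarrow> r' < q"
        using rows_r[of t r'] rA[of t r'] 2 u_less r_r' by (cases "t < r") auto
      moreover have "(r', r' - 1) \<in> P \<longleftrightarrow> r' < q"
        using balancedD[of "r' - 1"] rA[of "r' - 1" r'] r_r' u_less 2 t by simp
      moreover have "u \<le> t" "r' = Suc (Suc t)" using 2 u_less r_r' by auto
      ultimately show ?thesis by simp
    next
      case 3
      then show ?thesis
        using balancedD[of "Suc t"] t u_less r_r' by simp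
    qed
  next
    fix x x' assume x: "x < x'" "x' < n" "x \<noteq> r' - 1" "x' \<noteq> r' - 1" "R x = R x'"
    show "\<exists>c. c \<noteq> u \<and> ((x, c) \<in> P \<longleftrightarrow> (x', c) \<notin> P)"
    proof (rule ccontr)
      assume no: "\<not> ?thesis"
      have "(x, u) \<in> P \<longleftrightarrow> (x', u) \<notin> P"
      proof (rule ccontr)
        assume "\<not> ?thesis"
        then have "(x, c) \<in> P \<longleftrightarrow> (x', c) \<in> P" for c
          using no by metis
        then show False
          by (rule separated_rowsD[OF labels(8) x(1,2,5)])
      qed
      then have xr: "x < r' - 1" "r' \<le> x'"
        using col_u[of x] col_u[of x'] x by auto
      have "0 \<noteq> u"
        using u_pos by simp
      then have "(x, 0) \<in> P \<longleftrightarrow> (x', 0) \<in> P"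
        using no by blast
      then have rx: "r \<le> x"
        using col_0[of x] col_0[of x'] xr r_r' by simp
      have "R (r' - 1) = R x"
        using contiguousD[OF labels(6), of x "r' - 1" x'] x xr by simp
      then show False
        by (intro separated_rowsD[OF labels(8) xr(1)])
          (use rx xr rA[of x] rA[of "r' - 1"] r_r' r'_le_n in auto)
    qed
  next
    fix y y' assume y: "y < y'" "y' < n" "y \<noteq> u" "y' \<noteq> u" "C y = C y'"
    show "\<exists>c. c \<noteq> r' - 1 \<and> ((c, y) \<in> P \<longleftrightarrow> (c, y') \<notin> P)"
    proof (rule ccontr)
      assume no: "\<not> ?thesis"
      have "(r' - 1, y) \<in> P \<longleftrightarrow> (r' - 1, y') \<notin> P"
      proof (rule ccontr)
        assume "\<not> ?thesis"
        then have "(y, c) \<in> P\<inverse> \<longleftrightarrow> (y', c) \<in> P\<inverse>" for c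
          using no by (metis converse_iff)
        then show False
          by (rule separated_rowsD[OF labels(9) y(1,2,5)])
      qed
      then have "(u \<le> y \<and> y < q) \<longleftrightarrow> \<not> (u \<le> y' \<and> y' < q)"
        using rA[of "r' - 1" y] rA[of "r' - 1" y'] r_r' by simp
      moreover have "y < q \<longleftrightarrow> y' < q"
      proof -
        have "0 \<noteq> r' - 1"
          using r_r' r_pos by simp
        then have "(0, y) \<in> P \<longleftrightarrow> (0, y') \<in> P"
          using no by blast
        then show ?thesis using rows_r[of 0] r_pos by simp
      qed
      ultimately have yu: "y < u" "u < y'" "y' < q"
        using y by linarith+
      have "C u = C y"
        using contiguousD[OF labels(7), of y u y'] y yu by simp
      have "r' - 1 = r"
      proof (rule ccontr)
        assume "r' - 1 \<noteq> r"
        then have "(r, y) \<in> P \<longleftrightarrow> (r, y') \<in> P" using no by metis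
        then show False
          using cols_u[of y r] row_r[of y'] yu by simp
      qed
      then have "r' = Suc r" using r_r' by simp
      have "(i, y') \<in> P \<longleftrightarrow> i < r'" for i
      proof (cases "i = r' - 1")
        case True
        then show ?thesis using row_r[of y'] \<open>r' = Suc r\<close> yu by simp
      next
        case False
        then have "(i, y') \<in> P \<longleftrightarrow> (i, y) \<in> P" using no by blast
        then show ?thesis using cols_u[of y i] yu False \<open>r' = Suc r\<close> by auto
      qed
      then show False
        by (intro separated_rowsD[OF labels(9), of u y'])
          (use yu y \<open>C u = C y\<close> col_u in auto)
    qed
  qed
qed

text \<open>If \<open>det X = 0\<close>, the two products are equal, yet by \<open>det_sign\<close>
  and \<open>sign_cross\<close> they cannot have the same nonzero sign; so both vanish for every
  choice of indices. The minor at the first corner is nonzero by induction, which kills all minors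
  at \<open>(l, j)\<close>, and the second corner is one of them. If the columns agree, kernel
  vectors take the place of the second corner.\<close>

lemma det_nonzero_step:
  assumes IH: "\<And>P' (R' :: nat \<Rightarrow> 'r) (C' :: nat \<Rightarrow> 'c) X'. labelled_band (n - 1) P' R' C' X' \<Longrightarrow> det X' \<noteq> 0"
  shows "det X \<noteq> 0"
proof
  assume d: "det X = 0"
  note X = labels(2)
  have sub: "P \<subseteq> {..<n} \<times> {..<n}"
    using band by (simp add: band_def)
  have zero: "X $$ (i, j) = 0" if "i < n" "j < n" "(i, j) \<notin> P" for i j
    using labels(3) X that by (auto simp: supported_on_def)
  have sgn: "0 \<le> (-1) ^ sym_pairs (del_region i j P) * det (mat_delete X i j)" if "i < n" "j < n" for i j
    by (rule det_sign[OF band_del[OF band that] mat_delete_carrier[OF X]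
          supported_on_mat_delete[OF labels(3) X] signed_minors_mat_delete[OF labels(4) X sub that]])
  have both: "det (mat_delete X i y) * det (mat_delete X l j) = 0 \<and> det (mat_delete X i j) * det (mat_delete X l y) = 0"
    if i: "i < r" and y: "y < u" and l: "r \<le> l" "l < r'" and j: "u \<le> j" "j < q" for i y l j
  proof -
    have lt: "i < l" "l < n" "y < j" "j < n"
      using i y l j r'_le_n q_le_n by auto
    let ?a = "det (mat_delete X i y)" and ?b = "det (mat_delete X l j)"
      and ?c = "det (mat_delete X i j)" and ?e = "det (mat_delete X l y)"
    let ?sa = "(-1 :: real) ^ sym_pairs (del_region i y P)" and ?sb = "(-1 :: real) ^ sym_pairs (del_region l j P)"
      and ?sc = "(-1 :: real) ^ sym_pairs (del_region i j P)" and ?se = "(-1 :: real) ^ sym_pairs (del_region l y P)"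
    have sc: "?sc * ?se = - (?sa * ?sb)"
      unfolding power_add[symmetric]
      by (rule neg_one_power_odd) (use sign_cross[OF i y l j] in \<open>simp add: add.assoc\<close>)
    have eq: "?a * ?b = ?c * ?e"
      using lewis_carroll[OF X lt] d by simp
    have "0 \<le> (?sa * ?a) * (?sb * ?b)" "0 \<le> (?sc * ?c) * (?se * ?e)"
      by (intro mult_nonneg_nonneg sgn; use lt i y in linarith)+
    moreover have "(?sc * ?c) * (?se * ?e) = - ((?sa * ?sb) * (?a * ?b))"
    proof -
      have "(?sc * ?c) * (?se * ?e) = (?sc * ?se) * (?c * ?e)"
        by (simp only: ac_simps)
      then show ?thesis unfolding sc eq[symmetric] by simp
    qed
    moreover have "(?sa * ?a) * (?sb * ?b) = (?sa * ?sb) * (?a * ?b)"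
      by (simp only: ac_simps)
    ultimately have "(?sa * ?sb) * (?a * ?b) = 0"
      by linarith
    then have "?a * ?b = 0"
      by simp
    then show ?thesis using eq by simp
  qed
  have first: "det (mat_delete X (r - 1) 0) \<noteq> 0"
    by (rule IH[OF del_first_corner])
  have second: "det (mat_delete X l j) = 0" if "r \<le> l" "l < r'" "u \<le> j" "j < q" for l j
    using both[of "r - 1" 0 l j] first that r_pos u_pos by simp
  show False
  proof (cases "(r' - 1, q) \<in> P")
    case False
    have "r \<le> r' - 1" "r' - 1 < r'" "u < q"
      using r_r' u_less r_less by auto
    then show False
      using IH[OF del_second_corner[OF False]] second[of "r' - 1" u] by blast
  next
    case True
    note cB = cols_B[OF True]
    have row_inj: "inj_on R {..<r}"
      using labels_rows_inj[OF labels(8)] .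
    have C_ne: "C y \<noteq> C y'" if "y < y'" "y' < q" "y' < u \<or> u \<le> y" for y y'
    proof
      assume eq: "C y = C y'"
      show False
        by (rule separated_rowsD[OF labels(9) that(1) less_le_trans[OF that(2) q_le_n] eq])
          (use that cols_u[of y] cols_u[of y'] cB[of y] cB[of y'] in auto)
    qed
    show False
    proof (cases "\<exists>l. r \<le> l \<and> l < r' \<and> det (mat_delete X l 0) \<noteq> 0")
      case True
      then obtain l where l: "r \<le> l" "l < r'" "det (mat_delete X l 0) \<noteq> 0" by blast
      \<comment> \<open>A nonzero minor at \<open>(l, 0)\<close> kills the cofactors of row
        \<open>r - 1\<close> in the columns \<open>[u, q)\<close>. The remaining ones, in the
        columns \<open>[0, u)\<close>, are a kernel vector of the leading block of size
        \<open>u\<close>, whose labels are distinct.\<close>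
      have K0: "cofactor X (r - 1) j = 0" if "u \<le> j" "j < q" for j
        using both[of "r - 1" 0 l j] l that r_pos u_pos by (simp add: cofactor_def)
      define A where "A = mat u u (\<lambda>(a, b). X $$ (a, b))"
      have "det A \<noteq> 0"
        unfolding A_def
      proof (rule strict_minorsD[OF labels(5), where f = "\<lambda>a. a" and g = "\<lambda>b. b"])
        show "inj_on (\<lambda>a. R a) {..<u}"
          using row_inj u_less by (auto simp: inj_on_def)
        show "inj_on (\<lambda>b. C b) {..<u}"
          by (rule linorder_inj_onI) (use C_ne u_less r_less in auto)
      qed (use rows_r u_less r_less in \<open>auto simp: strict_mono_on_def\<close>)
      moreover have "(\<Sum>j<u. A $$ (i, j) * cofactor X (r - 1) j) = 0" if i: "i < u" for i
      proof -
        have "(\<Sum>j<u. A $$ (i, j) * cofactor X (r - 1) j) = (\<Sum>j<n. X $$ (i, j) * cofactor X (r - 1) j)"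
        proof (rule sum.mono_neutral_cong_left)
          show "\<forall>j\<in>{..<n} - {..<u}. X $$ (i, j) * cofactor X (r - 1) j = 0"
          proof
            fix j assume "j \<in> {..<n} - {..<u}"
            then show "X $$ (i, j) * cofactor X (r - 1) j = 0"
              using K0[of j] zero[of i j] rows_r[of i j] i u_less r_le_n by (cases "j < q") auto
          qed
        qed (use i u_less r_le_n in \<open>auto simp: A_def\<close>)
        also have "\<dots> = 0"
          using cofactor_row_orthogonality[OF X, of i "r - 1"] d i u_less r_le_n by auto
        finally show ?thesis .
      qed
      ultimately have "cofactor X (r - 1) 0 = 0"
        using kernel_trivial[of A u "cofactor X (r - 1)" 0] u_pos by (simp add: A_def)
      then show False using first by (simp add: cofactor_def)
    next
      case False
      \<comment> \<open>Now the cofactors of column 0 vanish in the rows \<open>[r, r')\<close>, so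
        those in the first \<open>r\<close> rows form a left kernel vector. Column \<open>u\<close>
        is skipped because it is the only one in \<open>[u, q)\<close> whose label may recur before
        \<open>u\<close>; \<open>r < q\<close> leaves enough columns.\<close>
      define A where "A = mat r r (\<lambda>(a, b). X $$ (a, insert_index u b))"
      have ins_q: "insert_index u b < q" if "b < r" for b
        using that r_less by (auto simp: insert_index_def)
      have "det A \<noteq> 0"
        unfolding A_def
      proof (rule strict_minorsD[OF labels(5), where f = "\<lambda>a. a" and g = "insert_index u"])
        show "inj_on (\<lambda>b. C (insert_index u b)) {..<r}"
        proof (rule linorder_inj_onI)
          fix b b' assume b: "b < b'" "b \<in> {..<r}" "b' \<in> {..<r}"
          let ?y = "insert_index u b" and ?y' = "insert_index u b'"
          have y: "?y < ?y'" "?y' < q" using b ins_q by auto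
          show "C ?y \<noteq> C ?y'"
          proof
            assume eq: "C ?y = C ?y'"
            then have uu: "?y < u" "u \<le> ?y'"
              using C_ne[OF y] by (meson not_le)+
            then have "C u = C ?y"
              using contiguousD[OF labels(7), of ?y u ?y'] eq y q_le_n by simp
            moreover have "u < ?y'"
              using uu by (auto simp: insert_index_def split: if_splits)
            ultimately show False
              using C_ne[of u ?y'] y eq by simp
          qed
        qed auto
      qed (use rows_r ins_q row_inj strict_mono_insert_index[of u] in \<open>auto simp: strict_mono_on_def\<close>)
      moreover have "(\<Sum>i<r. cofactor X i 0 * A $$ (i, b)) = 0" if b: "b < r" for b
      proof -
        let ?j = "insert_index u b"
        have jq: "?j < q" using ins_q b by simp
        have "(\<Sum>i<r. cofactor X i 0 * A $$ (i, b)) = (\<Sum>i<n. cofactor X i 0 * X $$ (i, ?j))"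
        proof (rule sum.mono_neutral_cong_left)
          show "\<forall>i\<in>{..<n} - {..<r}. cofactor X i 0 * X $$ (i, ?j) = 0"
          proof
            fix i assume i: "i \<in> {..<n} - {..<r}"
            show "cofactor X i 0 * X $$ (i, ?j) = 0"
            proof (cases "i < r'")
              case True
              then have "det (mat_delete X i 0) = 0"
                using False i by auto
              then show ?thesis by (simp add: cofactor_def)
            next
              case out: False
              have "(i, ?j) \<notin> P"
                using cols_u[of ?j i] cB[of ?j i] i out jq by (cases "?j < u") auto
              then show ?thesis
                using zero[of i ?j] i jq q_le_n by simp
            qed
          qed
        qed (use b r_le_n in \<open>auto simp: A_def\<close>)
        also have "\<dots> = 0"
          using cofactor_column_orthogonality[OF X, of 0 ?j] d jq q_le_n n_pos by auto
        finally show ?thesis .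
      qed
      ultimately have "cofactor X (r - 1) 0 = 0"
        using left_kernel_trivial[of A r "\<lambda>i. cofactor X i 0" "r - 1"] r_pos by (simp add: A_def)
      then show False using first by (simp add: cofactor_def)
    qed
  qed
qed

end

end

lemma separated_rows_shift:
  assumes "separated_rows n R P" and "\<And>a b. a < r \<Longrightarrow> r \<le> b \<Longrightarrow> (b, a) \<notin> P"
  shows "separated_rows (n - r) (R \<circ> (\<lambda>i. i + r)) (shift_region r P)"
  unfolding separated_rows_def
proof (intro allI impI)
  fix x x' assume x: "x < x'" "x' < n - r" "(R \<circ> (\<lambda>i. i + r)) x = (R \<circ> (\<lambda>i. i + r)) x'"
  then have "x + r < x' + r" "x' + r < n" "R (x + r) = R (x' + r)" by auto
  then obtain c where c: "(x + r, c) \<in> P \<longleftrightarrow> (x' + r, c) \<notin> P"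
    using assms(1) unfolding separated_rows_def by blast
  then have "r \<le> c" using assms(2)[of c] by (metis le_add2 not_le)
  then show "\<exists>c. (x, c) \<in> shift_region r P \<longleftrightarrow> (x', c) \<notin> shift_region r P"
    using c by (metis add.commute le_Suc_ex mem_shift_region)
qed

lemma labelled_band_shift:
  assumes L: "labelled_band n P R C X"
    and cross: "\<And>a b. a < r \<Longrightarrow> r \<le> b \<Longrightarrow> (a, b) \<notin> P \<and> (b, a) \<notin> P"
  shows "labelled_band (n - r) (shift_region r P) (\<lambda>i. R (i + r)) (\<lambda>i. C (i + r)) (shift_mat r X)"
proof -
  have L': "band n P" "X \<in> carrier_mat n n" "supported_on P X" "signed_minors P X" "strict_minors R C P X"
    "contiguous n R" "contiguous n C" "separated_rows n R P" "separated_rows n C (P\<inverse>)"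
    "balanced n P" "\<forall>a<n. (a, a) \<in> P"
    using L by (auto simp: labelled_band_def)
  have sub: "P \<subseteq> {..<n} \<times> {..<n}"
    using L'(1) by (simp add: band_def)
  have "strict_minors (R \<circ> (\<lambda>i. i + r)) (C \<circ> (\<lambda>i. i + r)) (shift_region r P) (shift_mat r X)"
  proof (rule strict_minors_reindex[OF L'(5) strict_mono_add strict_mono_add])
    fix a b assume "(a, b) \<in> shift_region r P"
    then show "(a + r, b + r) \<in> P" "shift_mat r X $$ (a, b) = X $$ (a + r, b + r)"
      using sub L'(2) by (auto simp: shift_mat_def dest!: subsetD)
  qed
  moreover have "contiguous (n - r) (R \<circ> (\<lambda>i. i + r))" "contiguous (n - r) (C \<circ> (\<lambda>i. i + r))"
    using L'(6,7) by (auto intro!: contiguous_reindex strict_mono_add)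
  moreover have "separated_rows (n - r) (R \<circ> (\<lambda>i. i + r)) (shift_region r P)"
    "separated_rows (n - r) (C \<circ> (\<lambda>i. i + r)) (shift_region r (P\<inverse>))"
    using cross by (auto intro!: separated_rows_shift L'(8,9))
  moreover have "(shift_region r P)\<inverse> = shift_region r (P\<inverse>)"
    by auto
  moreover have "balanced (n - r) (shift_region r P)"
    using L'(10) by (auto simp: balanced_def)
  ultimately show ?thesis
    unfolding labelled_band_def
    using band_shift[OF L'(1), of r] shift_mat_carrier[OF L'(2), of r] supported_on_shift[OF L'(3,2), of r]
      signed_minors_shift[OF L'(4,2) sub, of r] L'(8,9,11) cross by (simp add: comp_def)
qed

lemma det_nonzero_corner:
  fixes R :: "nat \<Rightarrow> 'r" and C :: "nat \<Rightarrow> 'c"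
  assumes corner: "band_corner n P r q" and L: "labelled_band n P R C X"
    and IH: "\<And>m P (R :: nat \<Rightarrow> 'r) (C :: nat \<Rightarrow> 'c) X. m < n \<Longrightarrow> labelled_band m P R C X \<Longrightarrow> det X \<noteq> 0"
  shows "det X \<noteq> 0"
proof -
  interpret band_corner n P r q by fact
  have L': "X \<in> carrier_mat n n" "supported_on P X" "strict_minors R C P X"
    "separated_rows n R P" "separated_rows n C (P\<inverse>)" "balanced n P"
    using L by (auto simp: labelled_band_def)
  have zero: "X $$ (i, j) = 0" if "i < n" "j < n" "(i, j) \<notin> P" for i j
    using L'(1,2) that by (auto simp: supported_on_def)
  have minor_r: "det (mat r r (\<lambda>(i, j). X $$ (i, j))) \<noteq> 0"
    if colr: "\<And>i j. j < r \<Longrightarrow> (i, j) \<in> P \<longleftrightarrow> i < r"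
  proof (rule strict_minorsD[OF L'(3), where f = "\<lambda>a. a" and g = "\<lambda>b. b"])
    show "inj_on (\<lambda>b. C b) {..<r}"
    proof (rule linorder_inj_onI)
      fix x x' assume x: "x < x'" "x \<in> {..<r}" "x' \<in> {..<r}"
      show "C x \<noteq> C x'"
      proof
        assume eq: "C x = C x'"
        show False
          by (rule separated_rowsD[OF L'(5) x(1) _ eq]) (use x colr r_le_n in auto)
      qed
    qed auto
  qed (use rows_r r_le_q labels_rows_inj[OF L'(4)] in \<open>auto simp: strict_mono_on_def\<close>)
  show ?thesis
  proof (cases rule: corner_cases)
    case full
    have "mat r r (\<lambda>(i, j). X $$ (i, j)) = X"
      using full L'(1) by (intro eq_matI) auto
    moreover have "(i, j) \<in> P \<longleftrightarrow> i < r" if "j < r" for i j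
      using that full rows_r[of i j] bounded[of i j] by auto
    ultimately show ?thesis using minor_r by simp
  next
    case block
    have sr: "Suc (r - 1) = r" using r_pos by simp
    \<comment> \<open>A zero block on one side suffices for the determinant, but not for restricting
      the labels to the blocks. Balance empties both cells next to the diagonal, and convexity with
      the diagonal spreads this to both off-diagonal blocks.\<close>
    have "(r - 1, r) \<notin> P \<or> (r, r - 1) \<notin> P"
      using block(2) rows_r[of "r - 1" r] sr by (metis lessI less_irrefl)
    then have no: "(r - 1, r) \<notin> P" "(r, r - 1) \<notin> P"
      using L'(6) block(1) sr unfolding balanced_def by metis+
    have cross: "(a, b) \<notin> P \<and> (b, a) \<notin> P" if "a < r" "r \<le> b" for a b
    proof
      have ar: "a \<le> r - 1" using that by simp
      then show "(a, b) \<notin> P"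
        using convex_regionD[OF convex, of a b r r "r - 1" r] diag[OF block(1)] no that r_pos by auto
      show "(b, a) \<notin> P"
        using convex_regionD[OF convex, of "r - 1" "r - 1" b a r "r - 1"] diag[of "r - 1"] block(1) ar no that r_pos by auto
    qed
    have "det X = det (mat r r (\<lambda>(i, j). X $$ (i, j))) * det (shift_mat r X)"
      by (rule det_block_triangular[OF L'(1) r_le_n]) (use cross zero r_le_n in auto)
    moreover have "det (shift_mat r X) \<noteq> 0"
      by (rule IH[OF _ labelled_band_shift[OF L cross]]) (use r_pos n_pos in auto)
    moreover have "(i, j) \<in> P \<longleftrightarrow> i < r" if "j < r" for i j
      using that rows_r[of i j] r_le_q cross[of j i] by (cases "i < r") auto
    ultimately show ?thesis using minor_r by simp
  next
    case (step u r')
    then interpret band_step n P r q u r' .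
    show ?thesis
      by (rule det_nonzero_step[OF L]) (rule IH[of "n - 1"], use n_pos in simp_all)
  qed
qed

text \<open>Both labellings have one type, because transposition exchanges them within the
  induction.\<close>

theorem det_nonzero:
  fixes R C :: "nat \<Rightarrow> 'r"
  assumes "labelled_band n P R C X"
  shows "det X \<noteq> 0"
  using assms
proof (induction n arbitrary: P R C X rule: less_induct)
  case (less n)
  have L': "band n P" "X \<in> carrier_mat n n" "\<And>a. a < n \<Longrightarrow> (a, a) \<in> P"
    using less.prems by (auto simp: labelled_band_def)
  show ?case
  proof (cases "n = 0")
    case True
    then show ?thesis using L'(2) by simp
  next
    case False
    show ?thesis
    proof (rule band_corner_exists[OF L'(1,3)])
      show "0 < n" using False by simp
    next
      fix r q assume "band_corner n P r q"
      then show ?thesis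
        by (rule det_nonzero_corner[OF _ less.prems less.IH])
    next
      fix r q assume "band_corner n (P\<inverse>) r q"
      then have "det (transpose_mat X) \<noteq> 0"
        by (rule det_nonzero_corner[OF _ labelled_band_converse[OF less.prems] less.IH])
      then show ?thesis using det_transpose[OF L'(2)] by simp
    qed
  qed
qed

section \<open>Regions of permutations\<close>

definition sandwich :: "nat \<Rightarrow> (nat \<Rightarrow> nat) \<Rightarrow> (nat \<times> nat) set" where
  "sandwich n w = {(i, j). i < n \<and> j < n \<and> (\<exists>k\<le>i. j \<le> w k) \<and> (\<exists>l<n. i \<le> l \<and> w l \<le> j)}"

definition avoids_4231 :: "nat \<Rightarrow> (nat \<Rightarrow> nat) \<Rightarrow> bool" where
  "avoids_4231 n w \<longleftrightarrow> (\<forall>a b c d. a < b \<longrightarrow> b < c \<longrightarrow> c < d \<longrightarrow> d < n \<longrightarrow> \<not> (w d < w b \<and> w b < w c \<and> w c < w a))"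

definition avoids_3412 :: "nat \<Rightarrow> (nat \<Rightarrow> nat) \<Rightarrow> bool" where
  "avoids_3412 n w \<longleftrightarrow> (\<forall>a b c d. a < b \<longrightarrow> b < c \<longrightarrow> c < d \<longrightarrow> d < n \<longrightarrow> \<not> (w c < w d \<and> w d < w a \<and> w a < w b))"

lemma avoids_4231D:
  "avoids_4231 n w \<Longrightarrow> a < b \<Longrightarrow> b < c \<Longrightarrow> c < d \<Longrightarrow> d < n \<Longrightarrow> w d < w b \<Longrightarrow> w b < w c \<Longrightarrow> w c < w a \<Longrightarrow> False"
  unfolding avoids_4231_def by blast

lemma avoids_3412D:
  "avoids_3412 n w \<Longrightarrow> a < b \<Longrightarrow> b < c \<Longrightarrow> c < d \<Longrightarrow> d < n \<Longrightarrow> w c < w d \<Longrightarrow> w d < w a \<Longrightarrow> w a < w b \<Longrightarrow> False"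
  unfolding avoids_3412_def by blast

lemma mem_sandwich:
  "(i, j) \<in> sandwich n w \<longleftrightarrow> i < n \<and> j < n \<and> (\<exists>k\<le>i. j \<le> w k) \<and> (\<exists>l<n. i \<le> l \<and> w l \<le> j)"
  by (simp add: sandwich_def)

lemma convex_sandwich: "convex_region (sandwich n w)"
  unfolding convex_region_def mem_sandwich by (meson le_less_trans order_trans)

text \<open>The corner \<open>(t, c0)\<close> has a point to the north-east, so it lacks one to the
  south-west; for \<open>(x, c3)\<close> it is the other way round. This orders the witnesses of the
  four cells as \<open>k1 < k2 < l1 < l2\<close>, a 3412 pattern.\<close>

lemma caterpillar_sandwich:
  assumes "avoids_3412 n w" and inj: "inj_on w {..<n}" shows "caterpillar (sandwich n w)"
  unfolding caterpillar_def
proof (intro notI, elim exE conjE)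
  fix x y z t c0 c1 c2 c3
  assume o: "x < y" "y \<le> z" "z < t" "c0 < c1" "c1 \<le> c2" "c2 < c3"
    and i: "(z, c0) \<in> sandwich n w" "(t, c1) \<in> sandwich n w" "(x, c2) \<in> sandwich n w" "(y, c3) \<in> sandwich n w"
    and o': "(t, c0) \<notin> sandwich n w" "(x, c3) \<notin> sandwich n w"
  have lt: "t < n" "c0 < n" "x < n" "c3 < n"
    using i by (auto simp: mem_sandwich)
  obtain k where k: "k \<le> t" "c1 \<le> w k"
    using i(2) by (auto simp: mem_sandwich)
  have no0: "c0 < w l" if "l < n" "t \<le> l" for l
  proof (rule ccontr)
    assume "\<not> c0 < w l"
    moreover have "c0 \<le> w k" using k o by simp
    ultimately show False
      using o'(1) k(1) that lt by (auto simp: mem_sandwich not_less)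
  qed
  obtain l where l: "l < n" "y \<le> l" "w l \<le> c3"
    using i(4) by (auto simp: mem_sandwich)
  have no3: "w k < c3" if "k \<le> x" for k
  proof (rule ccontr)
    assume "\<not> w k < c3"
    moreover have "x \<le> l" using l o by simp
    ultimately show False
      using o'(2) l that lt by (auto simp: mem_sandwich not_less)
  qed
  obtain l1 where l1: "l1 < n" "z \<le> l1" "w l1 \<le> c0"
    using i(1) by (auto simp: mem_sandwich)
  obtain l2 where l2: "l2 < n" "t \<le> l2" "w l2 \<le> c1"
    using i(2) by (auto simp: mem_sandwich)
  obtain k1 where k1: "k1 \<le> x" "c2 \<le> w k1"
    using i(3) by (auto simp: mem_sandwich)
  obtain k2 where k2: "k2 \<le> y" "c3 \<le> w k2"
    using i(4) by (auto simp: mem_sandwich)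
  have "x < k2" using no3[of k2] k2 by (meson not_le)
  moreover have "l1 < t" using no0[of l1] l1 by (meson not_le)
  moreover have "w k1 < c3" "c0 < w l2" using no3 no0 k1 l2 by auto
  moreover have "w l1 < w k2" using k2 l1 o by linarith
  then have "k2 \<noteq> l1" by blast
  ultimately have "k1 < k2" "k2 < l1" "l1 < l2" "w l1 < w l2" "w l2 \<le> w k1" "w k1 < w k2"
    using k1 k2 l1 l2 o by linarith+
  moreover have "w l2 \<noteq> w k1"
    using inj_onD[OF inj, of l2 k1] l2(1) \<open>k1 < k2\<close> \<open>k2 < l1\<close> \<open>l1 < l2\<close> by auto
  ultimately show False
    using avoids_3412D[OF assms(1), of k1 k2 l1 l2] l2(1) by simp
qed

lemma band_sandwich:
  assumes "avoids_3412 n w" "inj_on w {..<n}" shows "band n (sandwich n w)"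
  using convex_sandwich caterpillar_sandwich[OF assms] by (auto simp: band_def mem_sandwich)

text \<open>Injectivity and finiteness make \<open>w\<close> a permutation of the first
  \<open>a\<close> indices, which uses up all the small values.\<close>

lemma bij_initial_segment:
  assumes w: "bij_betw w {..<n} {..<n :: nat}" and a: "a \<le> n"
    and init: "\<And>k. k < a \<Longrightarrow> w k < a" and l: "a \<le> l" "l < n"
  shows "a \<le> w l"
proof (rule ccontr)
  assume c: "\<not> a \<le> w l"
  have inj: "inj_on w {..<a}"
    using bij_betw_imp_inj_on[OF w] a by (meson inj_on_subset lessThan_subset_iff)
  then have "w ` {..<a} = {..<a}"
    by (intro endo_inj_surj) (use init in auto)
  then obtain k where "k < a" "w k = w l"
    using c by (metis imageE lessThan_iff not_le)
  then show False
    using inj_onD[OF bij_betw_imp_inj_on[OF w], of k l] l a by auto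
qed

lemma bij_final_segment:
  assumes w: "bij_betw w {..<n} {..<n :: nat}" and a: "a \<le> n"
    and fin: "\<And>l. l < n \<Longrightarrow> a \<le> l \<Longrightarrow> a \<le> w l" and k: "k < a"
  shows "w k < a"
proof (rule ccontr)
  assume c: "\<not> w k < a"
  have wk: "w k < n" using bij_betwE[OF w] k a by auto
  have inj: "inj_on w {a..<n}"
    using bij_betw_imp_inj_on[OF w] by (rule inj_on_subset) auto
  moreover have "w ` {a..<n} \<subseteq> {a..<n}"
    using fin bij_betwE[OF w] by auto
  ultimately have "w ` {a..<n} = {a..<n}"
    by (intro endo_inj_surj) auto
  then obtain l where "a \<le> l" "l < n" "w l = w k"
    using c wk by (metis atLeastLessThan_iff imageE not_le)
  then show False
    using inj_onD[OF bij_betw_imp_inj_on[OF w], of l k] k a by auto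
qed

lemma sandwich_diag:
  assumes w: "bij_betw w {..<n} {..<n}" and a: "a < n"
  shows "(a, a) \<in> sandwich n w"
proof -
  have "\<exists>k\<le>a. a \<le> w k"
  proof (rule ccontr)
    assume no: "\<not> ?thesis"
    then have "w k < a" if "k < a" for k
      using that by (meson less_imp_le not_le)
    then have "a \<le> w a"
      using a by (intro bij_initial_segment[OF w]) auto
    then show False using no by blast
  qed
  moreover have "\<exists>l<n. a \<le> l \<and> w l \<le> a"
  proof (rule ccontr)
    assume no: "\<not> ?thesis"
    then have 1: "Suc a \<le> w l" if "l < n" "a \<le> l" for l
      using that by (meson not_le not_less_eq_eq)
    have "w a < Suc a"
      by (rule bij_final_segment[OF w]) (use 1 a in auto)
    then show False using 1[of a] a by simp
  qed
  ultimately show ?thesis using a by (simp add: mem_sandwich)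
qed

text \<open>Each cell says that \<open>w\<close> does not preserve the initial segment
  \<open>{..t}\<close>: a value leaves it exactly when some other value enters.\<close>

lemma balanced_sandwich:
  assumes w: "bij_betw w {..<n} {..<n}" shows "balanced n (sandwich n w)"
  unfolding balanced_def
proof (intro allI impI)
  fix t assume t: "Suc t < n"
  have d: "(t, t) \<in> sandwich n w" "(Suc t, Suc t) \<in> sandwich n w"
    using sandwich_diag[OF w] t by auto
  have "(t, Suc t) \<in> sandwich n w \<longleftrightarrow> (\<exists>k\<le>t. Suc t \<le> w k)"
    using d(1) t unfolding mem_sandwich by (meson Suc_lessD le_SucI)
  moreover have "(Suc t, t) \<in> sandwich n w \<longleftrightarrow> (\<exists>l<n. Suc t \<le> l \<and> w l \<le> t)"
    using d(1) t unfolding mem_sandwich by (meson Suc_lessD le_SucI)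
  moreover have "(\<exists>k\<le>t. Suc t \<le> w k) \<longleftrightarrow> (\<exists>l<n. Suc t \<le> l \<and> w l \<le> t)"
  proof
    assume ex: "\<exists>k\<le>t. Suc t \<le> w k"
    show "\<exists>l<n. Suc t \<le> l \<and> w l \<le> t"
    proof (rule ccontr)
      assume no: "\<not> ?thesis"
      then have "w k < Suc t" if "k < Suc t" for k
        by (intro bij_final_segment[OF w _ _ that]) (use t in \<open>auto simp: not_le Suc_le_eq\<close>)
      then show False using ex by (metis le_imp_less_Suc not_le)
    qed
  next
    assume ex: "\<exists>l<n. Suc t \<le> l \<and> w l \<le> t"
    show "\<exists>k\<le>t. Suc t \<le> w k"
    proof (rule ccontr)
      assume no: "\<not> ?thesis"
      then have "w k < Suc t" if "k < Suc t" for k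
        using that by (meson less_Suc_eq_le not_le)
      then have "Suc t \<le> w l" if "Suc t \<le> l" "l < n" for l
        using t that by (intro bij_initial_segment[OF w]) auto
      then show False using ex by (metis not_less_eq_eq)
    qed
  qed
  ultimately show "(t, Suc t) \<in> sandwich n w \<longleftrightarrow> (Suc t, t) \<in> sandwich n w" by simp
qed

section \<open>Inversions as symmetric pairs\<close>

lemma inverse_less:
  assumes w: "bij_betw w {..<n} {..<n}" and g: "\<And>i. i < n \<Longrightarrow> g (w i) = i" and j: "j < n"
  shows "g j < (n :: nat)"
proof -
  have "j \<in> w ` {..<n}"
    using bij_betw_imp_surj_on[OF w] j by simp
  then show ?thesis using g by auto
qed

lemma sandwich_inverse:
  assumes w: "bij_betw w {..<n} {..<n}" and g: "\<And>i. i < n \<Longrightarrow> g (w i) = i" "\<And>j. j < n \<Longrightarrow> w (g j) = j"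
  shows "(sandwich n w)\<inverse> = sandwich n g"
proof -
  have wn: "w i < n" if "i < n" for i using bij_betwE[OF w] that by auto
  have gn: "g j < n" if "j < n" for j
    by (rule inverse_less[OF w _ that]) (rule g(1))
  have "(i, j) \<in> sandwich n w \<longleftrightarrow> (j, i) \<in> sandwich n g" for i j
  proof
    assume "(i, j) \<in> sandwich n w"
    then obtain k l where *: "i < n" "j < n" "k \<le> i" "j \<le> w k" "l < n" "i \<le> l" "w l \<le> j"
      by (auto simp: mem_sandwich)
    then have "i \<le> g (w l)" "g (w k) \<le> i" "w k < n"
      using g(1) wn by auto
    then show "(j, i) \<in> sandwich n g"
      using * by (auto simp: mem_sandwich)
  next
    assume "(j, i) \<in> sandwich n g"
    then obtain k l where *: "i < n" "j < n" "k \<le> j" "i \<le> g k" "l < n" "j \<le> l" "g l \<le> i"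
      by (auto simp: mem_sandwich)
    then have "j \<le> w (g l)" "w (g k) \<le> j" "g k < n"
      using g(2) gn by auto
    then show "(i, j) \<in> sandwich n w"
      using * by (auto simp: mem_sandwich)
  qed
  then show ?thesis by auto
qed

lemma finite_inversions: "finite (inversions n w)"
  by (rule finite_subset[of _ "{..<n} \<times> {..<n}"]) (auto simp: inversions_def)

lemma card_inversions_inverse:
  assumes w: "bij_betw w {..<n} {..<n}" and g: "\<And>i. i < n \<Longrightarrow> g (w i) = i" "\<And>j. j < n \<Longrightarrow> w (g j) = j"
  shows "card (inversions n g) = card (inversions n w)"
proof (rule bij_betw_same_card)
  have wn: "w i < n" if "i < n" for i using bij_betwE[OF w] that by auto
  have gn: "g j < n" if "j < n" for j
    by (rule inverse_less[OF w _ that]) (rule g(1))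
  show "bij_betw (\<lambda>(i, j). (g j, g i)) (inversions n g) (inversions n w)"
    by (rule bij_betw_byWitness[where f' = "\<lambda>(i, j). (w j, w i)"])
      (use g wn gn in \<open>auto simp: inversions_def\<close>)
qed

text \<open>The patterns 4231 and 3412 are their own inverses.\<close>

lemma avoids_inverse:
  assumes w: "bij_betw w {..<n} {..<n}" and g: "\<And>i. i < n \<Longrightarrow> g (w i) = i" "\<And>j. j < n \<Longrightarrow> w (g j) = j"
  shows "avoids_4231 n w \<Longrightarrow> avoids_4231 n g" "avoids_3412 n w \<Longrightarrow> avoids_3412 n g"
proof -
  have gn: "g j < n" if "j < n" for j
    by (rule inverse_less[OF w _ that]) (rule g(1))
  show "avoids_4231 n g" if av: "avoids_4231 n w"
    unfolding avoids_4231_def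
  proof (intro allI impI notI)
    fix a b c d assume *: "a < b" "b < c" "c < d" "d < n" "g d < g b \<and> g b < g c \<and> g c < g a"
    then have "w (g a) < w (g b)" "w (g b) < w (g c)" "w (g c) < w (g d)"
      using g(2) by auto
    then show False
      using avoids_4231D[OF av, of "g d" "g b" "g c" "g a"] * gn[of a] by simp
  qed
  show "avoids_3412 n g" if av: "avoids_3412 n w"
    unfolding avoids_3412_def
  proof (intro allI impI notI)
    fix a b c d assume *: "a < b" "b < c" "c < d" "d < n" "g c < g d \<and> g d < g a \<and> g a < g b"
    then have "w (g a) < w (g b)" "w (g b) < w (g c)" "w (g c) < w (g d)"
      using g(2) by auto
    then show False
      using avoids_3412D[OF av, of "g c" "g d" "g a" "g b"] * gn[of b] by simp
  qed
qed

text \<open>The point of value 0 lies in row \<open>r - 1\<close> and takes part in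
  \<open>r - 1\<close> inversions, as many as the symmetric pairs lost on deleting that cell.
  Avoidance of 4231 ensures that the remaining region is the sandwich of the shortened
  permutation.\<close>

lemma inversions_eq_sym_pairs_corner:
  assumes w: "bij_betw w {..<n} {..<n}" and av: "avoids_4231 n w" "avoids_3412 n w"
    and corner: "band_corner n (sandwich n w) r q"
    and IH: "\<And>w'. bij_betw w' {..<n - 1} {..<n - 1} \<Longrightarrow> avoids_4231 (n - 1) w' \<Longrightarrow> avoids_3412 (n - 1) w' \<Longrightarrow>
      card (inversions (n - 1) w') = sym_pairs (sandwich (n - 1) w')"
  shows "card (inversions n w) = sym_pairs (sandwich n w)"
proof -
  let ?P = "sandwich n w"
  interpret band_corner n ?P r q by fact
  have wn: "w i < n" if "i < n" for i using bij_betwE[OF w] that by auto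
  have inj: "i = j" if "w i = w j" "i < n" "j < n" for i j
    using inj_onD[OF bij_betw_imp_inj_on[OF w]] that by auto
  have point: "(i, w i) \<in> ?P" if "i < n" for i
    using that wn by (auto simp: mem_sandwich)
  have surj: "\<exists>i<n. w i = j" if "j < n" for j
    using that w by (metis bij_betw_def imageE lessThan_iff)
  define p where "p = r - 1"
  have p: "p < n" "r = Suc p" using r_pos r_le_n by (auto simp: p_def)
  have wp: "w p = 0"
  proof -
    obtain l where l: "l < n" "w l = 0" using surj[of 0] n_pos by blast
    then have "(l, 0) \<in> ?P" using point[of l] by simp
    then have "l \<le> p" using col_0[of l] p by simp
    moreover obtain l' where "l' < n" "p \<le> l'" "w l' \<le> 0"
      using col_0[of p] p by (auto simp: mem_sandwich)
    then have "l' = l" using inj[of l' l] l by simp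
    ultimately show ?thesis using l \<open>p \<le> l'\<close> by simp
  qed
  \<comment> \<open>The first \<open>r\<close> rows are equally long, and the reach of row 0 is
    determined by the point in row 0 alone.\<close>
  have w0: "w i \<le> w 0" if "i \<le> p" for i
  proof -
    have "w i < q" using rows_r[of i "w i"] point[of i] that p by simp
    then have "(0, w i) \<in> ?P" using rows_r[of 0] r_pos by simp
    then show ?thesis by (auto simp: mem_sandwich)
  qed
  define v where "v = (\<lambda>a. w (insert_index p a) - 1)"
  have ip: "insert_index p a \<noteq> p" for a
    by (auto simp: insert_index_def)
  have il: "insert_index p a < n" if "a < n - 1" for a
    using that by (rule insert_index_less)
  have w_ins: "w (insert_index p a) = Suc (v a)" if "a < n - 1" for a
    using inj[of "insert_index p a" p] ip il[OF that] p wp unfolding v_def by (cases "w (insert_index p a)") auto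
  have v: "bij_betw v {..<n - 1} {..<n - 1}"
  proof -
    have "inj_on v {..<n - 1}"
    proof (rule inj_onI)
      fix a b assume ab: "a \<in> {..<n - 1}" "b \<in> {..<n - 1}" "v a = v b"
      then have "w (insert_index p a) = w (insert_index p b)"
        using w_ins by simp
      then have "insert_index p a = insert_index p b"
        by (rule inj) (use ab il in auto)
      then show "a = b" by (metis delete_insert_index)
    qed
    moreover have "v ` {..<n - 1} \<subseteq> {..<n - 1}"
    proof
      fix x assume "x \<in> v ` {..<n - 1}"
      then obtain a where a: "a < n - 1" "x = v a" by auto
      have "Suc (v a) < n" using wn[OF il[OF a(1)]] w_ins[OF a(1)] by simp
      then show "x \<in> {..<n - 1}" using a by simp
    qed
    ultimately show ?thesis
      using endo_inj_surj[of "{..<n - 1}" v] by (auto simp: bij_betw_def)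
  qed
  have v_less: "v a < v b \<longleftrightarrow> w (insert_index p a) < w (insert_index p b)" if "a < n - 1" "b < n - 1" for a b
    using w_ins that by simp
  have av': "avoids_4231 (n - 1) v" "avoids_3412 (n - 1) v"
  proof -
    show "avoids_4231 (n - 1) v"
      unfolding avoids_4231_def
    proof (intro allI impI)
      fix a b c d assume *: "a < b" "b < c" "c < d" "d < n - 1"
      then have "\<not> (w (insert_index p d) < w (insert_index p b) \<and> w (insert_index p b) < w (insert_index p c)
        \<and> w (insert_index p c) < w (insert_index p a))"
        using av(1) il[of d] unfolding avoids_4231_def by (meson insert_index_less_iff)
      then show "\<not> (v d < v b \<and> v b < v c \<and> v c < v a)"
        using v_less * by (meson less_trans)
    qed
    show "avoids_3412 (n - 1) v"
      unfolding avoids_3412_def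
    proof (intro allI impI)
      fix a b c d assume *: "a < b" "b < c" "c < d" "d < n - 1"
      then have "\<not> (w (insert_index p c) < w (insert_index p d) \<and> w (insert_index p d) < w (insert_index p a)
        \<and> w (insert_index p a) < w (insert_index p b))"
        using av(2) il[of d] unfolding avoids_3412_def by (meson insert_index_less_iff)
      then show "\<not> (v c < v d \<and> v d < v a \<and> v a < v b)"
        using v_less * by (meson less_trans)
    qed
  qed
  have ins_del: "insert_index p (delete_index p k) = k" if "k \<noteq> p" for k
    using that by (rule insert_delete_index)
  have del: "sandwich (n - 1) v = del_region p 0 ?P"
  proof -
    have "(a, b) \<in> sandwich (n - 1) v \<longleftrightarrow> (insert_index p a, Suc b) \<in> ?P" for a b
    proof
      assume "(a, b) \<in> sandwich (n - 1) v"
      then obtain k l where *: "a < n - 1" "b < n - 1" "k \<le> a" "b \<le> v k" "l < n - 1" "a \<le> l" "v l \<le> b"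
        by (auto simp: mem_sandwich)
      then have "Suc b \<le> w (insert_index p k)" "w (insert_index p l) \<le> Suc b" "Suc b < n"
        using w_ins[of k] w_ins[of l] by auto
      then show "(insert_index p a, Suc b) \<in> ?P"
        unfolding mem_sandwich using * il[of a] il[of l] by (meson insert_index_le_iff)
    next
      assume "(insert_index p a, Suc b) \<in> ?P"
      then obtain k l where *: "insert_index p a < n" "Suc b < n" "k \<le> insert_index p a" "Suc b \<le> w k"
        "l < n" "insert_index p a \<le> l" "w l \<le> Suc b"
        by (auto simp: mem_sandwich)
      let ?i = "insert_index p a"
      have a: "a < n - 1" by (rule insert_index_lessD[OF *(1) p(1)])
      have "k \<noteq> p" using *(4) wp by auto
      then have k: "k = insert_index p (delete_index p k)" by (simp add: ins_del)
      define k' where "k' = delete_index p k"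
      have k': "k' \<le> a" "b \<le> v k'"
        using *(3,4) k w_ins[of k'] a unfolding k'_def[symmetric] by auto
      \<comment> \<open>The removed point could have been the only south-west witness of the cell.
        Then the point of value 1 lies above row \<open>?i\<close>, and the rows \<open>0\<close>,
        \<open>k1\<close>, \<open>?i\<close>, \<open>p\<close> carry a 4231 pattern.\<close>
      have "\<exists>l<n. ?i \<le> l \<and> w l \<le> Suc b \<and> l \<noteq> p"
      proof (rule ccontr)
        assume no: "\<not> ?thesis"
        then have "l = p" using * by blast
        then have ilt: "?i < p" using *(6) ip[of a] by linarith
        obtain k1 where k1: "k1 < n" "w k1 = 1" using surj[of 1] *(2) by auto
        have "k1 \<noteq> p" using k1 wp by auto
        then have k1i: "k1 < ?i" using no k1 by (metis Suc_le_mono One_nat_def le0 not_le)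
        have wi: "Suc b < w ?i" using no *(1) ip[of a] by (metis le_refl not_le)
        have "w ?i \<le> w 0" using w0 ilt by simp
        moreover have "w ?i \<noteq> w 0" using inj[of ?i 0] k1i n_pos *(1) by auto
        ultimately have w4: "w ?i < w 0" by simp
        have "k1 \<noteq> 0" using k1 w4 wi by (cases k1) auto
        then show False
          using avoids_4231D[OF av(1), of 0 k1 ?i p] k1i ilt p(1) w4 wi k1 wp by simp
      qed
      then obtain l where l: "l < n" "?i \<le> l" "w l \<le> Suc b" "l \<noteq> p" by blast
      define l' where "l' = delete_index p l"
      have li: "l = insert_index p l'" using l ins_del by (simp add: l'_def)
      have l': "a \<le> l'" "l' < n - 1"
        using l li insert_index_lessD[of p l' n] p by auto
      then have "v l' \<le> b" "b < n - 1" using w_ins[of l'] l li *(2) by simp_all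
      then show "(a, b) \<in> sandwich (n - 1) v"
        unfolding mem_sandwich using a *(2) k' l' by blast
    qed
    then show ?thesis by auto
  qed
  have "sym_pairs ?P = sym_pairs (del_region 0 0 ?P) + (r - 1)"
    using sym_pairs_del_0[OF fin _ col_0, of q] rows_r[of 0] r_pos r_le_q by simp
  moreover have "del_region 0 0 ?P = del_region p 0 ?P"
    by (rule del_region_row_cong) (use rows_r p in auto)
  ultimately have symP: "sym_pairs ?P = sym_pairs (sandwich (n - 1) v) + p"
    using del p by simp
  have "inversions n w = map_prod (insert_index p) (insert_index p) ` inversions (n - 1) v \<union> (\<lambda>i. (i, p)) ` {..<p}"
  proof (rule Set.set_eqI)
    fix x :: "nat \<times> nat"
    obtain i j where x: "x = (i, j)" by (cases x)
    have "x \<in> inversions n w \<longleftrightarrow> i < j \<and> j < n \<and> w j < w i"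
      by (simp add: x inversions_def)
    moreover have "x \<in> (\<lambda>i. (i, p)) ` {..<p} \<longleftrightarrow> j = p \<and> i < p"
      by (auto simp: x)
    moreover have "x \<in> map_prod (insert_index p) (insert_index p) ` inversions (n - 1) v \<longleftrightarrow>
        i \<noteq> p \<and> j \<noteq> p \<and> i < j \<and> j < n \<and> w j < w i"
    proof
      assume "x \<in> map_prod (insert_index p) (insert_index p) ` inversions (n - 1) v"
      then obtain a b where ab: "i = insert_index p a" "j = insert_index p b" "a < b" "b < n - 1" "v b < v a"
        by (auto simp: x inversions_def)
      then show "i \<noteq> p \<and> j \<noteq> p \<and> i < j \<and> j < n \<and> w j < w i"
        using il[of b] v_less[of b a] ip[of a] ip[of b] by simp
    next
      assume *: "i \<noteq> p \<and> j \<noteq> p \<and> i < j \<and> j < n \<and> w j < w i"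
      define a b where "a = delete_index p i" and "b = delete_index p j"
      have ab: "i = insert_index p a" "j = insert_index p b"
        using * ins_del by (auto simp: a_def b_def)
      then have "a < b" "b < n - 1"
        using * insert_index_lessD[of p b n] p by auto
      then have "(a, b) \<in> inversions (n - 1) v"
        using * ab v_less[of b a] by (simp add: inversions_def)
      then show "x \<in> map_prod (insert_index p) (insert_index p) ` inversions (n - 1) v"
        using ab x by (auto simp: image_iff intro!: bexI[of _ "(a, b)"])
    qed
    moreover have "i < p \<Longrightarrow> w p < w i"
      using inj[of i p] p wp by (cases "w i") auto
    ultimately show "x \<in> inversions n w \<longleftrightarrow>
      x \<in> map_prod (insert_index p) (insert_index p) ` inversions (n - 1) v \<union> (\<lambda>i. (i, p)) ` {..<p}"
      unfolding Un_iff using p(1) wp by (cases "j = p"; cases "i = p") auto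
  qed
  moreover have "map_prod (insert_index p) (insert_index p) ` inversions (n - 1) v \<inter> (\<lambda>i. (i, p)) ` {..<p} = {}"
    using ip by auto
  moreover have "card (map_prod (insert_index p) (insert_index p) ` inversions (n - 1) v) = card (inversions (n - 1) v)"
  proof (rule card_image)
    have "inj (insert_index p)"
      by (rule injI) (metis delete_insert_index)
    then show "inj_on (map_prod (insert_index p) (insert_index p)) (inversions (n - 1) v)"
      by (meson prod.inj_map inj_on_subset subset_UNIV)
  qed
  moreover have "card ((\<lambda>i. (i, p)) ` {..<p}) = p"
    by (subst card_image) (auto simp: inj_on_def)
  ultimately have "card (inversions n w) = card (inversions (n - 1) v) + p"
    using finite_inversions[of "n - 1" v] by (simp add: card_Un_disjoint)
  then show ?thesis
    using symP IH[OF v av'] by simp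
qed

theorem inversions_eq_sym_pairs:
  assumes "bij_betw w {..<n} {..<n}" "avoids_4231 n w" "avoids_3412 n w"
  shows "card (inversions n w) = sym_pairs (sandwich n w)"
  using assms
proof (induction n arbitrary: w)
  case 0
  then show ?case by (simp add: inversions_def sandwich_def sym_pairs_def)
next
  case (Suc n)
  note w = Suc.prems(1) and av = Suc.prems(2,3)
  have inj: "inj_on w {..<Suc n}" using w by (rule bij_betw_imp_inj_on)
  show ?case
  proof (rule band_corner_exists[OF band_sandwich[OF av(2) inj] sandwich_diag[OF w]])
    show "0 < Suc n" by simp
  next
    fix r q assume "band_corner (Suc n) (sandwich (Suc n) w) r q"
    then show ?thesis
      by (rule inversions_eq_sym_pairs_corner[OF w av]) (simp add: Suc.IH)
  next
    fix r q assume c: "band_corner (Suc n) ((sandwich (Suc n) w)\<inverse>) r q"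
    define g where "g = inv_into {..<Suc n} w"
    have g: "g (w i) = i" if "i < Suc n" for i
      using that inj by (simp add: g_def)
    have g': "w (g j) = j" if "j < Suc n" for j
      using that w unfolding g_def by (metis bij_betw_def f_inv_into_f lessThan_iff)
    have gb: "bij_betw g {..<Suc n} {..<Suc n}"
      unfolding g_def by (rule bij_betw_inv_into[OF w])
    have conv: "(sandwich (Suc n) w)\<inverse> = sandwich (Suc n) g"
      by (rule sandwich_inverse[OF w]) (simp_all add: g g')
    have "avoids_4231 (Suc n) g" "avoids_3412 (Suc n) g"
      by (rule avoids_inverse[OF w]; simp add: g g' av)+
    then have "card (inversions (Suc n) g) = sym_pairs (sandwich (Suc n) g)"
      by (rule inversions_eq_sym_pairs_corner[OF gb _ _ c[unfolded conv]]) (simp add: Suc.IH)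
    moreover have "card (inversions (Suc n) g) = card (inversions (Suc n) w)"
      by (rule card_inversions_inverse[OF w]) (simp_all add: g g')
    ultimately show ?thesis
      using conv by (metis sym_pairs_converse)
  qed
qed

section \<open>Bruhat intervals up to the longest element\<close>

text \<open>Applying the transposition to both positions of an inversion, where this keeps them in
  order, and fixing the inversion otherwise is injective; the new inversion \<open>(a, b)\<close> is
  missed.\<close>

lemma coxeter_length_transpose_less:
  assumes a: "a < b" "b < n" and u: "u a < u b"
  shows "coxeter_length n u < coxeter_length n (u \<circ> transpose a b)"
proof -
  let ?t = "transpose a b" and ?u' = "u \<circ> transpose a b"
  define \<phi> where "\<phi> = (\<lambda>(x, y). if ?t x < ?t y then (?t x, ?t y) else (x, y))"
  have t: "?t x = (if x = a then b else if x = b then a else x)" for x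
    by (auto simp: transpose_def)
  have sub: "\<phi> ` inversions n u \<subseteq> inversions n ?u' - {(a, b)}"
  proof
    fix z assume "z \<in> \<phi> ` inversions n u"
    then obtain x y where z: "z = \<phi> (x, y)" and xy: "x < y" "y < n" "u y < u x"
      by (auto simp: inversions_def)
    show "z \<in> inversions n ?u' - {(a, b)}"
    proof (cases "?t x < ?t y")
      case True
      moreover have "?t y < n"
        using xy a by (auto simp: t)
      moreover have "(?t x, ?t y) \<noteq> (a, b)"
        using xy a by (auto simp: t split: if_splits)
      ultimately show ?thesis
        using z xy by (auto simp: \<phi>_def inversions_def)
    next
      case False
      have "(x, y) \<noteq> (a, b)" using xy u by auto
      moreover have "?u' y < ?u' x"
        using False xy u a by (auto simp: t split: if_splits)
      ultimately show ?thesis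
        using z xy False by (auto simp: \<phi>_def inversions_def)
    qed
  qed
  have "inj_on \<phi> (inversions n u)"
  proof (rule inj_onI)
    fix z z' assume zz: "z \<in> inversions n u" "z' \<in> inversions n u" "\<phi> z = \<phi> z'"
    obtain x y x' y' where z: "z = (x, y)" "z' = (x', y')" by (cases z; cases z')
    have xy: "x < y" "x' < y'" using zz z by (auto simp: inversions_def)
    have inv: "?t (?t c) = c" for c by simp
    consider "?t x < ?t y" "?t x' < ?t y'" | "\<not> ?t x < ?t y" "\<not> ?t x' < ?t y'"
      | "?t x < ?t y" "\<not> ?t x' < ?t y'" | "\<not> ?t x < ?t y" "?t x' < ?t y'" by blast
    then show "z = z'"
    proof cases
      case 1
      then have "?t x = ?t x'" "?t y = ?t y'"
        using zz(3) z by (auto simp: \<phi>_def)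
      then show ?thesis using z inv by metis
    next
      case 2
      then show ?thesis using zz(3) z by (auto simp: \<phi>_def)
    next
      case 3
      then have "x' = ?t x" "y' = ?t y"
        using zz(3) z by (auto simp: \<phi>_def)
      then show ?thesis using 3 xy inv by metis
    next
      case 4
      then have "x = ?t x'" "y = ?t y'"
        using zz(3) z by (auto simp: \<phi>_def)
      then show ?thesis using 4 xy inv by metis
    qed
  qed
  then have "card (inversions n u) \<le> card (inversions n ?u' - {(a, b)})"
    using sub by (intro card_inj_on_le[of \<phi>]) (auto simp: finite_inversions)
  also have "(a, b) \<in> inversions n ?u'"
    using a u by (auto simp: inversions_def t)
  then have "card (inversions n ?u' - {(a, b)}) < card (inversions n ?u')"
    by (rule card_Diff1_less[OF finite_inversions])
  finally show ?thesis by (simp add: coxeter_length_def)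
qed

lemma coxeter_length_transpose_lessD:
  assumes "a < b" "b < n" and len: "coxeter_length n u < coxeter_length n (u \<circ> transpose a b)"
    and inj: "inj u"
  shows "u a < u b"
proof (rule ccontr)
  assume "\<not> u a < u b"
  moreover have "u a \<noteq> u b"
    using inj assms(1) by (auto dest: injD)
  ultimately have "coxeter_length n (u \<circ> transpose a b) < coxeter_length n ((u \<circ> transpose a b) \<circ> transpose a b)"
    using assms by (intro coxeter_length_transpose_less) auto
  then show False using len by (simp add: comp_assoc)
qed

lemma bruhat_le_transpose:
  assumes "bruhat_le n v u" "a < b" "b < n" "u a < u b"
  shows "bruhat_le n v (u \<circ> transpose a b)"
  by (rule bruhat_le.step[OF assms(1) _ assms(3) coxeter_length_transpose_less]) (use assms in auto)

lemma bruhat_le_trans: "bruhat_le n v u \<Longrightarrow> bruhat_le n u w \<Longrightarrow> bruhat_le n v w"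
  by (rotate_tac, induction rule: bruhat_le.induct) (auto intro: bruhat_le.step)

lemma bruhat_le_permutes: "bruhat_le n v u \<Longrightarrow> u permutes {..<n}"
proof (induction rule: bruhat_le.induct)
  case (step u w a b)
  then show ?case
    by (intro permutes_compose[OF permutes_swap_id]) auto
qed

lemma decreasing_eq_longest:
  assumes u: "u permutes {..<n}" and dec: "\<And>a b. a < b \<Longrightarrow> b < n \<Longrightarrow> u b < u a"
  shows "u = longest_element n"
proof
  fix i
  have un: "u i < n" if "i < n" for i
    using permutes_in_image[OF u, of i] that by simp
  have inj: "inj_on u A" for A
    using permutes_inj_on[OF u] .
  show "u i = longest_element n i"
  proof (cases "i < n")
    case True
    have "card {Suc i..<n} \<le> card {..<u i}"
      by (rule card_inj_on_le[OF inj]) (use dec True in auto)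
    moreover have "card {..<i} \<le> card {Suc (u i)..<n}"
      by (rule card_inj_on_le[OF inj]) (use dec True un in \<open>auto simp: Suc_le_eq\<close>)
    ultimately show ?thesis
      using True un[OF True] by (simp add: longest_element_eq)
  next
    case False
    then show ?thesis using permutes_not_in[OF u, of i] by (simp add: longest_element_eq)
  qed
qed

lemma coxeter_length_bound: "coxeter_length n u \<le> n * n"
proof -
  have "card (inversions n u) \<le> card ({..<n} \<times> {..<n})"
    by (rule card_mono) (auto simp: inversions_def)
  then show ?thesis by (simp add: coxeter_length_def)
qed

lemma bruhat_le_longest:
  assumes "u permutes {..<n}" shows "bruhat_le n u (longest_element n)"
  using assms
proof (induction "n * n - coxeter_length n u" arbitrary: u rule: less_induct)
  case less
  show ?case
  proof (cases "\<exists>a b. a < b \<and> b < n \<and> u a < u b")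
    case True
    then obtain a b where ab: "a < b" "b < n" "u a < u b" by blast
    let ?u' = "u \<circ> transpose a b"
    have le: "bruhat_le n u ?u'"
      by (rule bruhat_le_transpose[OF bruhat_le.refl[OF less.prems] ab])
    have "n * n - coxeter_length n ?u' < n * n - coxeter_length n u"
      using coxeter_length_transpose_less[of a b n u] ab coxeter_length_bound[of n ?u'] by simp
    then have "bruhat_le n ?u' (longest_element n)"
      using less.hyps bruhat_le_permutes[OF le] by blast
    then show ?thesis using bruhat_le_trans[OF le] by blast
  next
    case False
    have "u b < u a" if "a < b" "b < n" for a b
      using False that permutes_inj[OF less.prems] by (metis injD linorder_neqE_nat less_irrefl)
    then have "u = longest_element n"
      by (rule decreasing_eq_longest[OF less.prems])
    then show ?thesis using bruhat_le.refl less.prems by metis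
  qed
qed

text \<open>A step moves the larger of two values to the earlier position. The witness under the
  smaller value and the witness over the larger one therefore serve both positions.\<close>

lemma bruhat_le_sandwiched:
  assumes "bruhat_le n v u"
  shows "i < n \<Longrightarrow> (\<exists>k\<le>i. v k \<le> u i) \<and> (\<exists>l<n. i \<le> l \<and> u i \<le> v l)"
  using assms
proof (induction arbitrary: i rule: bruhat_le.induct)
  case (step u w a b)
  define x y where "x = min a b" and "y = max a b"
  have "a \<noteq> b" using step.hyps by auto
  then have xy: "x < y" "y < n" using step.hyps by (auto simp: x_def y_def)
  have t: "transpose a b = transpose x y"
    by (auto simp: x_def y_def min_def max_def transpose_commute)
  have wxy: "w x < w y"
    using coxeter_length_transpose_lessD[OF xy] step.hyps bruhat_le_permutes[OF step.hyps(1)]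
    unfolding t by (simp add: permutes_inj)
  obtain k where k: "k \<le> x" "u k \<le> w x" using step.IH[of x] xy by auto
  obtain l where l: "l < n" "y \<le> l" "w y \<le> u l" using step.IH[of y] xy by auto
  consider "i = x" | "i = y" | "i \<noteq> x" "i \<noteq> y" by blast
  then show ?case
  proof cases
    case 1
    then have "(w \<circ> transpose a b) i = w y" by (simp add: t)
    moreover have "u k \<le> w y" "x \<le> l" using k l wxy xy by auto
    ultimately show ?thesis using k l 1 by auto
  next
    case 2
    then have "(w \<circ> transpose a b) i = w x" by (simp add: t)
    moreover have "w x \<le> u l" "k \<le> y" using k l wxy xy by auto
    ultimately show ?thesis using k l 2 by auto
  next
    case 3
    then have "(w \<circ> transpose a b) i = w i" by (simp add: t transpose_def)
    then show ?thesis using step.IH[OF step.prems] by simp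
  qed
qed auto

text \<open>At most two upward transpositions are needed. If exchanging position \<open>i\<close>
  with the position \<open>m\<close> of the value \<open>j\<close> would lower the length,
  \<open>i\<close> is first exchanged with the witness \<open>k\<close> or \<open>l\<close>, which
  is an upward move and puts a value on the other side of \<open>j\<close> at
  \<open>i\<close>.\<close>

lemma bruhat_le_through_point:
  assumes v: "v permutes {..<n}" and i: "i < n" and j: "j < n"
    and k: "k \<le> i" "v k \<le> j" and l: "l < n" "i \<le> l" "j \<le> v l"
  shows "\<exists>u. bruhat_le n v u \<and> u i = j"
proof -
  have inj: "inj v" using v by (rule permutes_inj)
  have refl: "bruhat_le n v v" using v by (rule bruhat_le.refl)
  obtain m where vm: "v m = j" using permutes_surj[OF v] by (metis surjD)
  have m: "m < n" using permutes_in_image[OF v, of m] vm j by simp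
  have ne: "v x \<noteq> v y" if "x \<noteq> y" for x y using inj that by (auto dest: injD)
  consider "m = i" | "m > i" "v i < j" | "m > i" "v i > j" | "m < i" "v i > j" | "m < i" "v i < j"
    using vm ne[of m i] by (metis linorder_neqE_nat)
  then show ?thesis
  proof cases
    case 1
    then show ?thesis using refl vm by blast
  next
    case 2
    then have "bruhat_le n v (v \<circ> transpose i m)"
      using bruhat_le_transpose[OF refl, of i m] m vm by simp
    then show ?thesis using vm by (intro exI[of _ "v \<circ> transpose i m"]) simp
  next
    case 3
    have kj: "v k < j" using k 3 vm ne[of k m] by (metis le_neq_implies_less not_le)
    have ki: "k < i" using k kj 3 by (metis le_neq_implies_less less_asym)
    let ?u = "v \<circ> transpose k i"
    have u: "bruhat_le n v ?u"
      using bruhat_le_transpose[OF refl ki i] kj 3 by simp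
    have um: "?u m = j" using 3 ki vm by (simp add: transpose_def)
    have "bruhat_le n v (?u \<circ> transpose i m)"
      by (rule bruhat_le_transpose[OF u 3(1) m]) (use um kj in simp)
    then show ?thesis using um by (intro exI[of _ "?u \<circ> transpose i m"]) simp
  next
    case 4
    then have "bruhat_le n v (v \<circ> transpose m i)"
      using bruhat_le_transpose[OF refl, of m i] i vm by simp
    then show ?thesis using vm by (intro exI[of _ "v \<circ> transpose m i"]) simp
  next
    case 5
    have lj: "j < v l" using l 5 vm ne[of l m] by (metis le_neq_implies_less not_le)
    have li: "i < l" using l lj 5 by (metis le_neq_implies_less less_asym)
    let ?u = "v \<circ> transpose i l"
    have u: "bruhat_le n v ?u"
      using bruhat_le_transpose[OF refl li l(1)] lj 5 by simp
    have um: "?u m = j" using 5 li vm by (simp add: transpose_def)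
    have "bruhat_le n v (?u \<circ> transpose m i)"
      by (rule bruhat_le_transpose[OF u 5(1) i]) (use um lj in simp)
    then show ?thesis using um by (intro exI[of _ "?u \<circ> transpose m i"]) simp
  qed
qed

lemma Gamma_region_longest:
  assumes v: "v permutes {..<n}"
  shows "Gamma_region n v (longest_element n) =
    {(i, j). i < n \<and> j < n \<and> (\<exists>k\<le>i. v k \<le> j) \<and> (\<exists>l<n. i \<le> l \<and> j \<le> v l)}"
proof -
  have "(i, j) \<in> Gamma_region n v (longest_element n) \<longleftrightarrow>
    i < n \<and> j < n \<and> (\<exists>k\<le>i. v k \<le> j) \<and> (\<exists>l<n. i \<le> l \<and> j \<le> v l)" for i j
  proof
    assume "(i, j) \<in> Gamma_region n v (longest_element n)"
    then obtain u where u: "bruhat_le n v u" "i < n" "j = u i"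
      by (auto simp: Gamma_region_def bruhat_interval_def)
    moreover have "u i < n"
      using permutes_in_image[OF bruhat_le_permutes[OF u(1)], of i] u by simp
    ultimately show "i < n \<and> j < n \<and> (\<exists>k\<le>i. v k \<le> j) \<and> (\<exists>l<n. i \<le> l \<and> j \<le> v l)"
      using bruhat_le_sandwiched[OF u(1,2)] by simp
  next
    assume *: "i < n \<and> j < n \<and> (\<exists>k\<le>i. v k \<le> j) \<and> (\<exists>l<n. i \<le> l \<and> j \<le> v l)"
    then obtain u where u: "bruhat_le n v u" "u i = j"
      using bruhat_le_through_point[OF v] by blast
    moreover have "bruhat_le n u (longest_element n)"
      by (rule bruhat_le_longest[OF bruhat_le_permutes[OF u(1)]])
    ultimately show "(i, j) \<in> Gamma_region n v (longest_element n)"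
      using * by (auto simp: Gamma_region_def bruhat_interval_def)
  qed
  then show ?thesis by auto
qed

lemma contains_pattern4:
  assumes "a < b" "b < c" "c < d" "d < n"
    and eq: "\<forall>x\<in>{0, 1, 2, 3}. \<forall>y\<in>{0, 1, 2, 3}. v ([a, b, c, d] ! x) < v ([a, b, c, d] ! y) \<longleftrightarrow> p ! x < p ! y"
    and len: "length p = 4"
  shows "contains_pattern n v p"
  unfolding contains_pattern_def
proof (intro exI[of _ "(!) [a, b, c, d]"] conjI)
  have four: "x < 4 \<longleftrightarrow> x = 0 \<or> x = 1 \<or> x = 2 \<or> x = 3" for x :: nat by auto
  show "strict_mono_on {..<length p} ((!) [a, b, c, d])"
  proof (rule strict_mono_onI)
    fix x y assume "x \<in> {..<length p}" "y \<in> {..<length p}" "x < y"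
    then have "(x = 0 \<and> y = 1) \<or> (x = 0 \<and> y = 2) \<or> (x = 0 \<and> y = 3) \<or> (x = 1 \<and> y = 2) \<or>
      (x = 1 \<and> y = 3) \<or> (x = 2 \<and> y = 3)"
      unfolding len lessThan_iff by presburger
    then show "[a, b, c, d] ! x < [a, b, c, d] ! y"
      using assms(1-3) by (elim disjE conjE) simp_all
  qed
  show "(!) [a, b, c, d] ` {..<length p} \<subseteq> {..<n}"
    using assms(1-4) by (auto simp: len four)
  show "\<forall>x<length p. \<forall>y<length p. v ([a, b, c, d] ! x) < v ([a, b, c, d] ! y) \<longleftrightarrow> p ! x < p ! y"
    using eq unfolding len four by blast
qed

section \<open>Column reversal and positive minors\<close>

text \<open>Expansion along row 0: the minors are again reversals, and reversing the order of
  summation contributes (-1)^s.\<close>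

lemma det_reverse_columns:
  fixes A :: "nat \<Rightarrow> nat \<Rightarrow> 'a :: comm_ring_1"
  shows "det (mat s s (\<lambda>(a, b). A a (s - 1 - b))) = (-1) ^ (s choose 2) * det (mat s s (\<lambda>(a, b). A a b))"
proof (induction s arbitrary: A)
  case (Suc s)
  let ?X = "mat (Suc s) (Suc s) (\<lambda>(a, b). A a b)" and ?Y = "mat (Suc s) (Suc s) (\<lambda>(a, b). A a (Suc s - 1 - b))"
  define g where "g c = (-1) ^ (s choose 2) * ((-1) ^ (s - c) * (A 0 c * det (mat_delete ?X 0 c)))" for c
  have "det ?Y = (\<Sum>b<Suc s. ?Y $$ (0, b) * cofactor ?Y 0 b)"
    by (rule laplace_expansion_row) auto
  also have "\<dots> = (\<Sum>b<Suc s. g (Suc s - Suc b))"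
  proof (rule sum.cong)
    fix b assume b: "b \<in> {..<Suc s}"
    have "mat_delete ?Y 0 b = mat s s (\<lambda>(a, c). A (Suc a) (insert_index (s - b) (s - 1 - c)))"
      using b by (intro eq_matI) (auto simp: mat_delete_def insert_index_def Suc_diff_Suc)
    also have "det \<dots> = (-1) ^ (s choose 2) * det (mat s s (\<lambda>(a, c). A (Suc a) (insert_index (s - b) c)))"
      by (rule Suc.IH)
    also have "mat s s (\<lambda>(a, c). A (Suc a) (insert_index (s - b) c)) = mat_delete ?X 0 (s - b)"
      by (intro eq_matI) (auto simp: mat_delete_def insert_index_def)
    finally show "?Y $$ (0, b) * cofactor ?Y 0 b = g (Suc s - Suc b)"
      using b by (simp add: cofactor_def g_def ac_simps)
  qed simp
  also have "\<dots> = (\<Sum>c<Suc s. g c)"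
    by (rule sum.nat_diff_reindex)
  also have "\<dots> = (\<Sum>c<Suc s. (-1) ^ (Suc s choose 2) * (?X $$ (0, c) * cofactor ?X 0 c))"
  proof (rule sum.cong)
    fix c assume c: "c \<in> {..<Suc s}"
    have "(-1 :: 'a) ^ (s - c) = (-1) ^ (s + c)"
      using c by (intro neg_one_power_even) auto
    moreover have "Suc s choose 2 = s + (s choose 2)"
      by (simp add: numeral_2_eq_2)
    ultimately show "g c = (-1) ^ (Suc s choose 2) * (?X $$ (0, c) * cofactor ?X 0 c)"
      using c by (simp add: g_def cofactor_def power_add ac_simps)
  qed simp
  also have "\<dots> = (-1) ^ (Suc s choose 2) * det ?X"
    by (subst laplace_expansion_row[of ?X "Suc s" 0]) (simp_all only: mat_carrier sum_distrib_left zero_less_Suc)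
  finally show ?case .
qed (simp add: numeral_2_eq_2)

text \<open>Translates the index sets of \<open>k_positive\<close> into increasing index
  functions.\<close>

lemma pick_strict_mono:
  assumes h: "strict_mono_on {..<s} h" and a: "a < s"
  shows "pick (h ` {..<s}) a = (h a :: nat)"
proof -
  have inj: "inj_on h {..<s}"
    by (rule strict_mono_on_imp_inj_on[OF h])
  have "{x \<in> h ` {..<s}. x < h a} = h ` {..<a}"
  proof (rule Set.set_eqI)
    fix x
    show "x \<in> {x \<in> h ` {..<s}. x < h a} \<longleftrightarrow> x \<in> h ` {..<a}"
      using a strict_mono_on_less[OF h] by auto
  qed
  moreover have "card (h ` {..<a}) = a"
    using a by (subst card_image) (auto intro: inj_on_subset[OF inj])
  ultimately show ?thesis
    using pick_card_in_set[of "h a" "h ` {..<s}"] a by simp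
qed

lemma k_positive_minor:
  assumes pos: "k_positive k M" and M: "M \<in> carrier_mat m m" and s: "s \<le> k"
    and f: "strict_mono_on {..<s} f" "\<And>a. a < s \<Longrightarrow> f a < m"
    and g: "strict_mono_on {..<s} g" "\<And>a. a < s \<Longrightarrow> g a < m"
  shows "0 < det (mat s s (\<lambda>(a, b). M $$ (f a, g b)))"
proof -
  have card: "card (f ` {..<s}) = s" "card (g ` {..<s}) = s"
    using f g by (simp_all add: card_image strict_mono_on_imp_inj_on)
  have set: "{i. i < m \<and> i \<in> f ` {..<s}} = f ` {..<s}" "{i. i < m \<and> i \<in> g ` {..<s}} = g ` {..<s}"
    using f g by auto
  have "0 < det (submatrix M (f ` {..<s}) (g ` {..<s}))"
    using pos M s card f g unfolding k_positive_def by (auto simp: image_subset_iff)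
  also have "submatrix M (f ` {..<s}) (g ` {..<s}) = mat s s (\<lambda>(a, b). M $$ (f a, g b))"
    using M set card f g by (intro eq_matI) (auto simp: submatrix_def pick_strict_mono)
  finally show ?thesis .
qed

lemma length_sorted_list_of_multiset [simp]: "length (sorted_list_of_multiset R) = size R"
  by (metis mset_sorted_list_of_multiset size_mset)

lemma label_less:
  assumes "R \<in> index_multisets m n" "i < n" shows "label R i < m"
proof -
  have "label R i \<in> set (sorted_list_of_multiset R)"
    using assms unfolding label_def index_multisets_def by (intro nth_mem) simp
  then show ?thesis using assms by (auto simp: index_multisets_def)
qed

lemma label_mono:
  assumes "R \<in> index_multisets m n" "i \<le> j" "j < n" shows "label R i \<le> label R j"
  using assms unfolding label_def index_multisets_def by (intro sorted_nth_mono) auto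

lemma square_le_largest_square:
  assumes "P \<subseteq> {..<n} \<times> {..<n}" and "{a..<a + s} \<times> {b..<b + s} \<subseteq> P"
  shows "s \<le> largest_square P"
proof -
  have "s \<le> n" if sub: "{a..<a + s} \<times> {b..<b + s} \<subseteq> P" for s a b
  proof (cases s)
    case (Suc t)
    then have "(a + t, b) \<in> P" using sub by auto
    then show ?thesis using assms(1) Suc by auto
  qed simp
  then have "finite {s. \<exists>a b. {a..<a + s} \<times> {b..<b + s} \<subseteq> P}"
    by (intro finite_subset[of _ "{..n}", OF _ finite_atMost]) blast
  then show ?thesis
    unfolding largest_square_def using assms(2) by (intro Max_ge) auto
qed

lemma strict_mono_on_ge:
  assumes "strict_mono_on {..<s} (f :: nat \<Rightarrow> nat)" "a < s" shows "f 0 + a \<le> f a"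
  using assms(2)
proof (induction a)
  case (Suc a)
  then have "f a < f (Suc a)"
    using assms(1) by (auto simp: strict_mono_on_def)
  then show ?case using Suc by simp
qed simp

theorem theorem3p10:
  fixes n m k :: nat and v :: "nat \<Rightarrow> nat" and R C :: "nat multiset" and M :: "real mat"
    and P :: "(nat \<times> nat) set"
  assumes "v permutes {..<n}"
    and "avoids n v [1, 3, 2, 4]" and "avoids n v [2, 1, 4, 3]"
    and "P = Gamma_region n v (longest_element n)"
    and "k = largest_square P"
    and "R \<in> index_multisets m n" and "C \<in> index_multisets m n"
    and "M \<in> carrier_mat m m" and "k_positive k M"
  shows "(-1) ^ coxeter_length n v * det (restrict_mat (gen_submatrix M R C) P) \<ge> 0 \<and>
    ((-1) ^ coxeter_length n v * det (restrict_mat (gen_submatrix M R C) P) = 0 \<longleftrightarrow>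
      \<not> admissible n R C P)"
proof -
  note v = assms(1) and R = assms(6) and C = assms(7) and M = assms(8) and pos = assms(9)
  \<comment> \<open>Complementing the values turns 1324 into 4231 and 2143 into 3412. Reversal makes
    the column labels \<open>C'\<close> weakly decreasing.\<close>
  define w where "w = (\<lambda>i. n - 1 - v i)"
  define Q where "Q = sandwich n w"
  define N where "N = restrict_mat (gen_submatrix M R C) P"
  define X where "X = mat n n (\<lambda>(i, j). N $$ (i, n - 1 - j))"
  define C' where "C' = (\<lambda>j. label C (n - 1 - j))"
  have vn: "v i < n" if "i < n" for i
    using permutes_in_image[OF v, of i] that by simp
  have v_inj: "inj_on v A" for A
    using permutes_inj_on[OF v] .
  have w_less: "w i < w j \<longleftrightarrow> v j < v i" if "i < n" "j < n" for i j
    using vn[OF that(1)] vn[OF that(2)] by (auto simp: w_def)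
  have w: "bij_betw w {..<n} {..<n}"
  proof -
    have "inj_on w {..<n}"
    proof (rule inj_onI)
      fix i j assume ij: "i \<in> {..<n}" "j \<in> {..<n}" "w i = w j"
      then have "v i = v j" using vn[of i] vn[of j] by (auto simp: w_def)
      then show "i = j" using inj_onD[OF v_inj] by blast
    qed
    moreover have "w ` {..<n} \<subseteq> {..<n}"
      by (auto simp: w_def)
    ultimately show ?thesis
      using endo_inj_surj[of "{..<n}" w] by (auto simp: bij_betw_def)
  qed
  have av1: "avoids_4231 n w"
    unfolding avoids_4231_def
  proof (intro allI impI notI)
    fix a b c d assume *: "a < b" "b < c" "c < d" "d < n" "w d < w b \<and> w b < w c \<and> w c < w a"
    then have "v a < v c" "v c < v b" "v b < v d"
      using w_less by auto
    then have "contains_pattern n v [1, 3, 2, 4]"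
      using * by (intro contains_pattern4[of a b c d]) auto
    then show False using assms(2) by simp
  qed
  have av2: "avoids_3412 n w"
    unfolding avoids_3412_def
  proof (intro allI impI notI)
    fix a b c d assume *: "a < b" "b < c" "c < d" "d < n" "w c < w d \<and> w d < w a \<and> w a < w b"
    then have "v b < v a" "v a < v d" "v d < v c"
      using w_less by auto
    then have "contains_pattern n v [2, 1, 4, 3]"
      using * by (intro contains_pattern4[of a b c d]) auto
    then show False using assms(3) by simp
  qed
  have PQ: "(i, j) \<in> P \<longleftrightarrow> (i, n - 1 - j) \<in> Q" if j: "j < n" for i j
  proof -
    have "v k \<le> j \<longleftrightarrow> n - 1 - j \<le> w k" if "k < n" for k
      using vn[OF that] j by (auto simp: w_def)
    moreover have "j \<le> v k \<longleftrightarrow> w k \<le> n - 1 - j" if "k < n" for k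
      using vn[OF that] j by (auto simp: w_def)
    ultimately show ?thesis
      unfolding assms(4) Gamma_region_longest[OF v] Q_def mem_sandwich
      using j by (auto intro: le_less_trans)
  qed
  have QP: "(i, j) \<in> Q \<longleftrightarrow> (i, n - 1 - j) \<in> P" if "j < n" for i j
    using PQ[of "n - 1 - j" i] that by simp
  have P_sub: "P \<subseteq> {..<n} \<times> {..<n}"
    unfolding assms(4) Gamma_region_longest[OF v] by auto
  have band: "band n Q"
    unfolding Q_def by (rule band_sandwich[OF av2 bij_betw_imp_inj_on[OF w]])
  then have Q_sub: "(i, j) \<in> Q \<Longrightarrow> i < n \<and> j < n" and conv: "convex_region Q" for i j
    by (auto simp: band_def)
  have sizes: "size R = n" "size C = n"
    using R C by (auto simp: index_multisets_def)
  have N: "N \<in> carrier_mat n n"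
    by (simp add: N_def restrict_mat_def gen_submatrix_def sizes)
  have N_entry: "N $$ (i, j) = (if (i, j) \<in> P then M $$ (label R i, label C j) else 0)" if "i < n" "j < n" for i j
    using that by (simp add: N_def restrict_mat_def gen_submatrix_def sizes)
  have X: "X \<in> carrier_mat n n" by (simp add: X_def)
  have X_entry: "X $$ (i, j) = (if (i, j) \<in> Q then M $$ (label R i, C' j) else 0)" if "i < n" "j < n" for i j
    using that QP[of j i] by (simp add: X_def N_entry C'_def)
  have supp: "supported_on Q X"
    using X by (auto simp: supported_on_def X_entry)
  have minor: "(inj_on (\<lambda>a. label R (f a)) {..<s} \<and> inj_on (\<lambda>b. C' (g b)) {..<s} \<longrightarrow>
        0 < (-1) ^ (s choose 2) * det (mat s s (\<lambda>(a, b). X $$ (f a, g b)))) \<and>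
      (\<not> (inj_on (\<lambda>a. label R (f a)) {..<s} \<and> inj_on (\<lambda>b. C' (g b)) {..<s}) \<longrightarrow>
        det (mat s s (\<lambda>(a, b). X $$ (f a, g b))) = 0)"
    if f: "strict_mono_on {..<s} f" and g: "strict_mono_on {..<s} g" and fg: "\<forall>a<s. \<forall>b<s. (f a, g b) \<in> Q"
    for s f g
  proof -
    let ?D = "mat s s (\<lambda>(a, b). M $$ (label R (f a), C' (g b)))"
    have fn: "f a < n" "g a < n" if "a < s" for a
      using fg Q_sub that by blast+
    have D: "mat s s (\<lambda>(a, b). X $$ (f a, g b)) = ?D"
      using fg fn by (intro eq_matI) (simp_all add: X_entry)
    have f_le: "f a \<le> f b" "g a \<le> g b" if "a \<le> b" "b < s" for a b
      using that f g by (auto simp: strict_mono_on_leD)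
    \<comment> \<open>Convexity fills the rectangle between the extreme rows and columns of the
      minor, and it contains a square of side \<open>s\<close>. The offset \<open>?b\<close> is the
      first column of this square before reversal.\<close>
    have sk: "s \<le> k"
    proof (cases "s = 0")
      case False
      then have s: "0 < s" "s - 1 < s" by auto
      have fl: "f 0 + (s - 1) \<le> f (s - 1)" "g 0 + (s - 1) \<le> g (s - 1)"
        using strict_mono_on_ge[OF f s(2)] strict_mono_on_ge[OF g s(2)] by auto
      let ?b = "n - (g 0 + s)"
      have gs: "g 0 + s \<le> n" using fl fn(2)[OF s(2)] s by linarith
      have "{f 0..<f 0 + s} \<times> {?b..<?b + s} \<subseteq> P"
      proof clarify
        fix i j assume ij: "i \<in> {f 0..<f 0 + s}" "j \<in> {?b..<?b + s}"
        then have jn: "j < n" "g 0 \<le> n - 1 - j" "n - 1 - j \<le> g (s - 1)"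
          using gs fl s by auto
        have "f 0 \<le> i" "i \<le> f (s - 1)"
          using ij fl(1) s(1) by auto
        then have "(i, n - 1 - j) \<in> Q"
          using fg s jn
          by (intro convex_regionD[OF conv, of "f 0" "g (s - 1)" "f (s - 1)" "g 0" i "n - 1 - j"]) blast+
        then show "(i, j) \<in> P" using PQ jn by blast
      qed
      then show ?thesis
        unfolding assms(5) by (rule square_le_largest_square[OF P_sub])
    qed simp
    have pos_minor: "0 < (-1) ^ (s choose 2) * det ?D"
      if inj: "inj_on (\<lambda>a. label R (f a)) {..<s}" "inj_on (\<lambda>b. C' (g b)) {..<s}"
    proof -
      \<comment> \<open>Listing the chosen columns backwards makes their labels increasing, so that
        positivity of \<open>M\<close> applies; this second reversal produces the sign.\<close>
      define h where "h = (\<lambda>b. C' (g (s - 1 - b)))"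
      have "det ?D = det (mat s s (\<lambda>(a, b). M $$ (label R (f a), h (s - 1 - b))))"
        by (rule arg_cong[of _ _ det], rule eq_matI) (auto simp: h_def)
      also have "\<dots> = (-1) ^ (s choose 2) * det (mat s s (\<lambda>(a, b). M $$ (label R (f a), h b)))"
        by (rule det_reverse_columns[of s "\<lambda>a b. M $$ (label R (f a), h b)"])
      finally have eq: "det ?D = (-1) ^ (s choose 2) * det (mat s s (\<lambda>(a, b). M $$ (label R (f a), h b)))" .
      have "0 < det (mat s s (\<lambda>(a, b). M $$ (label R (f a), h b)))"
      proof (rule k_positive_minor[OF pos M sk])
        show "strict_mono_on {..<s} (\<lambda>a. label R (f a))"
        proof (rule strict_mono_onI)
          fix a b assume ab: "a \<in> {..<s}" "b \<in> {..<s}" "a < b"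
          then have "label R (f a) \<le> label R (f b)"
            using f_le(1)[of a b] fn by (intro label_mono[OF R]) auto
          then show "label R (f a) < label R (f b)"
            using inj_onD[OF inj(1), of a b] ab by fastforce
        qed
        show "strict_mono_on {..<s} h"
        proof (rule strict_mono_onI)
          fix a b assume ab: "a \<in> {..<s}" "b \<in> {..<s}" "a < b"
          let ?a = "s - 1 - a" and ?b = "s - 1 - b"
          have "?b \<le> ?a" "?a < s" using ab by auto
          then have "g ?b \<le> g ?a" "g ?a < n" using f_le(2) fn(2) by blast+
          then have "C' (g ?a) \<le> C' (g ?b)"
            unfolding C'_def by (intro label_mono[OF C]) auto
          moreover have "C' (g ?a) \<noteq> C' (g ?b)"
            using inj_onD[OF inj(2), of ?a ?b] ab by fastforce
          ultimately show "h a < h b" by (simp add: h_def)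
        qed
        show "label R (f a) < m" if "a < s" for a
          using label_less[OF R] fn that by blast
        show "h b < m" if "b < s" for b
          unfolding h_def C'_def using fn(2)[of "s - 1 - b"] that by (intro label_less[OF C]) auto
      qed
      then show ?thesis unfolding eq by (simp flip: mult.assoc power_add)
    qed
    have zero_minor: "det ?D = 0"
      if "\<not> (inj_on (\<lambda>a. label R (f a)) {..<s} \<and> inj_on (\<lambda>b. C' (g b)) {..<s})"
      using that unfolding de_Morgan_conj
    proof
      assume "\<not> inj_on (\<lambda>a. label R (f a)) {..<s}"
      then obtain a b where ab: "a < s" "b < s" "a \<noteq> b" "label R (f a) = label R (f b)"
        by (auto simp: inj_on_def)
      show ?thesis
        by (rule det_identical_rows[of _ s a b]) (use ab in \<open>auto simp: row_def\<close>)
    next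
      assume "\<not> inj_on (\<lambda>b. C' (g b)) {..<s}"
      then obtain a b where ab: "a < s" "b < s" "a \<noteq> b" "C' (g a) = C' (g b)"
        by (auto simp: inj_on_def)
      show ?thesis
        by (rule det_identical_columns[of _ s a b]) (use ab in \<open>auto simp: col_def\<close>)
    qed
    show ?thesis unfolding D using pos_minor zero_minor by blast
  qed
  have signed: "signed_minors Q X"
    unfolding signed_minors_def
  proof (intro allI impI)
    fix s :: nat and f g
    assume "strict_mono_on {..<s} f" "strict_mono_on {..<s} g" "\<forall>a<s. \<forall>b<s. (f a, g b) \<in> Q"
    from minor[OF this] show "0 \<le> (-1) ^ (s choose 2) * det (mat s s (\<lambda>(a, b). X $$ (f a, g b)))"
      by (cases "inj_on (\<lambda>a. label R (f a)) {..<s} \<and> inj_on (\<lambda>b. C' (g b)) {..<s}") simp_all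
  qed
  have sign: "0 \<le> (-1) ^ sym_pairs Q * det X"
    by (rule det_sign[OF band X supp signed])
  have "det X = (-1) ^ (n choose 2) * det (mat n n (\<lambda>(a, b). N $$ (a, b)))"
    unfolding X_def by (rule det_reverse_columns[of n "\<lambda>a b. N $$ (a, b)"])
  also have "mat n n (\<lambda>(a, b). N $$ (a, b)) = N"
    using N by (intro eq_matI) auto
  finally have detX: "det X = (-1) ^ (n choose 2) * det N" .
  \<comment> \<open>Each pair of positions is an inversion of exactly one of \<open>v\<close> and
    \<open>w\<close>, so the sign of the column reversal and the exponent for \<open>Q\<close>
    combine to that of \<open>coxeter_length n v\<close>.\<close>
  have "inversions n w \<union> inversions n v = {(a, b). a < b \<and> b < n}"
  proof -
    have "v a \<noteq> v b" if "a < b" for a b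
      using inj_onD[OF v_inj[of UNIV], of a b] that by auto
    then have "w b < w a \<or> v b < v a" if "a < b" "b < n" for a b
      using w_less[of b a] that by (metis less_trans linorder_neqE_nat)
    then show ?thesis by (auto simp: inversions_def)
  qed
  moreover have "inversions n w \<inter> inversions n v = {}"
  proof -
    have "\<not> (w b < w a \<and> v b < v a)" if "a < b" "b < n" for a b
      using w_less[of b a] that by simp
    then show ?thesis unfolding inversions_def by blast
  qed
  ultimately have "card (inversions n w) + coxeter_length n v = n choose 2"
    using card_Un_disjoint[OF finite_inversions[of n w] finite_inversions[of n v]] card_ordered_pairs[of n]
    by (simp add: coxeter_length_def)
  then have count: "sym_pairs Q + coxeter_length n v = n choose 2"
    using inversions_eq_sym_pairs[OF w av1 av2] by (simp add: Q_def)
  have "coxeter_length n v + (sym_pairs Q + (n choose 2)) = 2 * (n choose 2)"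
    using count by simp
  then have "even (coxeter_length n v + (sym_pairs Q + (n choose 2)))"
    by (metis dvd_triv_left)
  then have "(-1 :: real) ^ coxeter_length n v = (-1) ^ (sym_pairs Q + (n choose 2))"
    by (rule neg_one_power_even)
  then have eq: "(-1) ^ coxeter_length n v * det N = (-1) ^ sym_pairs Q * det X"
    by (simp add: detX power_add)
  have nonzero: "det N \<noteq> 0" if adm: "admissible n R C P"
  proof -
    have "strict_minors (label R) C' Q X"
      unfolding strict_minors_def
    proof (intro allI impI)
      fix s :: nat and f g
      assume "strict_mono_on {..<s} f" "strict_mono_on {..<s} g" "\<forall>a<s. \<forall>b<s. (f a, g b) \<in> Q"
        and inj: "inj_on (\<lambda>a. label R (f a)) {..<s}" "inj_on (\<lambda>b. C' (g b)) {..<s}"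
      from minor[OF this(1-3)] inj have "0 < (-1) ^ (s choose 2) * det (mat s s (\<lambda>(a, b). X $$ (f a, g b)))"
        by blast
      then show "det (mat s s (\<lambda>(a, b). X $$ (f a, g b))) \<noteq> 0"
        by fastforce
    qed
    moreover have "contiguous n (label R)"
      unfolding contiguous_def
    proof (intro allI impI)
      fix i j l assume "i \<le> j" "j \<le> l" "l < n" "label R i = label R l"
      then show "label R j = label R i"
        using label_mono[OF R, of i j] label_mono[OF R, of j l] by simp
    qed
    moreover have "contiguous n C'"
      unfolding contiguous_def C'_def
    proof (intro allI impI)
      fix i j l assume "i \<le> j" "j \<le> l" "l < n" "label C (n - 1 - i) = label C (n - 1 - l)"
      moreover from this have "n - 1 - j \<le> n - 1 - i" "n - 1 - l \<le> n - 1 - j" "n - 1 - i < n" "n - 1 - j < n"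
        by auto
      ultimately show "label C (n - 1 - j) = label C (n - 1 - i)"
        using label_mono[OF C, of "n - 1 - j" "n - 1 - i"] label_mono[OF C, of "n - 1 - l" "n - 1 - j"] by simp
    qed
    moreover have "separated_rows n (label R) Q"
      unfolding separated_rows_def
    proof (intro allI impI)
      fix x x' assume x: "x < x'" "x' < n" "label R x = label R x'"
      then have "x \<noteq> x'" "x < n"
        by auto
      then have "row_support P x \<noteq> row_support P x'"
        using adm x(2,3) unfolding admissible_def by blast
      then obtain c where c: "(x, c) \<in> P \<longleftrightarrow> (x', c) \<notin> P"
        by (auto simp: row_support_def)
      then have "c < n" using P_sub by auto
      then show "\<exists>c. (x, c) \<in> Q \<longleftrightarrow> (x', c) \<notin> Q"
        using c PQ by blast
    qed
    moreover have "separated_rows n C' (Q\<inverse>)"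
      unfolding separated_rows_def
    proof (intro allI impI)
      fix y y' assume y: "y < y'" "y' < n" "C' y = C' y'"
      then have "n - 1 - y \<noteq> n - 1 - y'" "n - 1 - y < n" "n - 1 - y' < n"
        by auto
      then have "col_support P (n - 1 - y) \<noteq> col_support P (n - 1 - y')"
        using adm y(3) unfolding admissible_def C'_def by blast
      then obtain c where "(c, n - 1 - y) \<in> P \<longleftrightarrow> (c, n - 1 - y') \<notin> P"
        by (auto simp: col_support_def)
      then show "\<exists>c. (y, c) \<in> Q\<inverse> \<longleftrightarrow> (y', c) \<notin> Q\<inverse>"
        using QP[of y c] QP[of y' c] y by auto
    qed
    ultimately have "labelled_band n Q (label R) C' X"
      using band X supp signed balanced_sandwich[OF w] sandwich_diag[OF w]
      by (auto simp: labelled_band_def Q_def)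
    then show ?thesis
      using det_nonzero detX by fastforce
  qed
  have zero: "det N = 0" if "\<not> admissible n R C P"
    using that unfolding admissible_def de_Morgan_conj
  proof
    assume "\<not> (\<forall>i<n. \<forall>j<n. i \<noteq> j \<longrightarrow> label R i = label R j \<longrightarrow> row_support P i \<noteq> row_support P j)"
    then obtain i j where ij: "i < n" "j < n" "i \<noteq> j" "label R i = label R j" "row_support P i = row_support P j"
      by blast
    then have "(i, c) \<in> P \<longleftrightarrow> (j, c) \<in> P" for c
      by (auto simp: row_support_def)
    then have "row N i = row N j"
      using N ij by (intro eq_vecI) (auto simp: N_entry)
    then show ?thesis
      by (rule det_identical_rows[OF N ij(3,1,2)])
  next
    assume "\<not> (\<forall>i<n. \<forall>j<n. i \<noteq> j \<longrightarrow> label C i = label C j \<longrightarrow> col_support P i \<noteq> col_support P j)"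
    then obtain i j where ij: "i < n" "j < n" "i \<noteq> j" "label C i = label C j" "col_support P i = col_support P j"
      by blast
    then have "(c, i) \<in> P \<longleftrightarrow> (c, j) \<in> P" for c
      by (auto simp: col_support_def)
    then have "col N i = col N j"
      using N ij by (intro eq_vecI) (auto simp: N_entry)
    then show ?thesis
      by (rule det_identical_columns[OF N ij(3,1,2)])
  qed
  show ?thesis
    unfolding N_def[symmetric] using sign eq nonzero zero by auto
qed

end
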